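(* Let $\mathfrak{g}$ be the simple complex Lie algebra of type $G_2$, whose dual Coxeter number is $g=4$. Let $A=\wedge(\mathfrak{g}\oplus\mathfrak{g})/I$ be the bigraded algebra defined in the context, let $A^{\mathfrak{g}}$ be its subalgebra of $\mathfrak{g}$-invariants, and let $S\in A^{\mathfrak{g}}$ be the invariant element of bidegree $(1,1)$ (unique up to a nonzero scalar). Then: (i) the (unital, associative) algebra $A^{\mathfrak{g}}$ is generated by $S$; (ii) $S^{g}=S^4=0$; (iii) $S^{g-1}=S^3\neq 0$.
   Context: Let $\mathfrak{g}$ be a finite dimensional simple Lie algebra over $\mathbb{C}$, with a fixed nondegenerate invariant symmetric bilinear form, used to identify $\mathfrak{g}$ with $\mathfrak{g}^*$. Let $\{x_i\}$ be an orthonormal basis of $\mathfrak{g}$ and let $f_{ijk}$ be the structure constants, $[x_i,x_j]=\sum_k f_{ijk}x_k$. Let $R=\wedge(\mathfrak{g}\oplus\mathfrak{g})$ be the exterior algebra. It is bigraded by $\mathbb{Z}_{\geq 0}^2$, with the first copy of $\mathfrak{g}$ in degree $(1,0)$ and the second in degree $(0,1)$. For $x\in\mathfrak{g}$ write $x^{(1)}$, $x^{(2)}$ for the corresponding elements of the first and second copy. The components of $R$ of degrees $(2,0)$, $(1,1)$, $(0,2)$ are $\wedge^2\mathfrak{g}$, $\mathfrak{g}\otimes\mathfrak{g}$, $\wedge^2\mathfrak{g}$, and each contains a canonical copy of $\mathfrak{g}$ (the dual of the Lie bracket), spanned respectively by the elements $\sum_{i,j}f_{ijk}x_i^{(1)}x_j^{(1)}$,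 $\sum_{i,j}f_{ijk}x_i^{(1)}x_j^{(2)}$, $\sum_{i,j}f_{ijk}x_i^{(2)}x_j^{(2)}$ for $k=1,\dots,\dim\mathfrak{g}$. Let $I$ be the two-sided ideal of $R$ generated by these three copies of $\mathfrak{g}$, and let $A=R/I$. Equivalently, $A$ is the algebra of functions on the superscheme of pairs $(X,Y)$ of odd elements of $\mathfrak{g}$ with $\{X,X\}=\{X,Y\}=\{Y,Y\}=0$, where $\{X,Y\}=XY+YX$ is the supercommutator. The algebra $A$ inherits the bigrading and an action of $\mathfrak{g}$ by derivations induced by the adjoint action; $A^{\mathfrak{g}}$ denotes the invariants. The element $S$ is the image in $A$ of $\sum_i x_i^{(1)}x_i^{(2)}$, up to a nonzero scalar (equivalently, $S=\mathrm{Tr}|_V(XY)$ for a non-trivial irreducible finite dimensional representation $V$ of $\mathfrak{g}$). *)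

theory Defs
  imports
    Complex_Main
    "HOL-Library.Poly_Mapping"
    "HOL-Library.Product_Plus"
    "HOL-Algebra.Algebraic_Closure_Type"
begin

section \<open>Simple complex Lie algebras and type $G_2$\<close>

locale lie_algebra = vector_space scale
  for scale :: "complex \<Rightarrow> 'g::ab_group_add \<Rightarrow> 'g" +
  fixes brk :: "'g \<Rightarrow> 'g \<Rightarrow> 'g"
  assumes brk_linear_left: "Vector_Spaces.linear scale scale (\<lambda>u. brk u v)"
    and brk_linear_right: "Vector_Spaces.linear scale scale (brk u)"
    and brk_alternating: "brk u u = 0"
    and jacobi: "brk u (brk v w) + brk v (brk w u) + brk w (brk u v) = 0"

locale simple_lie_algebra = lie_algebra scale brk
  for scale :: "complex \<Rightarrow> 'g::ab_group_add \<Rightarrow> 'g" and brk +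
  assumes finite_dimensional: "\<exists>S. finite S \<and> span S = UNIV"
    and nonabelian: "\<exists>u v. brk u v \<noteq> 0"
    and only_trivial_ideals:
      "subspace L \<Longrightarrow> (\<And>u v. v \<in> L \<Longrightarrow> brk u v \<in> L) \<Longrightarrow> L = {0} \<or> L = UNIV"

text \<open>A simple Lie algebra with a nondegenerate invariant symmetric bilinear form \<open>B\<close>, an
  orthonormal basis \<open>x 0, \<dots>, x (n - 1)\<close>, and its structure constants \<open>f\<close>.\<close>

locale simple_lie_algebra_with_basis = simple_lie_algebra scale brk
  for scale :: "complex \<Rightarrow> 'g::ab_group_add \<Rightarrow> 'g" and brk +
  fixes B :: "'g \<Rightarrow> 'g \<Rightarrow> complex" and n :: nat and x :: "nat \<Rightarrow> 'g"
    and f :: "nat \<Rightarrow> nat \<Rightarrow> nat \<Rightarrow> complex"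
  assumes form_linear: "Vector_Spaces.linear scale (*) (B u)"
    and form_symmetric: "B u v = B v u"
    and form_invariant: "B (brk u v) w = B u (brk v w)"
    and form_nondegenerate: "(\<And>v. B u v = 0) \<Longrightarrow> u = 0"
    and basis_spans: "span (x ` {..<n}) = UNIV"
    and basis_orthonormal: "i < n \<Longrightarrow> j < n \<Longrightarrow> B (x i) (x j) = (if i = j then 1 else 0)"
    and structure_constants:
      "i < n \<Longrightarrow> j < n \<Longrightarrow> brk (x i) (x j) = (\<Sum>k<n. scale (f i j k) (x k))"

inductive_set lie_subalgebra_generated ::
    "(complex \<Rightarrow> 'g::ab_group_add \<Rightarrow> 'g) \<Rightarrow> ('g \<Rightarrow> 'g \<Rightarrow> 'g) \<Rightarrow> 'g set \<Rightarrow> 'g set"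
  for scale brk G where
  gen: "u \<in> G \<Longrightarrow> u \<in> lie_subalgebra_generated scale brk G"
| add: "u \<in> lie_subalgebra_generated scale brk G \<Longrightarrow> v \<in> lie_subalgebra_generated scale brk G \<Longrightarrow>
    u + v \<in> lie_subalgebra_generated scale brk G"
| scale: "u \<in> lie_subalgebra_generated scale brk G \<Longrightarrow>
    scale c u \<in> lie_subalgebra_generated scale brk G"
| brk: "u \<in> lie_subalgebra_generated scale brk G \<Longrightarrow> v \<in> lie_subalgebra_generated scale brk G \<Longrightarrow>
    brk u v \<in> lie_subalgebra_generated scale brk G"

definition cartan_matrix_G2 :: "nat \<Rightarrow> nat \<Rightarrow> int" where
  "cartan_matrix_G2 i j = (if i = j then 2 else if i = 0 then -1 else -3)"

text \<open>Generation by Chevalley generators subject to the Chevalley--Serre relations of the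
  $l \times l$ Cartan matrix \<open>a\<close>, with the convention $a_{ij} = \alpha_j(h_i)$. By Serre's theorem
  the relations present the semisimple Lie algebra with Cartan matrix \<open>a\<close>; a nonzero simple Lie
  algebra so generated is that algebra when \<open>a\<close> is indecomposable.\<close>

definition chevalley_serre_generated ::
    "(complex \<Rightarrow> 'g::ab_group_add \<Rightarrow> 'g) \<Rightarrow> ('g \<Rightarrow> 'g \<Rightarrow> 'g) \<Rightarrow> nat \<Rightarrow> (nat \<Rightarrow> nat \<Rightarrow> int) \<Rightarrow> bool"
  where
  "chevalley_serre_generated scale brk l a \<longleftrightarrow> (\<exists>e f h.
     lie_subalgebra_generated scale brk (e ` {..<l} \<union> f ` {..<l} \<union> h ` {..<l}) = UNIV \<and>
     (\<forall>i<l. \<forall>j<l.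
        brk (h i) (h j) = 0 \<and>
        brk (e i) (f j) = (if i = j then h i else 0) \<and>
        brk (h i) (e j) = scale (of_int (a i j)) (e j) \<and>
        brk (h i) (f j) = scale (- of_int (a i j)) (f j) \<and>
        (i \<noteq> j \<longrightarrow> (brk (e i) ^^ nat (1 - a i j)) (e j) = 0 \<and>
                 (brk (f i) ^^ nat (1 - a i j)) (f j) = 0)))"

definition type_G2 :: "(complex \<Rightarrow> 'g::ab_group_add \<Rightarrow> 'g) \<Rightarrow> ('g \<Rightarrow> 'g \<Rightarrow> 'g) \<Rightarrow> bool" where
  "type_G2 scale brk \<longleftrightarrow> chevalley_serre_generated scale brk 2 cartan_matrix_G2"


section \<open>The free associative algebra on a set\<close>

text \<open>Words form the free monoid, written additively so that the convolution product of
  \<^typ>\<open>'a \<Rightarrow>\<^sub>0 'b\<close> applies: \<open>'v word \<Rightarrow>\<^sub>0 complex\<close> is the free unital associative algebra on \<open>'v\<close>.\<close>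

datatype 'v word = Word (letters: "'v list")

instantiation word :: (type) monoid_add
begin

definition zero_word :: "'v word" where "zero_word = Word []"

definition plus_word :: "'v word \<Rightarrow> 'v word \<Rightarrow> 'v word" where
  "plus_word u w = Word (letters u @ letters w)"

instance by standard (simp_all add: zero_word_def plus_word_def)

end

type_synonym 'v free_alg = "'v word \<Rightarrow>\<^sub>0 complex"

abbreviation free_ring :: "'v free_alg ring" where
  "free_ring \<equiv> ring_of_type_algebra"

definition letter :: "'v \<Rightarrow> 'v free_alg" where
  "letter v = Poly_Mapping.single (Word [v]) 1"

definition const :: "complex \<Rightarrow> 'v free_alg" where
  "const c = Poly_Mapping.single 0 c"

text \<open>The linear extension to the free algebra of the derivation with \<open>v \<mapsto> d v\<close> on letters.\<close>

definition free_derivation :: "('v \<Rightarrow> 'v) \<Rightarrow> 'v free_alg \<Rightarrow> 'v free_alg" where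
  "free_derivation d p = (\<Sum>w\<in>Poly_Mapping.keys p. \<Sum>i<length (letters w).
     Poly_Mapping.single (Word ((letters w)[i := d (letters w ! i)])) (Poly_Mapping.lookup p w))"


section \<open>The exterior algebra\<close>

text \<open>The exterior algebra of a complex vector space \<open>'v\<close>. The first two families of relations
  turn the free algebra on the underlying set of \<open>'v\<close> into the tensor algebra.\<close>

definition exterior_relations ::
    "(complex \<Rightarrow> 'v::ab_group_add \<Rightarrow> 'v) \<Rightarrow> 'v free_alg set" where
  "exterior_relations scale =
     {letter (u + v) - letter u - letter v | u v. True} \<union>
     {letter (scale c v) - const c * letter v | c v. True} \<union>
     {letter v * letter v | v. True}"

definition exterior_ideal ::
    "(complex \<Rightarrow> 'v::ab_group_add \<Rightarrow> 'v) \<Rightarrow> 'v free_alg set" where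
  "exterior_ideal scale = Idl\<^bsub>free_ring\<^esub> (exterior_relations scale)"

definition exterior_algebra ::
    "(complex \<Rightarrow> 'v::ab_group_add \<Rightarrow> 'v) \<Rightarrow> 'v free_alg set ring" where
  "exterior_algebra scale = free_ring Quot exterior_ideal scale"

definition exterior_class ::
    "(complex \<Rightarrow> 'v::ab_group_add \<Rightarrow> 'v) \<Rightarrow> 'v free_alg \<Rightarrow> 'v free_alg set" where
  "exterior_class scale p = exterior_ideal scale +>\<^bsub>free_ring\<^esub> p"

text \<open>The map induced on \<open>R Quot I\<close> by an additive map \<open>T\<close> of \<open>R\<close> with \<open>T ` I \<subseteq> I\<close>.\<close>

definition quot_map :: "('r, 'm) ring_scheme \<Rightarrow> 'r set \<Rightarrow> ('r \<Rightarrow> 'r) \<Rightarrow> 'r set \<Rightarrow> 'r set" where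
  "quot_map R I T C = (\<Union>r\<in>C. I +>\<^bsub>R\<^esub> T r)"


section \<open>The algebra \<open>A\<close>\<close>

text \<open>In the following \<open>scale\<close> is the scalar multiplication of the Lie algebra, \<open>x\<close> its
  orthonormal basis and \<open>f\<close> the structure constants.\<close>

definition scale2 :: "(complex \<Rightarrow> 'g \<Rightarrow> 'g) \<Rightarrow> complex \<Rightarrow> 'g \<times> 'g \<Rightarrow> 'g \<times> 'g" where
  "scale2 scale c = map_prod (scale c) (scale c)"

abbreviation letter1 :: "'g::ab_group_add \<Rightarrow> ('g \<times> 'g) free_alg" where
  "letter1 u \<equiv> letter (u, 0)"

abbreviation letter2 :: "'g::ab_group_add \<Rightarrow> ('g \<times> 'g) free_alg" where
  "letter2 u \<equiv> letter (0, u)"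

definition bracket_elements ::
    "nat \<Rightarrow> (nat \<Rightarrow> 'g::ab_group_add) \<Rightarrow> (nat \<Rightarrow> nat \<Rightarrow> nat \<Rightarrow> complex) \<Rightarrow> ('g \<times> 'g) free_alg set" where
  "bracket_elements n x f = (\<Union>k<n.
     {\<Sum>i<n. \<Sum>j<n. const (f i j k) * letter1 (x i) * letter1 (x j),
      \<Sum>i<n. \<Sum>j<n. const (f i j k) * letter1 (x i) * letter2 (x j),
      \<Sum>i<n. \<Sum>j<n. const (f i j k) * letter2 (x i) * letter2 (x j)})"

definition ideal_I ::
    "(complex \<Rightarrow> 'g::ab_group_add \<Rightarrow> 'g) \<Rightarrow> nat \<Rightarrow> (nat \<Rightarrow> 'g) \<Rightarrow>
     (nat \<Rightarrow> nat \<Rightarrow> nat \<Rightarrow> complex) \<Rightarrow> ('g \<times> 'g) free_alg set set" where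
  "ideal_I scale n x f =
     Idl\<^bsub>exterior_algebra (scale2 scale)\<^esub> (exterior_class (scale2 scale) ` bracket_elements n x f)"

definition algebra_A ::
    "(complex \<Rightarrow> 'g::ab_group_add \<Rightarrow> 'g) \<Rightarrow> nat \<Rightarrow> (nat \<Rightarrow> 'g) \<Rightarrow>
     (nat \<Rightarrow> nat \<Rightarrow> nat \<Rightarrow> complex) \<Rightarrow> ('g \<times> 'g) free_alg set set ring" where
  "algebra_A scale n x f = exterior_algebra (scale2 scale) Quot ideal_I scale n x f"

definition A_class ::
    "(complex \<Rightarrow> 'g::ab_group_add \<Rightarrow> 'g) \<Rightarrow> nat \<Rightarrow> (nat \<Rightarrow> 'g) \<Rightarrow>
     (nat \<Rightarrow> nat \<Rightarrow> nat \<Rightarrow> complex) \<Rightarrow> ('g \<times> 'g) free_alg \<Rightarrow> ('g \<times> 'g) free_alg set set" where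
  "A_class scale n x f p =
     ideal_I scale n x f +>\<^bsub>exterior_algebra (scale2 scale)\<^esub> exterior_class (scale2 scale) p"

text \<open>The structure map of the complex algebra \<open>A\<close>.\<close>

definition A_scalar ::
    "(complex \<Rightarrow> 'g::ab_group_add \<Rightarrow> 'g) \<Rightarrow> nat \<Rightarrow> (nat \<Rightarrow> 'g) \<Rightarrow>
     (nat \<Rightarrow> nat \<Rightarrow> nat \<Rightarrow> complex) \<Rightarrow> complex \<Rightarrow> ('g \<times> 'g) free_alg set set" where
  "A_scalar scale n x f c = A_class scale n x f (const c)"

definition A_bidegree ::
    "(complex \<Rightarrow> 'g::ab_group_add \<Rightarrow> 'g) \<Rightarrow> nat \<Rightarrow> (nat \<Rightarrow> 'g) \<Rightarrow>
     (nat \<Rightarrow> nat \<Rightarrow> nat \<Rightarrow> complex) \<Rightarrow> nat \<Rightarrow> nat \<Rightarrow> ('g \<times> 'g) free_alg set set set" where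
  "A_bidegree scale n x f p q = A_class scale n x f `
     {t. \<forall>w\<in>Poly_Mapping.keys t. \<exists>us :: ('g + 'g) list.
        w = Word (map (case_sum (\<lambda>u. (u, 0)) (\<lambda>u. (0, u))) us) \<and>
        length (filter isl us) = p \<and> length (filter (\<lambda>s. \<not> isl s) us) = q}"

definition A_action ::
    "(complex \<Rightarrow> 'g::ab_group_add \<Rightarrow> 'g) \<Rightarrow> ('g \<Rightarrow> 'g \<Rightarrow> 'g) \<Rightarrow> nat \<Rightarrow> (nat \<Rightarrow> 'g) \<Rightarrow>
     (nat \<Rightarrow> nat \<Rightarrow> nat \<Rightarrow> complex) \<Rightarrow> 'g \<Rightarrow>
     ('g \<times> 'g) free_alg set set \<Rightarrow> ('g \<times> 'g) free_alg set set" where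
  "A_action scale brk n x f y =
     quot_map (exterior_algebra (scale2 scale)) (ideal_I scale n x f)
       (quot_map free_ring (exterior_ideal (scale2 scale))
         (free_derivation (map_prod (brk y) (brk y))))"

definition A_invariants ::
    "(complex \<Rightarrow> 'g::ab_group_add \<Rightarrow> 'g) \<Rightarrow> ('g \<Rightarrow> 'g \<Rightarrow> 'g) \<Rightarrow> nat \<Rightarrow> (nat \<Rightarrow> 'g) \<Rightarrow>
     (nat \<Rightarrow> nat \<Rightarrow> nat \<Rightarrow> complex) \<Rightarrow> ('g \<times> 'g) free_alg set set set" where
  "A_invariants scale brk n x f =
     {a \<in> carrier (algebra_A scale n x f).
        \<forall>y. A_action scale brk n x f y a = \<zero>\<^bsub>algebra_A scale n x f\<^esub>}"

definition S_element ::
    "(complex \<Rightarrow> 'g::ab_group_add \<Rightarrow> 'g) \<Rightarrow> nat \<Rightarrow> (nat \<Rightarrow> 'g) \<Rightarrow>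
     (nat \<Rightarrow> nat \<Rightarrow> nat \<Rightarrow> complex) \<Rightarrow> ('g \<times> 'g) free_alg set set" where
  "S_element scale n x f = A_class scale n x f (\<Sum>i<n. letter1 (x i) * letter2 (x i))"

text \<open>The unital subalgebra generated by \<open>G\<close> in a ring \<open>A\<close> that is a complex algebra through the
  structure map \<open>s\<close>.\<close>

inductive_set subalgebra_generated ::
    "('r, 'm) ring_scheme \<Rightarrow> (complex \<Rightarrow> 'r) \<Rightarrow> 'r set \<Rightarrow> 'r set"
  for A s G where
  scalar: "s c \<in> subalgebra_generated A s G"
| gen: "a \<in> G \<Longrightarrow> a \<in> subalgebra_generated A s G"
| add: "a \<in> subalgebra_generated A s G \<Longrightarrow> b \<in> subalgebra_generated A s G \<Longrightarrow>
    a \<oplus>\<^bsub>A\<^esub> b \<in> subalgebra_generated A s G"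
| mult: "a \<in> subalgebra_generated A s G \<Longrightarrow> b \<in> subalgebra_generated A s G \<Longrightarrow>
    a \<otimes>\<^bsub>A\<^esub> b \<in> subalgebra_generated A s G"

end

(* Dually to A = R/I, consider the linear functionals on A: the multilinear alternating functions of
   lists in g + g that vanish on the contractions with the bracket.  Splitting a functional by its
   arguments turns it into a pair of such forms on g.

   On a p-form annihilating the bracket contractions the Casimir operator acts by p times its
   eigenvalue on g, because its cross terms are bracket contractions.  Go through the weight basis of
   g downwards from the highest root vector e5: the value of a form at (u, t), where t is one of the
   lists [], [e5], [e4, e5], [e3, e4, e5], is a highest weight value as soon as the values at all
   earlier u vanish, and comparing Casimir eigenvalues forces it to vanish except for a single u,
   which leads to the next list, and for no u at all after [e3, e4, e5].  So an f-stable space of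
   p-forms is detected by one value for p <= 3, and there are no 4-forms.  An invariant functional
   therefore lives in bidegrees (k, k) with k <= 3, is unique there up to a scalar, and S^4 = 0.

   For S^3 <> 0, take the reproducing kernel of the 3-forms for the Hermitian product given by the
   compact real form.  It is an invariant pair of 3-forms with nonzero trace.  Its contraction over
   the mixed bracket relation is an equivariant map from g to pairs of 2-forms, determined by its
   values on the Cartan subalgebra at the extremal pair; two linear relations, one from ad e0 and one
   from the Casimir element, show that it is zero.  Hence the kernel defines a functional on A whose
   value at S^3 is, up to a nonzero scalar, the trace.

   Complete reducibility, needed to see that invariants are detected by invariant functionals, comes
   from orthogonal projection: the compact real form acts by skew-Hermitian operators. *)
theory Submission
  imports Defs
begin

section \<open>Multilinear functions on lists\<close>

text \<open>The four lists of the overview come from Kostant's description of the top Casimir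
  eigenspaces of an exterior algebra: they are spanned by wedges of commuting elements, with highest
  weight vectors the wedges over abelian ideals of a Borel subalgebra. Type G2 has exactly four such
  ideals, one in each of the dimensions 0, 1, 2, 3, so the largest dimension is g - 1. Comparing
  eigenvalues at the 14 weights of the Lie algebra recovers them.

  The exterior algebra on 28 generators is too large for explicit calculation. Hence statements
  about A become statements about functions on lists, where a relation is tested in place with all
  other arguments fixed, and the bracket table is kept to simple root vectors and a few coroots.

  The main obstacle is one functional on A that sees S^3. A pair of 3-forms satisfies the relations
  inside each copy by definition, but the mixed relation ties the two copies together and has to be
  derived from invariance. Functionals dual to the lower powers are then obtained from this one by
  multiplication with powers of S.\<close>

fun der :: "('v \<Rightarrow> 'v) \<Rightarrow> ('v list \<Rightarrow> complex) \<Rightarrow> 'v list \<Rightarrow> complex" where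
  "der d w [] = 0"
| "der d w (u # us) = w (d u # us) + der d (\<lambda>t. w (u # t)) us"

lemma der_add: "der d (\<lambda>t. w t + w' t) us = der d w us + der d w' us"
  by (induction us arbitrary: w w') simp_all

lemma der_scale: "der d (\<lambda>t. c * w t) us = c * der d w us"
  by (induction us arbitrary: w) (simp_all add: algebra_simps)

lemma der_0 [simp]: "der d (\<lambda>t. 0) us = 0"
  using der_scale[of d 0 "\<lambda>t. 0" us] by simp

lemma der_minus: "der d (\<lambda>t. - w t) us = - der d w us"
  using der_scale[of d "-1" w us] by simp

lemma der_sum: "der d (\<lambda>t. \<Sum>i\<in>I. w i t) us = (\<Sum>i\<in>I. der d (w i) us)"
  by (induction I rule: infinite_finite_induct) (simp_all add: der_add)

lemma der_cong_length:
  "(\<And>t. length t = length us \<Longrightarrow> w t = w' t) \<Longrightarrow> der d w us = der d w' us"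
proof (induction us arbitrary: w w')
  case (Cons u us)
  have "der d (\<lambda>t. w (u # t)) us = der d (\<lambda>t. w' (u # t)) us"
    using Cons.prems by (intro Cons.IH) simp
  then show ?case using Cons.prems by simp
qed simp

lemma der_eq_0: "(\<And>t. length t = length us \<Longrightarrow> w t = 0) \<Longrightarrow> der d w us = 0"
  using der_cong_length[of us w "\<lambda>t. 0" d] by simp

lemma der_append:
  "der d w (us @ vs) = der d (\<lambda>t. w (t @ vs)) us + der d (\<lambda>t. w (us @ t)) vs"
  by (induction us arbitrary: w) simp_all

lemma der_map_add:
  "(\<And>l r u v. w (l @ (u + v) # r) = w (l @ u # r) + w (l @ v # r)) \<Longrightarrow>
    der (\<lambda>u. d u + d' u) w us = der d w us + der d' w us"
proof (induction us arbitrary: w)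
  case (Cons u us)
  have "w ((d u + d' u) # us) = w (d u # us) + w (d' u # us)"
    using Cons.prems[of "[]"] by simp
  moreover have "der (\<lambda>u. d u + d' u) (\<lambda>t. w (u # t)) us
      = der d (\<lambda>t. w (u # t)) us + der d' (\<lambda>t. w (u # t)) us"
    using Cons.prems[of "u # _"] by (intro Cons.IH) simp
  ultimately show ?case by simp
qed simp

definition mlin :: "(complex \<Rightarrow> 'v::ab_group_add \<Rightarrow> 'v) \<Rightarrow> ('v list \<Rightarrow> complex) \<Rightarrow> bool" where
  "mlin s w \<longleftrightarrow> (\<forall>l r u v. w (l @ (u + v) # r) = w (l @ u # r) + w (l @ v # r)) \<and>
     (\<forall>l r c u. w (l @ s c u # r) = c * w (l @ u # r))"

lemma mlinI:
  "(\<And>l r u v. w (l @ (u + v) # r) = w (l @ u # r) + w (l @ v # r)) \<Longrightarrow>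
   (\<And>l r c u. w (l @ s c u # r) = c * w (l @ u # r)) \<Longrightarrow> mlin s w"
  by (simp add: mlin_def)

lemma mlin_plus: "mlin s w \<Longrightarrow> w (l @ (u + v) # r) = w (l @ u # r) + w (l @ v # r)"
  by (simp add: mlin_def)

lemma mlin_scale: "mlin s w \<Longrightarrow> w (l @ s c u # r) = c * w (l @ u # r)"
  by (simp add: mlin_def)

lemma mlin_plus0: "mlin s w \<Longrightarrow> w ((u + v) # r) = w (u # r) + w (v # r)"
  using mlin_plus[of s w "[]"] by simp

lemma mlin_scale0: "mlin s w \<Longrightarrow> w (s c u # r) = c * w (u # r)"
  using mlin_scale[of s w "[]"] by simp

lemma mlin_zero: "mlin s w \<Longrightarrow> w (l @ 0 # r) = 0"
  using mlin_plus[of s w l 0 0 r] by simp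

lemma mlin_zero0: "mlin s w \<Longrightarrow> w (0 # r) = 0"
  using mlin_zero[of s w "[]"] by simp

lemma mlin_uminus: "mlin s w \<Longrightarrow> w (l @ (- u) # r) = - w (l @ u # r)"
  using mlin_plus[of s w l u "- u" r] mlin_zero[of s w l r] by (simp add: eq_neg_iff_add_eq_0 add.commute)

lemma mlin_uminus0: "mlin s w \<Longrightarrow> w ((- u) # r) = - w (u # r)"
  using mlin_uminus[of s w "[]"] by simp

lemma mlin_diff: "mlin s w \<Longrightarrow> w (l @ (u - v) # r) = w (l @ u # r) - w (l @ v # r)"
  using mlin_plus[of s w l u "- v" r] mlin_uminus[of s w l v r] by simp

lemma mlin_diff0: "mlin s w \<Longrightarrow> w ((u - v) # r) = w (u # r) - w (v # r)"
  using mlin_diff[of s w "[]"] by simp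

lemma mlin_sum: "mlin s w \<Longrightarrow> w (l @ (\<Sum>i\<in>I. z i) # r) = (\<Sum>i\<in>I. w (l @ z i # r))"
  by (induction I rule: infinite_finite_induct) (simp_all add: mlin_zero mlin_plus)

lemma mlin_sum0: "mlin s w \<Longrightarrow> w ((\<Sum>i\<in>I. z i) # r) = (\<Sum>i\<in>I. w (z i # r))"
  using mlin_sum[of s w "[]"] by simp

lemma alternating_swap:
  assumes "mlin s w" "\<And>u. w (l @ u # u # r) = 0"
  shows "w (l @ u # v # r) = - w (l @ v # u # r)"
proof -
  have "w (l @ (u + v) # (u + v) # r) = w (l @ u # (u + v) # r) + w (l @ v # (u + v) # r)"
    by (rule mlin_plus[OF assms(1)])
  moreover have "w (l @ a # (u + v) # r) = w (l @ a # u # r) + w (l @ a # v # r)" for a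
    using mlin_plus[OF assms(1), of "l @ [a]" u v r] by simp
  ultimately have "w (l @ u # v # r) + w (l @ v # u # r) = 0"
    by (simp only: assms(2) add_0 add_0_right)
  then show ?thesis by (simp only: eq_neg_iff_add_eq_0)
qed

lemma mlin_ctx: "mlin s w \<Longrightarrow> mlin s (\<lambda>t. w (a @ t @ b))"
  unfolding mlin_def by (metis append.assoc append_Cons)

lemma mlin_Cons: "mlin s w \<Longrightarrow> mlin s (\<lambda>t. w (a # t))"
  using mlin_ctx[of s w "[a]" "[]"] by simp

lemma mlin_add_fun: "mlin s w \<Longrightarrow> mlin s w' \<Longrightarrow> mlin s (\<lambda>t. w t + w' t)"
  by (simp add: mlin_def algebra_simps)

lemma mlin_scale_fun: "mlin s w \<Longrightarrow> mlin s (\<lambda>t. c * w t)"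
  by (simp add: mlin_def algebra_simps)

lemma mlin_der:
  assumes w: "mlin s w" and add: "\<And>u v. d (u + v) = d u + d v" and sc: "\<And>c u. d (s c u) = s c (d u)"
  shows "mlin s (der d w)"
proof (rule mlinI)
  fix l r u v
  have "der d (\<lambda>t. w (t @ (u + v) # r)) l = der d (\<lambda>t. w (t @ u # r)) l + der d (\<lambda>t. w (t @ v # r)) l"
    by (simp add: mlin_plus[OF w] der_add)
  moreover have "der d (\<lambda>t. w (l @ (u + v) # t)) r = der d (\<lambda>t. w (l @ u # t)) r + der d (\<lambda>t. w (l @ v # t)) r"
    by (simp add: mlin_plus[OF w] der_add)
  ultimately show "der d w (l @ (u + v) # r) = der d w (l @ u # r) + der d w (l @ v # r)"
    by (simp add: der_append add mlin_plus[OF w])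
next
  fix l r c u
  have "der d (\<lambda>t. w (t @ s c u # r)) l = c * der d (\<lambda>t. w (t @ u # r)) l"
    by (simp add: mlin_scale[OF w] der_scale)
  moreover have "der d (\<lambda>t. w (l @ s c u # t)) r = c * der d (\<lambda>t. w (l @ u # t)) r"
    by (simp add: mlin_scale[OF w] der_scale)
  ultimately show "der d w (l @ s c u # r) = c * der d w (l @ u # r)"
    by (simp add: der_append sc mlin_scale[OF w] algebra_simps)
qed

lemma der_map_scale:
  assumes "mlin s w" shows "der (\<lambda>u. s c (d u)) w us = c * der d w us"
  using assms
proof (induction us arbitrary: w)
  case (Cons u us)
  show ?case using Cons.IH[OF mlin_Cons[OF Cons.prems, of u]] mlin_scale0[OF Cons.prems]
    by (simp add: algebra_simps)
qed simp

lemma der_map_sum: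
  assumes "mlin s w" shows "der (\<lambda>u. \<Sum>i\<in>I. d i u) w us = (\<Sum>i\<in>I. der (d i) w us)"
  using assms
proof (induction us arbitrary: w)
  case (Cons u us)
  show ?case using Cons.IH[OF mlin_Cons[OF Cons.prems, of u]] mlin_sum0[OF Cons.prems]
    by (simp add: sum.distrib)
qed simp

text \<open>\<open>der\<close> is the transpose of the derivation of the tensor algebra extending
  \<open>d\<close>, so the operators on the right-hand side appear in the opposite order.\<close>

lemma der_commutator:
  assumes "mlin s w"
  shows "der (\<lambda>u. d (d' u) - d' (d u)) w us = der d' (der d w) us - der d (der d' w) us"
  using assms
proof (induction us arbitrary: w)
  case (Cons u us)
  have "der d' (der d w) (u # us) - der d (der d' w) (u # us) =
     w (d (d' u) # us) - w (d' (d u) # us)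
     + (der d' (der d (\<lambda>t. w (u # t))) us - der d (der d' (\<lambda>t. w (u # t))) us)"
    by (simp add: der_add)
  then show ?case using Cons.IH[OF mlin_Cons[OF Cons.prems, of u]] mlin_diff0[OF Cons.prems]
    by simp
qed simp

text \<open>Without a clause for zero this set is empty when \<open>G\<close> is; otherwise zero
  arises by scaling a member with 0, which is how \<open>lin_hull_zero\<close> and later uses obtain
  it.\<close>

inductive_set lin_hull :: "('w \<Rightarrow> complex) set \<Rightarrow> ('w \<Rightarrow> complex) set" for G where
  base: "w \<in> G \<Longrightarrow> w \<in> lin_hull G"
| add: "w \<in> lin_hull G \<Longrightarrow> w' \<in> lin_hull G \<Longrightarrow> (\<lambda>t. w t + w' t) \<in> lin_hull G"
| scale: "w \<in> lin_hull G \<Longrightarrow> (\<lambda>t. c * w t) \<in> lin_hull G"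

subsection \<open>Words in a finite spanning family\<close>

fun words :: "'j set \<Rightarrow> nat \<Rightarrow> 'j list set" where
  "words J 0 = {[]}"
| "words J (Suc d) = (\<lambda>(i, w). i # w) ` (J \<times> words J d)"

lemma finite_words: "finite J \<Longrightarrow> finite (words J d)"
  by (induction d) auto

lemma length_words: "w \<in> words J d \<Longrightarrow> length w = d"
  by (induction d arbitrary: w) auto

lemma sum_words_Suc:
  assumes "finite J"
  shows "(\<Sum>w\<in>words J (Suc d). g w) = (\<Sum>i\<in>J. \<Sum>w\<in>words J d. g (i # w))"
proof -
  have "inj_on (\<lambda>(i, w). i # w) (J \<times> words J d)" by (auto simp: inj_on_def)
  then show ?thesis
    using assms by (simp add: sum.reindex sum.cartesian_product finite_words o_def case_prod_unfold)
qed

fun coord :: "('j \<Rightarrow> 'v \<Rightarrow> complex) \<Rightarrow> 'j list \<Rightarrow> 'v list \<Rightarrow> complex" where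
  "coord c [] [] = 1"
| "coord c (i # w) (u # us) = c i u * coord c w us"
| "coord c _ _ = 0"

lemma mlin_expand:
  assumes J: "finite J" and c: "\<And>u. u = (\<Sum>i\<in>J. s (c i u) (z i))" and "mlin s w"
  shows "w us = (\<Sum>u\<in>words J (length us). coord c u us * w (map z u))"
  using \<open>mlin s w\<close>
proof (induction us arbitrary: w)
  case (Cons u us)
  have "w (u # us) = w ((\<Sum>i\<in>J. s (c i u) (z i)) # us)" using c by simp
  also have "\<dots> = (\<Sum>i\<in>J. c i u * w (z i # us))"
    using Cons.prems by (simp add: mlin_sum0 mlin_scale0)
  also have "\<dots> = (\<Sum>i\<in>J. c i u * (\<Sum>v\<in>words J (length us). coord c v us * w (z i # map z v)))"
    using Cons.IH[OF mlin_Cons[OF Cons.prems]] by simp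
  also have "\<dots> = (\<Sum>v\<in>words J (length (u # us)). coord c v (u # us) * w (map z v))"
    by (simp only: list.size(4) add_Suc_right add_0_right sum_words_Suc[OF J])
       (simp add: sum_distrib_left algebra_simps)
  finally show ?case .
qed simp

lemma mlin_eq_0:
  assumes J: "finite J" and c: "\<And>u. u = (\<Sum>i\<in>J. s (c i u) (z i))" and "mlin s w"
    and "\<And>u. u \<in> words J (length us) \<Longrightarrow> w (map z u) = 0"
  shows "w us = 0"
  using mlin_expand[OF J c \<open>mlin s w\<close>, of us] assms(4) by simp

text \<open>The matrix of \<open>der d\<close> on words when \<open>d\<close> has the matrix
  \<open>M\<close> on letters. The guards \<open>u = v\<close> and \<open>i = j\<close> express that
  one position changes at a time.\<close>

fun der_matrix :: "('j \<Rightarrow> 'j \<Rightarrow> real) \<Rightarrow> 'j list \<Rightarrow> 'j list \<Rightarrow> real" where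
  "der_matrix M (i # u) (j # v) = (if u = v then M i j else 0) + (if i = j then der_matrix M u v else 0)"
| "der_matrix M _ _ = 0"

lemma der_matrix_antisym:
  assumes "\<And>i j. i \<in> J \<Longrightarrow> j \<in> J \<Longrightarrow> M i j = - M j i" and "u \<in> words J d" "v \<in> words J d"
  shows "der_matrix M u v = - der_matrix M v u"
  using assms(2,3)
proof (induction d arbitrary: u v)
  case (Suc d)
  from Suc.prems obtain i u' j v' where uv: "u = i # u'" "v = j # v'" "i \<in> J" "j \<in> J"
    "u' \<in> words J d" "v' \<in> words J d" by auto
  show ?case using Suc.IH[OF uv(5,6)] assms(1)[OF uv(3,4)] by (cases "i = j"; cases "u' = v'") (simp_all add: uv)
qed simp

lemma der_expand:
  assumes J: "finite J" and M: "\<And>i. i \<in> J \<Longrightarrow> d (z i) = (\<Sum>j\<in>J. s (of_real (M i j)) (z j))"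
    and "mlin s w" and "u \<in> words J k"
  shows "der d w (map z u) = (\<Sum>v\<in>words J k. of_real (der_matrix M u v) * w (map z v))"
  using assms(3,4)
proof (induction k arbitrary: u w)
  case (Suc k)
  from Suc.prems(2) obtain i u' where u: "u = i # u'" and i: "i \<in> J" and u': "u' \<in> words J k" by auto
  have "(\<Sum>v\<in>words J (Suc k). of_real (der_matrix M u v) * w (map z v))
     = (\<Sum>j\<in>J. \<Sum>v\<in>words J k. (if u' = v then of_real (M i j) * w (z j # map z v) else 0)
          + (if i = j then of_real (der_matrix M u' v) * w (z j # map z v) else 0))"
    unfolding sum_words_Suc[OF J] u by (intro sum.cong refl) (auto simp: algebra_simps)
  also have "\<dots> = (\<Sum>j\<in>J. of_real (M i j) * w (z j # map z u'))
       + (\<Sum>j\<in>J. if i = j then (\<Sum>v\<in>words J k. of_real (der_matrix M u' v) * w (z j # map z v)) else 0)"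
    unfolding sum.distrib using u' by (intro arg_cong2[of _ _ _ _ "(+)"] sum.cong refl)
      (auto simp: sum.delta finite_words[OF J])
  also have "\<dots> = (\<Sum>j\<in>J. of_real (M i j) * w (z j # map z u'))
       + (\<Sum>v\<in>words J k. of_real (der_matrix M u' v) * w (z i # map z v))"
    using i J by (simp add: sum.delta)
  also have "\<dots> = der d w (map z u)"
    using Suc.IH[OF mlin_Cons[OF Suc.prems(1)] u', of "z i"] M[OF i] Suc.prems(1)
    by (simp add: u mlin_sum0 mlin_scale0)
  finally show ?case ..
qed simp

text \<open>A real antisymmetric matrix is skew-Hermitian, and \<open>der_matrix\<close> inherits
  both properties from \<open>M\<close>. This is the form in which the compact real form acts in the
  later orthogonality arguments.\<close>

lemma der_skew:
  assumes J: "finite J" and M: "\<And>i. i \<in> J \<Longrightarrow> d (z i) = (\<Sum>j\<in>J. s (of_real (M i j)) (z j))"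
    and anti: "\<And>i j. i \<in> J \<Longrightarrow> j \<in> J \<Longrightarrow> M i j = - M j i"
    and w: "mlin s w" and w': "mlin s w'"
  shows "(\<Sum>u\<in>words J k. der d w (map z u) * cnj (w' (map z u)))
     = - (\<Sum>u\<in>words J k. w (map z u) * cnj (der d w' (map z u)))"
proof -
  have "(\<Sum>u\<in>words J k. der d w (map z u) * cnj (w' (map z u)))
    = (\<Sum>u\<in>words J k. \<Sum>v\<in>words J k. of_real (der_matrix M u v) * w (map z v) * cnj (w' (map z u)))"
    by (simp add: der_expand[where d = d and z = z and M = M, OF J M w] sum_distrib_right)
  also have "\<dots> = (\<Sum>v\<in>words J k. \<Sum>u\<in>words J k. of_real (der_matrix M u v) * w (map z v) * cnj (w' (map z u)))"
    by (rule sum.swap)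
  also have "\<dots> = (\<Sum>v\<in>words J k. \<Sum>u\<in>words J k. - (of_real (der_matrix M v u) * w (map z v) * cnj (w' (map z u))))"
    by (intro sum.cong refl) (metis (no_types, lifting) anti der_matrix_antisym minus_mult_left of_real_minus)
  also have "\<dots> = - (\<Sum>v\<in>words J k. w (map z v) * cnj (der d w' (map z v)))"
    by (simp add: der_expand[where d = d and z = z and M = M, OF J M w'] sum_distrib_left sum_negf algebra_simps)
  finally show ?thesis .
qed

text \<open>Gram-Schmidt along the points of \<open>W\<close>, with no basis of \<open>U\<close>
  involved: the members of \<open>U\<close> vanishing at the new point \<open>x\<close> fall under
  the induction hypothesis, and they have codimension at most one in \<open>U\<close>.\<close>

lemma projection_exists:
  fixes U :: "('w \<Rightarrow> complex) set"
  assumes "finite W" and "(\<lambda>_. 0) \<in> U"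
    and add: "\<And>u v. u \<in> U \<Longrightarrow> v \<in> U \<Longrightarrow> (\<lambda>t. u t + v t) \<in> U"
    and scale: "\<And>c u. u \<in> U \<Longrightarrow> (\<lambda>t. c * u t) \<in> U"
  shows "\<exists>u\<in>U. \<forall>v\<in>U. (\<Sum>w\<in>W. (p w - u w) * cnj (v w)) = 0"
  using assms
proof (induction W arbitrary: U p rule: finite_induct)
  case (insert x W)
  let ?ip = "\<lambda>p q. \<Sum>w\<in>insert x W. p w * cnj (q w)"
  let ?U0 = "{u \<in> U. u x = 0}"
  have IH: "\<exists>u\<in>?U0. \<forall>v\<in>?U0. ?ip (\<lambda>w. p w - u w) v = 0" for p
    using insert.IH[of ?U0 p] insert.prems insert.hyps by simp
  show ?case
  proof (cases "?U0 = U")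
    case True then show ?thesis using IH[of p] by simp
  next
    case False
    then obtain u1 where u1: "u1 \<in> U" "u1 x \<noteq> 0" by auto
    obtain u2 where u2: "u2 \<in> ?U0" "\<And>v. v \<in> ?U0 \<Longrightarrow> ?ip (\<lambda>w. u1 w - u2 w) v = 0" using IH[of u1] by blast
    \<comment> \<open>The part of \<open>u1\<close> orthogonal to \<open>?U0\<close>. Since
      \<open>u2\<close> vanishes at \<open>x\<close>, \<open>e\<close> does not, so \<open>U\<close>
      is \<open>?U0\<close> plus the multiples of \<open>e\<close>.\<close>
    define e where "e = (\<lambda>w. u1 w - u2 w)"
    have eU: "e \<in> U" using insert.prems(2)[OF u1(1) insert.prems(3)[of u2 "-1"]] u2(1) by (simp add: e_def)
    have ex: "e x \<noteq> 0" using u1 u2(1) by (simp add: e_def)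
    have e0: "?ip e v = 0" if "v \<in> ?U0" for v using u2(2)[OF that] by (simp add: e_def)
    have e0': "?ip v e = 0" if "v \<in> ?U0" for v
    proof -
      have "cnj (?ip e v) = ?ip v e" unfolding cnj_sum by (intro sum.cong refl) (simp add: mult.commute)
      then show ?thesis using e0[OF that] by (metis complex_cnj_zero)
    qed
    have "?ip e e = of_real (\<Sum>w\<in>insert x W. (cmod (e w))\<^sup>2)"
      by (simp only: of_real_sum complex_norm_square)
    moreover have "(\<Sum>w\<in>insert x W. (cmod (e w))\<^sup>2) > 0"
      using insert.hyps ex by (intro sum_pos2[of _ x]) auto
    ultimately have ee: "?ip e e \<noteq> 0" by (metis of_real_eq_0_iff less_irrefl)
    obtain u0 where u0: "u0 \<in> ?U0" "\<And>v. v \<in> ?U0 \<Longrightarrow> ?ip (\<lambda>w. p w - u0 w) v = 0" using IH[of p] by blast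
    define c where "c = ?ip p e / ?ip e e"
    define u where "u = (\<lambda>w. u0 w + c * e w)"
    have uU: "u \<in> U" unfolding u_def using u0(1) eU insert.prems(2,3) by blast
    have lin: "?ip (\<lambda>w. p w - u w) v = ?ip (\<lambda>w. p w - u0 w) v - c * ?ip e v" for v
      unfolding sum_distrib_left sum_subtractf[symmetric]
      by (intro sum.cong refl) (simp add: u_def algebra_simps)
    have "?ip (\<lambda>w. p w - u w) v = 0" if v: "v \<in> U" for v
    proof -
      \<comment> \<open>Removing this multiple of \<open>e\<close> makes the value at
        \<open>x\<close> zero, which puts the rest of \<open>v\<close> into
        \<open>?U0\<close>.\<close>
      define a where "a = v x / e x"
      define v0 where "v0 = (\<lambda>w. v w + (- a) * e w)"
      have v0: "v0 \<in> ?U0" unfolding v0_def using insert.prems(2)[OF v insert.prems(3)[OF eU, of "- a"]] ex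
        by (simp add: a_def)
      have "?ip q v = ?ip q v0 + cnj a * ?ip q e" for q
        unfolding sum_distrib_left sum.distrib[symmetric]
        by (intro sum.cong refl) (simp add: v0_def algebra_simps)
      moreover have "?ip (\<lambda>w. p w - u w) v0 = 0" using lin[of v0] u0(2)[OF v0] e0[OF v0] by simp
      moreover have "?ip (\<lambda>w. p w - u0 w) e = ?ip p e - ?ip u0 e"
        unfolding sum_subtractf[symmetric] by (intro sum.cong refl) (simp add: algebra_simps)
      then have "?ip (\<lambda>w. p w - u w) e = 0" using lin[of e] e0'[OF u0(1)] ee by (simp add: c_def)
      ultimately show ?thesis by simp
    qed
    then show ?thesis using uU by blast
  qed
qed auto

text \<open>Functions on an infinite type are compared through their values at the finitely many
  points \<open>z w\<close>; this lets \<open>U\<close> be a space of forms.\<close>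

lemma projection_exists_on:
  fixes U :: "('v \<Rightarrow> complex) set" and z :: "'w \<Rightarrow> 'v"
  assumes "finite W" and 0: "(\<lambda>_. 0) \<in> U"
    and add: "\<And>u v. u \<in> U \<Longrightarrow> v \<in> U \<Longrightarrow> (\<lambda>t. u t + v t) \<in> U"
    and scale: "\<And>c u. u \<in> U \<Longrightarrow> (\<lambda>t. c * u t) \<in> U"
  shows "\<exists>u\<in>U. \<forall>v\<in>U. (\<Sum>w\<in>W. (p w - u (z w)) * cnj (v (z w))) = 0"
proof -
  have "\<exists>u\<in>(\<lambda>u w. u (z w)) ` U. \<forall>v\<in>(\<lambda>u w. u (z w)) ` U. (\<Sum>w\<in>W. (p w - u w) * cnj (v w)) = 0"
  proof (rule projection_exists[OF assms(1)])
    show "(\<lambda>_. 0) \<in> (\<lambda>u w. u (z w)) ` U" using 0 by (intro image_eqI[of _ _ "\<lambda>_. 0"]) auto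
    show "(\<lambda>t. u t + v t) \<in> (\<lambda>u w. u (z w)) ` U"
      if uv: "u \<in> (\<lambda>u w. u (z w)) ` U" "v \<in> (\<lambda>u w. u (z w)) ` U" for u v
    proof -
      obtain a b where "a \<in> U" "b \<in> U" "u = (\<lambda>w. a (z w))" "v = (\<lambda>w. b (z w))" using uv by blast
      then show ?thesis by (intro image_eqI[of _ _ "\<lambda>t. a t + b t"]) (simp_all add: add)
    qed
    show "(\<lambda>t. c * u t) \<in> (\<lambda>u w. u (z w)) ` U" if u: "u \<in> (\<lambda>u w. u (z w)) ` U" for c u
    proof -
      obtain a where "a \<in> U" "u = (\<lambda>w. a (z w))" using u by blast
      then show ?thesis by (intro image_eqI[of _ _ "\<lambda>t. c * a t"]) (simp_all add: scale)
    qed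
  qed
  then show ?thesis by (simp only: ball_simps bex_simps)
qed

lemma sum_mult_cnj_eq_0:
  assumes "finite W" "(\<Sum>w\<in>W. g w * cnj (g w)) = 0" "w \<in> W" shows "g w = 0"
proof -
  have "complex_of_real (\<Sum>w\<in>W. (cmod (g w))\<^sup>2) = 0"
    using assms(2) by (simp only: of_real_sum complex_norm_square)
  then have "(\<Sum>w\<in>W. (cmod (g w))\<^sup>2) = 0" by (simp only: of_real_eq_0_iff)
  then show ?thesis using assms(1,3) by (simp add: sum_nonneg_eq_0_iff)
qed

subsection \<open>Quadratic relations\<close>

definition rel_fun :: "(('v \<Rightarrow> 'v \<Rightarrow> complex) \<Rightarrow> complex) \<Rightarrow> bool" where
  "rel_fun \<rho> \<longleftrightarrow> (\<forall>\<beta> \<gamma>. \<rho> (\<lambda>a b. \<beta> a b + \<gamma> a b) = \<rho> \<beta> + \<rho> \<gamma>) \<and> (\<forall>c \<beta>. \<rho> (\<lambda>a b. c * \<beta> a b) = c * \<rho> \<beta>)"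

lemma rel_fun_plus: "rel_fun \<rho> \<Longrightarrow> \<rho> (\<lambda>a b. \<beta> a b + \<gamma> a b) = \<rho> (\<lambda>a b. \<beta> a b) + \<rho> (\<lambda>a b. \<gamma> a b)"
  unfolding rel_fun_def by blast

lemma rel_fun_times: "rel_fun \<rho> \<Longrightarrow> \<rho> (\<lambda>a b. c * \<beta> a b) = c * \<rho> (\<lambda>a b. \<beta> a b)"
  unfolding rel_fun_def by blast

text \<open>The functionals on the tensor algebra modulo a two-sided ideal with quadratic
  generators. A generator is given by its evaluation \<rho> on functions of two arguments and is
  tested in every context \<open>l\<close>, \<open>r\<close>. The instances are forms on the Lie
  algebra (\<open>FRel\<close>) and functionals on A (\<open>LRel\<close>).\<close>

definition qform :: "(complex \<Rightarrow> 'v::ab_group_add \<Rightarrow> 'v) \<Rightarrow> (('v \<Rightarrow> 'v \<Rightarrow> complex) \<Rightarrow> complex) set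
    \<Rightarrow> ('v list \<Rightarrow> complex) \<Rightarrow> bool" where
  "qform s Rel w \<longleftrightarrow> mlin s w \<and> (\<forall>\<rho>\<in>Rel. \<forall>l r. \<rho> (\<lambda>a b. w (l @ a # b # r)) = 0)"

lemma qform_rel: "qform s Rel w \<Longrightarrow> \<rho> \<in> Rel \<Longrightarrow> \<rho> (\<lambda>a b. w (l @ a # b # r)) = 0"
  unfolding qform_def by blast

definition bilin :: "(complex \<Rightarrow> 'v::ab_group_add \<Rightarrow> 'v) \<Rightarrow> ('v \<Rightarrow> 'v \<Rightarrow> complex) \<Rightarrow> bool" where
  "bilin s \<beta> \<longleftrightarrow> (\<forall>u v a. \<beta> (u + v) a = \<beta> u a + \<beta> v a) \<and> (\<forall>u v a. \<beta> a (u + v) = \<beta> a u + \<beta> a v) \<and>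
    (\<forall>c u a. \<beta> (s c u) a = c * \<beta> u a) \<and> (\<forall>c u a. \<beta> a (s c u) = c * \<beta> a u)"

lemma mlin_bilin: "mlin s w \<Longrightarrow> bilin s (\<lambda>a b. w (l @ a # b # r))"
  unfolding bilin_def using mlin_plus[of s w "l @ [_]"] mlin_scale[of s w "l @ [_]"]
  by (simp add: mlin_plus mlin_scale)

lemma qform_mlin: "qform s Rel w \<Longrightarrow> mlin s w" by (simp add: qform_def)

lemma qform_ctx:
  assumes "qform s Rel w" shows "qform s Rel (\<lambda>t. w (a @ t @ b))"
  unfolding qform_def
proof (intro conjI ballI allI)
  show "mlin s (\<lambda>t. w (a @ t @ b))" using assms by (simp add: qform_def mlin_ctx)
  fix \<rho> l r assume "\<rho> \<in> Rel"
  then have "\<rho> (\<lambda>u v. w ((a @ l) @ u # v # (r @ b))) = 0" using assms unfolding qform_def by blast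
  then show "\<rho> (\<lambda>u v. w (a @ (l @ u # v # r) @ b)) = 0" by simp
qed

lemma qform_Cons: "qform s Rel w \<Longrightarrow> qform s Rel (\<lambda>t. w (a # t))"
  using qform_ctx[of s Rel w "[a]" "[]"] by simp

lemma qform_add:
  assumes R: "\<And>\<rho>. \<rho> \<in> Rel \<Longrightarrow> rel_fun \<rho>" and w: "qform s Rel w" "qform s Rel w'"
  shows "qform s Rel (\<lambda>t. w t + w' t)"
  unfolding qform_def
proof (intro conjI ballI allI)
  show "mlin s (\<lambda>t. w t + w' t)" using w by (simp add: qform_def mlin_add_fun)
  fix \<rho> l r assume "\<rho> \<in> Rel"
  then show "\<rho> (\<lambda>a b. w (l @ a # b # r) + w' (l @ a # b # r)) = 0"
    by (simp add: rel_fun_plus[of \<rho>, OF R] qform_rel[OF w(1), of \<rho>] qform_rel[OF w(2), of \<rho>])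
qed

lemma qform_scale:
  assumes R: "\<And>\<rho>. \<rho> \<in> Rel \<Longrightarrow> rel_fun \<rho>" and w: "qform s Rel w"
  shows "qform s Rel (\<lambda>t. c * w t)"
  unfolding qform_def
proof (intro conjI ballI allI)
  show "mlin s (\<lambda>t. c * w t)" using w by (simp add: qform_def mlin_scale_fun)
  fix \<rho> l r assume "\<rho> \<in> Rel"
  then show "\<rho> (\<lambda>a b. c * w (l @ a # b # r)) = 0"
    by (simp add: rel_fun_times[of \<rho>, OF R] qform_rel[OF w, of \<rho>])
qed

lemma rel_fun_0: "rel_fun \<rho> \<Longrightarrow> \<rho> (\<lambda>a b. 0) = 0"
  using rel_fun_times[of \<rho> 0 "\<lambda>a b. 0"] by simp

lemma qform_0: "(\<And>\<rho>. \<rho> \<in> Rel \<Longrightarrow> rel_fun \<rho>) \<Longrightarrow> qform s Rel (\<lambda>t. 0)"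
  unfolding qform_def by (simp add: mlin_def rel_fun_0)

lemma qform_sum:
  assumes "\<And>\<rho>. \<rho> \<in> Rel \<Longrightarrow> rel_fun \<rho>" "\<And>i. i \<in> I \<Longrightarrow> qform s Rel (w i)"
  shows "qform s Rel (\<lambda>t. \<Sum>i\<in>I. w i t)"
  using assms(2) by (induction I rule: infinite_finite_induct) (auto intro!: qform_0 qform_add assms(1))

lemma qform_lin_hull:
  assumes "\<And>\<rho>. \<rho> \<in> Rel \<Longrightarrow> rel_fun \<rho>" "\<And>w. w \<in> G \<Longrightarrow> qform s Rel w" "w \<in> lin_hull G"
  shows "qform s Rel w"
  using assms(3) by induction (simp_all add: qform_scale qform_add assms(1,2))

text \<open>Where \<open>d\<close> hits the context, the relation is evaluated in a changed context
  and vanishes; where it hits one of the two slots, the last hypothesis applies, which is the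
  stability of the relations under the derivation.\<close>

lemma qform_der:
  assumes w: "qform s Rel w" and add: "\<And>u v. d (u + v) = d u + d v" and sc: "\<And>c u. d (s c u) = s c (d u)"
    and Rel: "\<And>\<rho>. \<rho> \<in> Rel \<Longrightarrow> rel_fun \<rho>"
    and d: "\<And>\<rho> \<beta>. \<rho> \<in> Rel \<Longrightarrow> bilin s \<beta> \<Longrightarrow> (\<And>\<rho>. \<rho> \<in> Rel \<Longrightarrow> \<rho> \<beta> = 0) \<Longrightarrow>
         \<rho> (\<lambda>a b. \<beta> (d a) b + \<beta> a (d b)) = 0"
  shows "qform s Rel (der d w)"
  unfolding qform_def
proof (intro conjI ballI allI)
  show "mlin s (der d w)" using w add sc by (intro mlin_der) (auto simp: qform_def)
  fix \<rho> l r assume \<rho>: "\<rho> \<in> Rel"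
  note r = rel_fun_plus[OF Rel[OF \<rho>]]
  have z: "\<rho> (\<lambda>a b. der d (\<lambda>t. v (t @ a # b # r)) l) = 0" if "qform s Rel v" for v
    using that
  proof (induction l arbitrary: v)
    case Nil then show ?case using rel_fun_0[OF Rel[OF \<rho>]] by simp
  next
    case (Cons u l)
    have "\<rho> (\<lambda>a b. v ((d u # l) @ a # b # r)) = 0"
      using Cons.prems \<rho> unfolding qform_def by blast
    then show ?case using Cons.IH[OF qform_Cons[OF Cons.prems, of u]]
      by (simp only: append_Cons der.simps r add_0)
  qed
  have z2: "\<rho> (\<lambda>a b. w (l @ d a # b # r) + w (l @ a # d b # r)) = 0"
  proof (rule d[OF \<rho> mlin_bilin[OF qform_mlin[OF w]]])
    fix \<rho>' assume "\<rho>' \<in> Rel"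
    then show "\<rho>' (\<lambda>a b. w (l @ a # b # r)) = 0" using w by (simp add: qform_def)
  qed
  \<comment> \<open>The right context is consumed from its end, \<open>m\<close> holding the letters
    already passed.\<close>
  have z3: "\<rho> (\<lambda>a b. der d (\<lambda>t. v (a # b # t @ m)) k) = 0" if "qform s Rel v" for v k m
  proof (induction k arbitrary: m rule: rev_induct)
    case Nil then show ?case using rel_fun_0[OF Rel[OF \<rho>]] by simp
  next
    case (snoc u k)
    have "\<rho> (\<lambda>a b. v ([] @ a # b # k @ d u # m)) = 0"
      using that \<rho> unfolding qform_def by blast
    moreover have "der d (\<lambda>t. v (a # b # t @ m)) (k @ [u])
        = der d (\<lambda>t. v (a # b # t @ u # m)) k + v ([] @ a # b # k @ d u # m)" for a b
      by (simp add: der_append)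
    ultimately show ?case using snoc.IH[of "u # m"] by (simp only: r add_0)
  qed
  have "der d w (l @ a # b # r) = der d (\<lambda>t. w (t @ a # b # r)) l
      + (w (l @ d a # b # r) + w (l @ a # d b # r)) + der d (\<lambda>t. w (l @ a # b # t @ [])) r" for a b
    by (simp add: der_append)
  then show "\<rho> (\<lambda>a b. der d w (l @ a # b # r)) = 0"
    using z[OF w] z2 z3[OF qform_ctx[OF w, of l "[]"], of "[]" r]
    by (simp only: r add_0 append_Nil2 append_Nil append_Cons)
qed

section \<open>The Lie algebra of type $G_2$\<close>

context lie_algebra
begin

lemma brk_add_left: "brk (u + v) w = brk u w + brk v w"
  using brk_linear_left[of w] by (simp add: Vector_Spaces.linear_iff)

lemma brk_add_right: "brk w (u + v) = brk w u + brk w v"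
  using brk_linear_right[of w] by (simp add: Vector_Spaces.linear_iff)

lemma brk_scale_left: "brk (scale c u) w = scale c (brk u w)"
  using brk_linear_left[of w] by (simp add: Vector_Spaces.linear_iff)

lemma brk_scale_right: "brk w (scale c u) = scale c (brk w u)"
  using brk_linear_right[of w] by (simp add: Vector_Spaces.linear_iff)

lemma brk_zero_left [simp]: "brk 0 u = 0" using brk_add_left[of 0 0 u] by simp
lemma brk_zero_right [simp]: "brk u 0 = 0" using brk_add_right[of u 0 0] by simp

lemma brk_minus_left: "brk (- u) w = - brk u w"
  using brk_add_left[of u "- u" w] by (simp add: eq_neg_iff_add_eq_0 add.commute)

lemma brk_minus_right: "brk w (- u) = - brk w u"
  using brk_add_right[of w u "- u"] by (simp add: eq_neg_iff_add_eq_0 add.commute)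

lemma brk_diff_left: "brk (u - v) w = brk u w - brk v w"
  using brk_add_left[of u "- v" w] by (simp add: brk_minus_left)

lemma brk_diff_right: "brk w (u - v) = brk w u - brk w v"
  using brk_add_right[of w u "- v"] by (simp add: brk_minus_right)

lemmas brk_lin = brk_add_left brk_add_right brk_scale_left brk_scale_right brk_minus_left brk_minus_right
  brk_diff_left brk_diff_right

lemma brk_self [simp]: "brk u u = 0" by (rule brk_alternating)

lemma brk_anti: "brk u v = - brk v u"
proof -
  have "brk (u + v) (u + v) = brk u v + brk v u" by (simp add: brk_lin del: brk_self) (simp add: add.commute)
  then show ?thesis using brk_alternating[of "u + v"] by (metis eq_neg_iff_add_eq_0)
qed

lemma brk_jac: "brk u (brk v w) = brk (brk u v) w + brk v (brk u w)"
proof -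
  have "brk u (brk v w) + brk v (brk w u) + brk w (brk u v) = 0" by (rule jacobi)
  moreover have "brk v (brk w u) = - brk v (brk u w)" using brk_anti[of w u] by (simp add: brk_lin)
  moreover have "brk w (brk u v) = - brk (brk u v) w" by (rule brk_anti)
  ultimately show ?thesis by (simp add: algebra_simps)
qed

lemma brk_brk: "brk (brk u v) w = brk u (brk v w) - brk v (brk u w)"
  using brk_jac[of u v w] by simp

end

text \<open>Contraction with the invariant tensor inverse to the form. The Casimir operator, the
  bracket relations and multiplication by S are all written with it.\<close>

definition cas :: "nat \<Rightarrow> (nat \<Rightarrow> 'g) \<Rightarrow> ('g \<Rightarrow> 'g \<Rightarrow> complex) \<Rightarrow> complex" where
  "cas n x \<beta> = (\<Sum>i<n. \<beta> (x i) (x i))"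

lemma bilin_sum_left: "bilin s \<beta> \<Longrightarrow> \<beta> (\<Sum>i\<in>I. z i) u = (\<Sum>i\<in>I. \<beta> (z i) u)"
proof (induction I rule: infinite_finite_induct)
  case empty
  then have "\<beta> (0 + 0) u = \<beta> 0 u + \<beta> 0 u" unfolding bilin_def by blast
  then show ?case by simp
next
  case (infinite A)
  then have "\<beta> (0 + 0) u = \<beta> 0 u + \<beta> 0 u" unfolding bilin_def by blast
  then show ?case using infinite by simp
qed (simp add: bilin_def)

lemma bilin_sum_right: "bilin s \<beta> \<Longrightarrow> \<beta> u (\<Sum>i\<in>I. z i) = (\<Sum>i\<in>I. \<beta> u (z i))"
  using bilin_sum_left[of s "\<lambda>a b. \<beta> b a" z I u] by (simp add: bilin_def)

lemma bilinD:
  assumes "bilin s \<beta>"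
  shows "\<beta> (u + v) a = \<beta> u a + \<beta> v a" "\<beta> a (u + v) = \<beta> a u + \<beta> a v"
    "\<beta> (s c u) a = c * \<beta> u a" "\<beta> a (s c u) = c * \<beta> a u"
    "\<beta> 0 a = 0" "\<beta> a 0 = 0" "\<beta> (- u) a = - \<beta> u a" "\<beta> a (- u) = - \<beta> a u"
    "\<beta> (u - v) a = \<beta> u a - \<beta> v a" "\<beta> a (u - v) = \<beta> a u - \<beta> a v"
proof -
  note b = assms[unfolded bilin_def]
  show l: "\<beta> (u + v) a = \<beta> u a + \<beta> v a" for u v using b by blast
  show r: "\<beta> a (u + v) = \<beta> a u + \<beta> a v" for u v using b by blast
  show "\<beta> (s c u) a = c * \<beta> u a" "\<beta> a (s c u) = c * \<beta> a u" using b by blast+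
  show l0: "\<beta> 0 a = 0" and r0: "\<beta> a 0 = 0" using l[of 0 0] r[of 0 0] by simp_all
  show lm: "\<beta> (- u) a = - \<beta> u a" and rm: "\<beta> a (- u) = - \<beta> a u" for u
    using l[of u "- u"] r[of u "- u"] l0 r0 by (simp_all add: eq_neg_iff_add_eq_0 add.commute)
  show "\<beta> (u - v) a = \<beta> u a - \<beta> v a" "\<beta> a (u - v) = \<beta> a u - \<beta> a v"
    using l[of u "- v"] r[of u "- v"] lm[of v] rm[of v] by simp_all
qed

context simple_lie_algebra_with_basis
begin

lemma B_bilin: "bilin scale B"
proof -
  have r: "B u (v + w) = B u v + B u w" "B u (scale c v) = c * B u v" for u v w c
    using form_linear[of u] by (simp_all add: Vector_Spaces.linear_iff)
  then show ?thesis unfolding bilin_def using form_symmetric by metis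
qed

lemmas B_lin = bilinD[OF B_bilin]

lemma B_inv: "B (brk z u) v = - B u (brk z v)"
  using form_invariant[of u z v] brk_anti[of z u] by (simp add: B_lin)

lemma B_skew: "B u (brk z v) = - B v (brk z u)"
  using B_inv[of z u v] form_symmetric[of "brk z u" v] by simp

lemma x_expand: "u = (\<Sum>i<n. scale (B (x i) u) (x i))"
proof -
  have "u \<in> span (x ` {..<n})" using basis_spans by simp
  then show ?thesis
  proof (induction rule: span_induct_alt)
    case base show ?case by (simp add: B_lin)
  next
    case (step c z v)
    then obtain j where j: "z = x j" "j < n" by auto
    have "(\<Sum>i<n. scale (B (x i) (scale c z + v)) (x i))
      = (\<Sum>i<n. if i = j then scale c (x j) else 0) + (\<Sum>i<n. scale (B (x i) v) (x i))"
      unfolding sum.distrib[symmetric] using j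
      by (intro sum.cong refl) (simp add: B_lin basis_orthonormal scale_left_distrib)
    also have "\<dots> = scale c z + v" using step.IH j by (simp add: sum.delta)
    finally show ?case ..
  qed
qed

abbreviation casimir :: "('g \<Rightarrow> 'g \<Rightarrow> complex) \<Rightarrow> complex" where
  "casimir \<equiv> cas n x"

text \<open>The tensor does not depend on the basis: expanding one factor along \<open>b\<close> and
  resumming the other produces \<open>d\<close>. This gives the root vector formula
  \<open>casimir_root\<close>.\<close>

lemma casimir_dual:
  assumes \<beta>: "bilin scale \<beta>" and I: "finite I" and e: "\<And>u. u = (\<Sum>i\<in>I. scale (B (d i) u) (b i))"
  shows "casimir \<beta> = (\<Sum>i\<in>I. \<beta> (b i) (d i))"
proof -
  have "casimir \<beta> = (\<Sum>j<n. \<beta> (\<Sum>i\<in>I. scale (B (d i) (x j)) (b i)) (x j))"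
    unfolding cas_def by (intro sum.cong refl arg_cong2[where f = \<beta>] e)
  also have "\<dots> = (\<Sum>j<n. \<Sum>i\<in>I. B (d i) (x j) * \<beta> (b i) (x j))"
    by (simp add: bilin_sum_left[OF \<beta>] bilinD[OF \<beta>])
  also have "\<dots> = (\<Sum>i\<in>I. \<Sum>j<n. B (d i) (x j) * \<beta> (b i) (x j))" by (rule sum.swap)
  also have "\<dots> = (\<Sum>i\<in>I. \<beta> (b i) (\<Sum>j<n. scale (B (x j) (d i)) (x j)))"
    by (simp add: bilin_sum_right[OF \<beta>] bilinD[OF \<beta>] form_symmetric)
  finally show ?thesis by (simp flip: x_expand)
qed

text \<open>In an orthonormal basis \<open>ad z\<close> has an antisymmetric matrix
  (\<open>B_skew\<close>), so the two sums cancel.\<close>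

lemma casimir_inv:
  assumes \<beta>: "bilin scale \<beta>"
  shows "casimir (\<lambda>u v. \<beta> (brk z u) v + \<beta> u (brk z v)) = 0"
proof -
  have "casimir (\<lambda>u v. \<beta> (brk z u) v) = (\<Sum>i<n. \<beta> (\<Sum>j<n. scale (B (x j) (brk z (x i))) (x j)) (x i))"
    unfolding cas_def by (intro sum.cong refl arg_cong2[where f = \<beta>] x_expand)
  also have "\<dots> = (\<Sum>i<n. \<Sum>j<n. B (x j) (brk z (x i)) * \<beta> (x j) (x i))"
    by (simp add: bilin_sum_left[OF \<beta>] bilinD[OF \<beta>])
  also have "\<dots> = (\<Sum>j<n. \<Sum>i<n. B (x j) (brk z (x i)) * \<beta> (x j) (x i))" by (rule sum.swap)
  also have "\<dots> = (\<Sum>j<n. \<Sum>i<n. - B (x i) (brk z (x j)) * \<beta> (x j) (x i))"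
    by (intro sum.cong refl arg_cong2[where f = "(*)"] B_skew)
  also have "\<dots> = (\<Sum>j<n. \<beta> (x j) (\<Sum>i<n. - scale (B (x i) (brk z (x j))) (x i)))"
    by (simp add: bilin_sum_right[OF \<beta>] bilinD[OF \<beta>])
  also have "\<dots> = - casimir (\<lambda>u v. \<beta> u (brk z v))"
    unfolding cas_def sum_negf by (simp add: bilinD[OF \<beta>] sum_negf flip: x_expand)
  finally show ?thesis by (simp add: cas_def sum.distrib)
qed

lemma casimir_inv': "bilin scale \<beta> \<Longrightarrow> casimir (\<lambda>u v. \<beta> (brk z u) v) = - casimir (\<lambda>u v. \<beta> u (brk z v))"
  using casimir_inv[of \<beta> z] by (simp add: cas_def sum.distrib eq_neg_iff_add_eq_0)

lemma B_ext: "(\<And>v. B u v = B w v) \<Longrightarrow> u = w"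
  using form_nondegenerate[of "u - w"] by (simp add: B_lin)

end

section \<open>Root vectors of G2 from the Chevalley-Serre relations\<close>

locale G2 = simple_lie_algebra_with_basis scale brk B n x f
  for scale :: "complex \<Rightarrow> 'g::ab_group_add \<Rightarrow> 'g" and brk B n x f +
  fixes e0 e1 f0 f1 h0 h1 :: 'g
  assumes generated: "lie_subalgebra_generated scale brk {e0, e1, f0, f1, h0, h1} = UNIV"
    and hh: "brk h0 h1 = 0"
    and ef: "brk e0 f0 = h0" "brk e1 f1 = h1" "brk e0 f1 = 0" "brk e1 f0 = 0"
    and he: "brk h0 e0 = scale 2 e0" "brk h0 e1 = - e1" "brk h1 e0 = scale (-3) e0" "brk h1 e1 = scale 2 e1"
    and hf: "brk h0 f0 = scale (-2) f0" "brk h0 f1 = f1" "brk h1 f0 = scale 3 f0" "brk h1 f1 = scale (-2) f1"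
    and serre: "brk e0 (brk e0 e1) = 0" "brk e1 (brk e1 (brk e1 (brk e1 e0))) = 0"
      "brk f0 (brk f0 f1) = 0" "brk f1 (brk f1 (brk f1 (brk f1 f0))) = 0"
begin

text \<open>The hypotheses are symmetric under the Chevalley involution, so every fact about the \<open>e\<close> side
  yields one about the \<open>f\<close> side by reinterpreting the locale.\<close>

lemma swap: "G2 scale brk B n x f f0 f1 e0 e1 (- h0) (- h1)"
proof unfold_locales
  have "u \<in> lie_subalgebra_generated scale brk {f0, f1, e0, e1, - h0, - h1}"
    if "u \<in> lie_subalgebra_generated scale brk {e0, e1, f0, f1, h0, h1}" for u
    using that
  proof induction
    case (gen u)
    have *: "v \<in> lie_subalgebra_generated scale brk {f0, f1, e0, e1, - h0, - h1}"
      if "- v \<in> {f0, f1, e0, e1, - h0, - h1}" for v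
      using lie_subalgebra_generated.scale[OF lie_subalgebra_generated.gen[OF that], where scale = scale and brk = brk and c = "-1"] by simp
    from gen consider "u \<in> {f0, f1, e0, e1, - h0, - h1}" | "- u \<in> {f0, f1, e0, e1, - h0, - h1}" by auto
    then show ?case
    proof cases
      case 1 then show ?thesis by (rule lie_subalgebra_generated.gen)
    next
      case 2 then show ?thesis by (rule *)
    qed
  qed (auto intro: lie_subalgebra_generated.intros)
  then show "lie_subalgebra_generated scale brk {f0, f1, e0, e1, - h0, - h1} = UNIV"
    using generated by auto
  show "brk f0 e0 = - h0" "brk f1 e1 = - h1" "brk f0 e1 = 0" "brk f1 e0 = 0"
    using ef brk_anti[of f0 e0] brk_anti[of f0 e1] brk_anti[of f1 e0] brk_anti[of f1 e1] by simp_all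
qed (simp_all add: hh he hf serre brk_lin)

text \<open>\<open>e2\<close>, \<open>e3\<close>, \<open>e4\<close>, \<open>e5\<close> are root
  vectors for \<alpha>0 + \<alpha>1, \<alpha>0 + 2 \<alpha>1, \<alpha>0 + 3 \<alpha>1 and 2
  \<alpha>0 + 3 \<alpha>1. They are left unnormalised; this is the source of the factors 3, 12 and
  36 in the later tables.\<close>

definition e2 where "e2 = brk e1 e0"
definition e3 where "e3 = brk e1 e2"
definition e4 where "e4 = brk e1 e3"
definition e5 where "e5 = brk e0 e4"
definition f2 where "f2 = brk f1 f0"
definition f3 where "f3 = brk f1 f2"
definition f4 where "f4 = brk f1 f3"
definition f5 where "f5 = brk f0 f4"

definition wt :: "complex \<Rightarrow> complex \<Rightarrow> 'g \<Rightarrow> bool" where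
  "wt a b u \<longleftrightarrow> brk h0 u = scale a u \<and> brk h1 u = scale b u"

lemma wt_brk: "wt a b u \<Longrightarrow> wt c d v \<Longrightarrow> wt (a + c) (b + d) (brk u v)"
  by (simp add: wt_def brk_jac[of h0] brk_jac[of h1] brk_lin scale_left_distrib)

lemma wt_e01: "wt 2 (-3) e0" "wt (-1) 2 e1"
  by (simp_all add: wt_def he)

lemma wt_e: "wt 2 (-3) e0" "wt (-1) 2 e1" "wt 1 (-1) e2" "wt 0 1 e3" "wt (-1) 3 e4" "wt 1 0 e5"
proof -
  show "wt 2 (-3) e0" "wt (-1) 2 e1" by (fact wt_e01)+
  show a: "wt 1 (-1) e2" using wt_brk[OF wt_e01(2) wt_e01(1)] by (simp add: e2_def)
  show b: "wt 0 1 e3" using wt_brk[OF wt_e01(2) a] by (simp add: e3_def)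
  show c: "wt (-1) 3 e4" using wt_brk[OF wt_e01(2) b] by (simp add: e4_def)
  show "wt 1 0 e5" using wt_brk[OF wt_e01(1) c] by (simp add: e5_def)
qed

lemma wt_h: "wt 0 0 h0" "wt 0 0 h1"
  using hh brk_anti[of h1 h0] by (simp_all add: wt_def)

lemma scale_combine:
  "u + scale c u = scale (1 + c) u" "scale c u + u = scale (c + 1) u"
  "scale c u - u = scale (c - 1) u" "u - scale c u = scale (1 - c) u"
  "scale c u + scale d u = scale (c + d) u" "scale c u - scale d u = scale (c - d) u"
  using scale_left_distrib[of 1 c u] scale_left_distrib[of c 1 u] scale_left_diff_distrib[of 1 c u]
    scale_left_diff_distrib[of c 1 u] scale_left_distrib[of c d u] scale_left_diff_distrib[of c d u]
  by simp_all

text \<open>The rows of \<open>e0\<close> and \<open>e1\<close> rest on the Serre relations; the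
  rows of \<open>f0\<close> and \<open>f1\<close> follow the root strings upwards, each entry by the
  Jacobi identity from the entry before it.\<close>

lemma ad_e0: "brk e0 e0 = 0" "brk e0 e1 = - e2" "brk e0 e2 = 0" "brk e0 e3 = 0" "brk e0 e4 = e5"
  "brk e0 h0 = scale (-2) e0" "brk e0 h1 = scale 3 e0"
  and ad_e1: "brk e1 e0 = e2" "brk e1 e1 = 0" "brk e1 e2 = e3" "brk e1 e3 = e4" "brk e1 e4 = 0"
    "brk e1 h0 = e1" "brk e1 h1 = scale (-2) e1"
  and ad_f1_e: "brk f1 e0 = 0" "brk f1 e1 = - h1" "brk f1 e2 = scale 3 e0"
     "brk f1 e3 = scale 4 e2" "brk f1 e4 = scale 3 e3"
  and ad_f0_e: "brk f0 e0 = - h0" "brk f0 e1 = 0" "brk f0 e2 = - e1" "brk f0 e3 = 0" "brk f0 e4 = 0"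
proof -
  note w = wt_e[unfolded wt_def]
  show 1: "brk e0 e0 = 0" "brk e0 e1 = - e2" "brk e0 e4 = e5" "brk e1 e0 = e2" "brk e1 e1 = 0" "brk e1 e2 = e3"
    "brk e1 e3 = e4" using brk_anti[of e0 e1] by (simp_all add: e2_def e3_def e4_def e5_def)
  show 2: "brk e0 e2 = 0" using serre(1) 1 by (simp add: brk_lin)
  show "brk e1 e4 = 0" using serre(2) by (simp add: e2_def e3_def e4_def)
  show "brk e0 e3 = 0" by (subst e3_def, subst brk_jac) (simp add: 1 2 brk_lin)
  show 3: "brk f1 e0 = 0" "brk f1 e1 = - h1" "brk f0 e0 = - h0" "brk f0 e1 = 0"
    using ef brk_anti[of f0 e0] brk_anti[of f0 e1] brk_anti[of f1 e0] brk_anti[of f1 e1] by simp_all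
  show "brk e0 h0 = scale (-2) e0" "brk e0 h1 = scale 3 e0" "brk e1 h0 = e1" "brk e1 h1 = scale (-2) e1"
    using he brk_anti[of e0 h0] brk_anti[of e0 h1] brk_anti[of e1 h0] brk_anti[of e1 h1] by simp_all
  show 4: "brk f1 e2 = scale 3 e0"
    by (subst e2_def, subst brk_jac) (simp add: 3 brk_lin w scale_combine)
  show 5: "brk f1 e3 = scale 4 e2"
    by (subst e3_def, subst brk_jac) (simp add: 1 3 4 brk_lin w scale_combine)
  show "brk f1 e4 = scale 3 e3"
    by (subst e4_def, subst brk_jac) (simp add: 1 3 5 brk_lin w scale_combine)
  show 6: "brk f0 e2 = - e1"
    by (subst e2_def, subst brk_jac) (simp add: 1 3 4 brk_lin he brk_anti[of e1 h0])
  show 7: "brk f0 e3 = 0"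
    by (subst e3_def, subst brk_jac) (simp add: 1 3 6 brk_lin)
  show "brk f0 e4 = 0"
    by (subst e4_def, subst brk_jac) (simp add: 1 3 7 brk_lin)
qed

lemma e23: "brk e2 e3 = - e5"
proof -
  have "e5 = brk e0 (brk e1 e3)" by (simp add: e5_def e4_def)
  also have "\<dots> = brk (brk e0 e1) e3 + brk e1 (brk e0 e3)" by (rule brk_jac)
  also have "\<dots> = - brk e2 e3" by (simp add: ad_e0 brk_lin)
  finally show ?thesis by simp
qed

text \<open>The weight 2 \<alpha>0 + 4 \<alpha>1 is not a root, yet vanishing of
  \<open>brk e1 e5\<close> has to be proved: expanding \<open>e5\<close> gives
  \<open>brk e2 e4\<close>, and expanding \<open>e4\<close> in that gives
  \<open>- brk e1 e5\<close>, so the bracket is its own negative.\<close>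

lemma ad_e5: "brk e1 e5 = 0" "brk e0 e5 = 0" "brk f1 e5 = 0" "brk f0 e5 = e4"
proof -
  have a: "brk e1 e5 = brk e2 e4"
    by (subst e5_def, subst brk_jac) (simp add: ad_e1 brk_lin)
  have "brk e2 e4 = brk (brk e2 e1) e3 + brk e1 (brk e2 e3)"
    unfolding e4_def by (rule brk_jac)
  also have "\<dots> = - brk e1 e5" using brk_anti[of e2 e1] by (simp add: ad_e1 e23 brk_lin)
  finally have "brk e1 e5 + brk e1 e5 = 0" using a by (simp only: eq_neg_iff_add_eq_0)
  then have "scale 2 (brk e1 e5) = 0" using scale_left_distrib[of 1 1 "brk e1 e5"] by simp
  then show "brk e1 e5 = 0" by simp
  have "brk e0 e5 = - brk e0 (brk e2 e3)" by (simp add: e23 brk_lin)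
  also have "\<dots> = 0" unfolding brk_jac[of e0 e2 e3] by (simp add: ad_e0)
  finally show "brk e0 e5 = 0" .
  show "brk f1 e5 = 0"
    by (subst e5_def, subst brk_jac) (simp add: ad_f1_e ad_e0 brk_lin)
  show "brk f0 e5 = e4"
    by (subst e5_def, subst brk_jac) (simp add: ad_f0_e brk_lin wt_e[unfolded wt_def])
qed

lemma
  shows ad_f0_f: "brk f0 f0 = 0" "brk f0 f1 = - f2" "brk f0 f2 = 0" "brk f0 f3 = 0" "brk f0 f4 = f5"
      "brk f0 f5 = 0" "brk f0 h0 = scale 2 f0" "brk f0 h1 = scale (-3) f0"
    and ad_f1_f: "brk f1 f0 = f2" "brk f1 f1 = 0" "brk f1 f2 = f3" "brk f1 f3 = f4" "brk f1 f4 = 0"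
      "brk f1 f5 = 0" "brk f1 h0 = - f1" "brk f1 h1 = scale 2 f1"
    and ad_e1_f: "brk e1 f0 = 0" "brk e1 f1 = h1" "brk e1 f2 = scale 3 f0" "brk e1 f3 = scale 4 f2"
      "brk e1 f4 = scale 3 f3" "brk e1 f5 = 0"
    and ad_e0_f: "brk e0 f0 = h0" "brk e0 f1 = 0" "brk e0 f2 = - f1" "brk e0 f3 = 0" "brk e0 f4 = 0"
      "brk e0 f5 = f4"
    and wt_f: "wt (-2) 3 f0" "wt 1 (-2) f1" "wt (-1) 1 f2" "wt 0 (-1) f3" "wt 1 (-3) f4" "wt (-1) 0 f5"
proof -
  interpret sw: G2 scale brk B n x f f0 f1 e0 e1 "- h0" "- h1" by (rule swap)
  have d: "sw.e2 = f2" "sw.e3 = f3" "sw.e4 = f4" "sw.e5 = f5"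
    by (simp_all add: sw.e2_def sw.e3_def sw.e4_def sw.e5_def f2_def f3_def f4_def f5_def)
  have w: "wt (- a) (- b) u" if "sw.wt a b u" for a b u
    using that by (simp add: sw.wt_def wt_def brk_lin) (metis minus_minus)
  note s = sw.ad_e0[unfolded d] sw.ad_e1[unfolded d] sw.ad_f1_e[unfolded d] sw.ad_f0_e[unfolded d] sw.ad_e5[unfolded d]
  show "brk f0 f0 = 0" "brk f0 f1 = - f2" "brk f0 f2 = 0" "brk f0 f3 = 0" "brk f0 f4 = f5"
      "brk f0 f5 = 0" "brk f1 f0 = f2" "brk f1 f1 = 0" "brk f1 f2 = f3" "brk f1 f3 = f4" "brk f1 f4 = 0"
      "brk f1 f5 = 0" "brk e1 f0 = 0" "brk e1 f2 = scale 3 f0" "brk e1 f3 = scale 4 f2"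
      "brk e1 f4 = scale 3 f3" "brk e1 f5 = 0" "brk e0 f1 = 0" "brk e0 f2 = - f1" "brk e0 f3 = 0" "brk e0 f4 = 0"
      "brk e0 f5 = f4" using s by simp_all
  show "brk f0 h0 = scale 2 f0" "brk f0 h1 = scale (-3) f0" "brk f1 h0 = - f1" "brk f1 h1 = scale 2 f1"
    using hf brk_anti[of f0 h0] brk_anti[of f0 h1] brk_anti[of f1 h0] brk_anti[of f1 h1] by simp_all
  show "brk e1 f1 = h1" "brk e0 f0 = h0" by (rule ef)+
  show "wt (-2) 3 f0" "wt 1 (-2) f1" "wt (-1) 1 f2" "wt 0 (-1) f3" "wt 1 (-3) f4" "wt (-1) 0 f5"
    using sw.wt_e[THEN w] by (simp_all add: d)
qed

lemmas ad_e0_all = ad_e0 ad_e5(2) ad_e0_f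
lemmas ad_e1_all = ad_e1 ad_e5(1) ad_e1_f
lemmas ad_f0_all = ad_f0_e ad_e5(4) ad_f0_f
lemmas ad_f1_all = ad_f1_e ad_e5(3) ad_f1_f
lemmas ad_all = ad_e0_all ad_e1_all ad_f0_all ad_f1_all
lemmas wt_all = wt_e wt_h wt_f

text \<open>Decreasing order with respect to the height of the weight: \<open>e5\<close> is the highest root vector (of the
  long highest root \<open>2 \<alpha>0 + 3 \<alpha>1\<close>, where \<open>\<alpha>0\<close> is long and \<open>\<alpha>1\<close> short).\<close>

definition bl where "bl = [e5, e4, e3, e2, e1, e0, h0, h1, f0, f1, f2, f3, f4, f5]"

lemma span_bl: "span (set bl) = UNIV"
proof -
  let ?L = "span (set bl)"
  have m: "u \<in> ?L" if "u \<in> set bl" for u using that by (rule span_base)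
  have mem: "e0 \<in> ?L" "e1 \<in> ?L" "e2 \<in> ?L" "e3 \<in> ?L" "e4 \<in> ?L" "e5 \<in> ?L" "h0 \<in> ?L" "h1 \<in> ?L"
    "f0 \<in> ?L" "f1 \<in> ?L" "f2 \<in> ?L" "f3 \<in> ?L" "f4 \<in> ?L" "f5 \<in> ?L"
    by (auto simp: bl_def intro!: span_base)
  have ext: "brk g v \<in> ?L" if "\<forall>b\<in>set bl. brk g b \<in> ?L" "v \<in> ?L" for g v
    using that(2)
    by (induction rule: span_induct_alt) (use that(1) in \<open>auto simp: brk_lin intro: span_add span_scale span_zero\<close>)
  \<comment> \<open>Both parts are carried through the induction: a bracket lies in the span because
    \<open>ad u\<close> preserves the span and \<open>v\<close> lies in it.\<close>
  have "u \<in> ?L \<and> (\<forall>v\<in>?L. brk u v \<in> ?L)"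
    if "u \<in> lie_subalgebra_generated scale brk {e0, e1, f0, f1, h0, h1}" for u
    using that
  proof induction
    case (gen u)
    have "\<forall>b\<in>set bl. brk u b \<in> ?L"
      using gen by (auto simp: bl_def ad_all wt_all[unfolded wt_def] mem[unfolded bl_def list.set] span_scale span_neg span_zero)
    then show ?case using gen mem ext by blast
  next
    case (brk u v)
    then show ?case by (auto simp: brk_brk intro: span_diff)
  qed (auto simp: brk_lin intro: span_add span_scale)
  then show ?thesis using generated by auto
qed

text \<open>An invariant form on a simple Lie algebra is fixed up to a scalar, and all its values
  are expressed through this one. It is 1 when long roots have squared length 2.\<close>

definition \<kappa> where "\<kappa> = B e0 f0"

lemma B_wt:
  assumes "wt a b u" "wt c d v" "a + c \<noteq> 0 \<or> b + d \<noteq> 0"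
  shows "B u v = 0"
proof -
  have "B (brk h0 u) v = - B u (brk h0 v)" "B (brk h1 u) v = - B u (brk h1 v)" by (rule B_inv)+
  then have "(a + c) * B u v = 0" "(b + d) * B u v = 0"
    using assms(1,2) by (simp_all add: wt_def B_lin algebra_simps eq_neg_iff_add_eq_0)
  then show ?thesis using assms(3) by auto
qed

text \<open>Invariance moves \<open>ad e0\<close> or \<open>ad e1\<close> across the form, so each
  value follows from an earlier one; every move contributes a sign and a constant of the bracket
  table.\<close>

lemma B_ef: "B e0 f0 = \<kappa>" "B e1 f1 = 3 * \<kappa>" "B e2 f2 = - (3 * \<kappa>)" "B e3 f3 = 12 * \<kappa>"
    "B e4 f4 = - (36 * \<kappa>)" "B e5 f5 = 36 * \<kappa>"
  and B_hh: "B h0 h0 = 2 * \<kappa>" "B h0 h1 = - (3 * \<kappa>)" "B h1 h0 = - (3 * \<kappa>)" "B h1 h1 = 6 * \<kappa>"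
proof -
  show 0: "B e0 f0 = \<kappa>" by (simp add: \<kappa>_def)
  have "B h0 h0 = - B f0 (brk e0 h0)" using B_inv[of e0 f0 h0] by (simp add: ef)
  then show "B h0 h0 = 2 * \<kappa>" using 0 by (simp add: ad_all B_lin form_symmetric[of f0])
  have "B h0 h1 = - B f0 (brk e0 h1)" using B_inv[of e0 f0 h1] by (simp add: ef)
  then show a: "B h0 h1 = - (3 * \<kappa>)" using 0 by (simp add: ad_all B_lin form_symmetric[of f0])
  have "B h1 h0 = - B f1 (brk e1 h0)" using B_inv[of e1 f1 h0] by (simp add: ef)
  then show 1: "B e1 f1 = 3 * \<kappa>" using a by (simp add: ad_all B_lin form_symmetric[of f1] form_symmetric[of h1])
  show "B h1 h0 = - (3 * \<kappa>)" using a by (simp add: form_symmetric[of h1])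
  have "B h1 h1 = - B f1 (brk e1 h1)" using B_inv[of e1 f1 h1] by (simp add: ef)
  then show "B h1 h1 = 6 * \<kappa>" using 1 by (simp add: ad_all B_lin form_symmetric[of f1])
  show 2: "B e2 f2 = - (3 * \<kappa>)" using B_inv[of e1 e0 f2] 0 by (simp add: ad_all B_lin)
  show 3: "B e3 f3 = 12 * \<kappa>" using B_inv[of e1 e2 f3] 2 by (simp add: ad_all B_lin)
  show 4: "B e4 f4 = - (36 * \<kappa>)" using B_inv[of e1 e3 f4] 3 by (simp add: ad_all B_lin)
  show "B e5 f5 = 36 * \<kappa>" using B_inv[of e0 e4 f5] 4 by (simp add: ad_all B_lin)
qed

lemmas B_fe = B_ef[unfolded form_symmetric[of e0] form_symmetric[of e1] form_symmetric[of e2]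
  form_symmetric[of e3] form_symmetric[of e4] form_symmetric[of e5]]

end

section \<open>Dual bases and the Casimir tensor in root vectors\<close>

context G2
begin

definition wl :: "(complex \<times> complex \<times> 'g) list" where "wl = [(1, 0, e5), (-1, 3, e4), (0, 1, e3), (1, -1, e2), (-1, 2, e1), (2, -3, e0),
  (0, 0, h0), (0, 0, h1), (-2, 3, f0), (1, -2, f1), (-1, 1, f2), (0, -1, f3), (1, -3, f4), (-1, 0, f5)]"

lemma B_orthogonal_list:
  "list_all (\<lambda>(a, b, u). list_all (\<lambda>(c, d, v). a + c \<noteq> 0 \<or> b + d \<noteq> 0 \<longrightarrow> B u v = 0) wl) wl"
proof -
  have "\<forall>(a, b, u)\<in>set wl. wt a b u" by (simp add: wl_def wt_all)
  then have "B u v = 0" if "(a, b, u) \<in> set wl" "(c, d, v) \<in> set wl" "a + c \<noteq> 0 \<or> b + d \<noteq> 0" for a b u c d v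
    using that by (intro B_wt[of a b u c d v]) auto
  then show ?thesis unfolding list_all_iff by fast
qed

lemmas B_orthogonal = B_orthogonal_list[unfolded wl_def, simplified]
lemmas B_table = B_orthogonal B_ef B_fe B_hh

lemma bl_cases: "u \<in> set bl \<Longrightarrow> u = e5 \<or> u = e4 \<or> u = e3 \<or> u = e2 \<or> u = e1 \<or> u = e0 \<or> u = h0 \<or> u = h1 \<or>
  u = f0 \<or> u = f1 \<or> u = f2 \<or> u = f3 \<or> u = f4 \<or> u = f5"
  by (simp add: bl_def)

lemma bl_induct:
  assumes "\<And>u. u \<in> set bl \<Longrightarrow> P u" "\<And>u v. P u \<Longrightarrow> P v \<Longrightarrow> P (u + v)" "\<And>c u. P u \<Longrightarrow> P (scale c u)"
  shows "P u"
proof -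
  have "u \<in> span (set bl)" using span_bl by simp
  then show ?thesis
  proof (induction rule: span_induct_alt)
    case base
    have "P (scale 0 e5)" using assms by (simp add: bl_def del: scale_zero_left)
    then show ?case by simp
  qed (use assms in blast)
qed

text \<open>Every entry of the Gram matrix of \<open>bl\<close> is a multiple of \<kappa>, so
  \<kappa> = 0 would make the form zero on a nonzero space.\<close>

lemma kappa_nonzero: "\<kappa> \<noteq> 0"
proof
  assume k: "\<kappa> = 0"
  have "B u v = 0" if "u \<in> set bl" for u v
  proof (induction v rule: bl_induct)
    case (1 v) then show ?case using bl_cases[OF that] bl_cases[OF 1] k by (elim disjE) (simp_all add: B_table)
  qed (simp_all add: B_lin)
  then have all: "B u v = 0" for u v by (induction u rule: bl_induct) (simp_all add: B_lin)
  have "u = 0" for u :: 'g by (rule form_nondegenerate) (rule all)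
  then show False using nonabelian by metis
qed

text \<open>The basis dual to \<open>bl\<close> under the form. The two Cartan entries come from
  inverting the Gram matrix of \<open>h0\<close> and \<open>h1\<close>, which is \<kappa> times
  [[2, -3], [-3, 6]] and has determinant 3 \<kappa>^2.\<close>

definition dl where "dl = [scale (1 / (36 * \<kappa>)) f5, scale (- 1 / (36 * \<kappa>)) f4, scale (1 / (12 * \<kappa>)) f3,
  scale (- 1 / (3 * \<kappa>)) f2, scale (1 / (3 * \<kappa>)) f1, scale (1 / \<kappa>) f0,
  scale (1 / \<kappa>) (scale 2 h0 + h1), scale (1 / \<kappa>) (h0 + scale (2/3) h1),
  scale (1 / \<kappa>) e0, scale (1 / (3 * \<kappa>)) e1, scale (- 1 / (3 * \<kappa>)) e2,
  scale (1 / (12 * \<kappa>)) e3, scale (- 1 / (36 * \<kappa>)) e4, scale (1 / (36 * \<kappa>)) e5]"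

lemma sum14: "(\<Sum>i<14. g i) = g 0 + g 1 + g 2 + g 3 + g 4 + g 5 + g 6 + g 7 + g 8 + g 9 + g 10 + g 11 + g 12 + g (13::nat)"
  for g :: "nat \<Rightarrow> 'z::comm_monoid_add"
  by (simp add: eval_nat_numeral lessThan_Suc ac_simps)

lemma bl_expand: "u = (\<Sum>i<14. scale (B (dl ! i) u) (bl ! i))"
proof (induction u rule: bl_induct)
  case (1 u)
  then show ?case using bl_cases[OF 1] kappa_nonzero
    by (elim disjE) (simp_all add: sum14 dl_def bl_def B_lin B_table)
next
  case (2 u v)
  then show ?case by (simp add: B_lin scale_left_distrib sum.distrib)
next
  case (3 c u)
  then have "scale c u = scale c (\<Sum>i<14. scale (B (dl ! i) u) (bl ! i))" by simp
  also have "\<dots> = (\<Sum>i<14. scale (B (dl ! i) (scale c u)) (bl ! i))" by (simp add: B_lin scale_sum_right)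
  finally show ?case .
qed

lemma casimir_root:
  assumes \<beta>: "bilin scale \<beta>"
  shows "\<kappa> * casimir \<beta> = (\<beta> e5 f5 + \<beta> f5 e5) / 36 - (\<beta> e4 f4 + \<beta> f4 e4) / 36 + (\<beta> e3 f3 + \<beta> f3 e3) / 12
    - (\<beta> e2 f2 + \<beta> f2 e2) / 3 + (\<beta> e1 f1 + \<beta> f1 e1) / 3 + (\<beta> e0 f0 + \<beta> f0 e0)
    + 2 * \<beta> h0 h0 + \<beta> h0 h1 + \<beta> h1 h0 + 2/3 * \<beta> h1 h1"
  unfolding casimir_dual[OF \<beta> finite_lessThan bl_expand] sum14
  using kappa_nonzero
  by (simp add: dl_def bl_def bilinD[OF \<beta>] distrib_left right_diff_distrib add_divide_distrib)

lemma coroots: "brk e2 f2 = - h1 - scale 3 h0" "brk e3 f3 = scale 8 h1 + scale 12 h0"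
   "brk e4 f4 = scale (-36) h1 + scale (-36) h0" "brk e5 f5 = scale 72 h0 + scale 36 h1"
proof -
  show 1: "brk e2 f2 = - h1 - scale 3 h0" unfolding e2_def brk_brk by (simp add: ad_all brk_lin)
  have 2: "brk e2 f3 = scale 4 f1" unfolding e2_def brk_brk by (simp add: ad_all brk_lin)
  show 3: "brk e3 f3 = scale 8 h1 + scale 12 h0" unfolding e3_def brk_brk
    by (simp add: ad_all brk_lin 1 2 scale_right_diff_distrib scale_combine algebra_simps)
  have 4: "brk e2 f4 = 0" unfolding e2_def brk_brk by (simp add: ad_all brk_lin 2)
  have 6: "brk e3 f4 = scale (-12) f1" unfolding e3_def brk_brk by (simp add: 2 4 ad_all brk_lin)
  show 7: "brk e4 f4 = scale (-36) h1 + scale (-36) h0" unfolding e4_def brk_brk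
    by (simp add: ad_all brk_lin 3 6 scale_right_distrib scale_combine algebra_simps)
  have 8: "brk e2 f5 = scale 3 f3" unfolding e2_def brk_brk by (simp add: ad_all brk_lin)
  have 9: "brk e3 f5 = scale 12 f2" unfolding e3_def brk_brk by (simp add: ad_all brk_lin 8)
  have 10: "brk e4 f5 = scale 36 f0" unfolding e4_def brk_brk by (simp add: ad_all brk_lin 9)
  show "brk e5 f5 = scale 72 h0 + scale 36 h1" unfolding e5_def brk_brk
    by (simp add: ad_all brk_lin 10 7 scale_right_distrib scale_combine algebra_simps)
qed

text \<open>\<open>low z\<close> says that \<open>ad z\<close> moves every element of \<open>bl\<close> into the span of earlier ones; it holds for
  the positive root vectors.\<close>

definition low :: "'g \<Rightarrow> bool" where
  "low z \<longleftrightarrow> (\<forall>k. \<forall>u\<in>span (set (take k bl)). brk z u \<in> span (set (take (k - 1) bl)))"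

lemma lowI:
  assumes "\<And>k. k < 14 \<Longrightarrow> brk z (bl ! k) \<in> span (set (take k bl))"
  shows "low z"
  unfolding low_def
proof (intro allI ballI)
  fix k u assume "u \<in> span (set (take k bl))"
  then show "brk z u \<in> span (set (take (k - 1) bl))"
  proof (induction rule: span_induct_alt)
    case base show ?case by (simp add: span_zero)
  next
    case (step c b v)
    then obtain j where j: "j < k" "j < 14" "b = bl ! j" by (auto simp: in_set_conv_nth bl_def)
    have "span (set (take j bl)) \<subseteq> span (set (take (k - 1) bl))"
      using j by (intro span_mono set_take_subset_set_take) simp
    then have "brk z b \<in> span (set (take (k - 1) bl))" using assms[OF j(2)] j(3) by blast
    then show ?case using step.IH by (simp add: brk_lin span_add span_scale)
  qed
qed

lemma low_brk:
  assumes "low a" "low b" shows "low (brk a b)"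
  unfolding low_def
proof (intro allI ballI)
  fix k u assume u: "u \<in> span (set (take k bl))"
  have "span (set (take (k - 1 - 1) bl)) \<subseteq> span (set (take (k - 1) bl))"
    by (intro span_mono set_take_subset_set_take) simp
  then show "brk (brk a b) u \<in> span (set (take (k - 1) bl))"
    using assms u unfolding brk_brk low_def by (blast intro: span_diff)
qed

lemma nat14_cases: "k < 14 \<Longrightarrow> k = 0 \<or> k = 1 \<or> k = 2 \<or> k = 3 \<or> k = 4 \<or> k = 5 \<or> k = 6 \<or> k = 7 \<or> k = 8 \<or> k = 9 \<or> k = 10
    \<or> k = 11 \<or> k = 12 \<or> k = (13::nat)" by presburger

lemma low_e01: "low e0" "low e1"
proof -
  have mem: "u \<in> set xs \<Longrightarrow> scale c u \<in> span (set xs)" "u \<in> set xs \<Longrightarrow> u \<in> span (set xs)"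
    "u \<in> set xs \<Longrightarrow> - u \<in> span (set xs)" for c u xs
    by (auto intro: span_scale span_base span_neg)
  show "low e0"
  proof (rule lowI)
    fix k :: nat assume "k < 14"
    from nat14_cases[OF this] show "brk e0 (bl ! k) \<in> span (set (take k bl))"
      by (elim disjE) (simp_all add: bl_def ad_e0_all mem span_zero
        mem[of _ "[_, _, _]", simplified] mem[of _ "[_, _, _, _]", simplified] mem[of _ "[_, _, _, _, _]", simplified]
        mem[of _ "[_, _, _, _, _, _]", simplified] mem[of _ "[_, _, _, _, _, _, _]", simplified]
        mem[of _ "[_, _, _, _, _, _, _, _]", simplified] span_base span_scale span_neg)
  qed
  show "low e1"
  proof (rule lowI)
    fix k :: nat assume "k < 14"
    from nat14_cases[OF this] show "brk e1 (bl ! k) \<in> span (set (take k bl))"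
      by (elim disjE) (simp_all add: bl_def ad_e1_all span_zero span_base span_scale span_neg)
  qed
qed

lemma low_e: "low e0" "low e1" "low e2" "low e3" "low e4" "low e5"
proof -
  show "low e0" "low e1" by (fact low_e01)+
  then show "low e2" unfolding e2_def by (intro low_brk)
  then show "low e3" unfolding e3_def by (intro low_brk low_e01)
  then show "low e4" unfolding e4_def by (intro low_brk low_e01)
  then show "low e5" unfolding e5_def by (intro low_brk low_e01)
qed

lemma low_nth:
  assumes "low z" "k < 14" shows "brk z (bl ! k) \<in> span (set (take k bl))"
proof -
  have "length bl = 14" by (simp add: bl_def)
  then have "bl ! k \<in> set (take (Suc k) bl)" using assms(2) by (simp add: take_Suc_conv_app_nth)
  then show ?thesis using assms(1) unfolding low_def by (metis diff_Suc_1 span_base)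
qed

lemma brk_e5: "low z \<Longrightarrow> brk z e5 = 0"
  using low_nth[of z 0] by (simp add: bl_def)

lemma brk_e4: "low z \<Longrightarrow> \<exists>c. brk z e4 = scale c e5"
  using low_nth[of z 1] by (auto simp: bl_def span_singleton)

lemma brk_e3: "low z \<Longrightarrow> \<exists>c d. brk z e3 = scale c e5 + scale d e4"
  using low_nth[of z 2] by (auto simp: bl_def span_breakdown_eq) (metis diff_add_cancel add.commute)

section \<open>The Casimir eigenvalue on the adjoint representation\<close>

definition adj_casimir :: "'g \<Rightarrow> 'g" where "adj_casimir u = (\<Sum>i<n. brk (x i) (brk (x i) u))"

lemma bilin_brk: "bilin scale (\<lambda>a b. B (brk a (brk b u)) v)"
  by (simp add: bilin_def brk_lin B_lin)

lemma B_sum_left: "B (\<Sum>i\<in>I. z i) v = (\<Sum>i\<in>I. B (z i) v)"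
  by (rule bilin_sum_left[OF B_bilin])

lemma B_adj_casimir: "B (adj_casimir u) v = casimir (\<lambda>a b. B (brk a (brk b u)) v)"
  by (simp add: adj_casimir_def cas_def B_sum_left)

text \<open>The operator commutes with \<open>ad\<close>, so the vectors with eigenvalue 8 /
  \<kappa> form an ideal, and simplicity reduces the claim to the single vector \<open>e5\<close>.
  The constant 8 is twice the dual Coxeter number.\<close>

lemma adj_casimir: "adj_casimir u = scale (8 / \<kappa>) u"
proof -
  let ?Z = "{u. adj_casimir u = scale (8 / \<kappa>) u}"
  have comm: "adj_casimir (brk z u) = brk z (adj_casimir u)" for z u
  proof (rule B_ext)
    fix v
    have bil: "bilin scale (\<lambda>a b. B (brk a (brk b u)) v)" by (rule bilin_brk)
    have "B (brk z (adj_casimir u)) v = - casimir (\<lambda>a b. B (brk a (brk b u)) (brk z v))"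
      by (simp add: B_inv B_adj_casimir)
    also have "\<dots> = casimir (\<lambda>a b. B (brk z (brk a (brk b u))) v)"
      by (simp add: cas_def B_inv sum_negf)
    also have "\<dots> = casimir (\<lambda>a b. (B (brk (brk z a) (brk b u)) v + B (brk a (brk (brk z b) u)) v) + B (brk a (brk b (brk z u))) v)"
      unfolding cas_def by (intro sum.cong refl) (simp add: brk_jac[of z] brk_lin B_lin)
    also have "\<dots> = casimir (\<lambda>a b. B (brk a (brk b (brk z u))) v)"
      using casimir_inv[OF bil, of z] by (simp add: cas_def sum.distrib)
    finally show "B (adj_casimir (brk z u)) v = B (brk z (adj_casimir u)) v" by (simp add: B_adj_casimir)
  qed
  have add: "adj_casimir (u + v) = adj_casimir u + adj_casimir v" for u v
    by (simp add: adj_casimir_def brk_lin sum.distrib)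
  have sc: "adj_casimir (scale c u) = scale c (adj_casimir u)" for c u
    by (simp add: adj_casimir_def brk_lin scale_sum_right)
  have "subspace ?Z"
    unfolding subspace_def using add sc by (auto simp: adj_casimir_def scale_right_distrib mult.commute)
  moreover have "brk u v \<in> ?Z" if "v \<in> ?Z" for u v using that by (simp add: comm brk_lin)
  ultimately have "?Z = {0} \<or> ?Z = UNIV" by (intro only_trivial_ideals) auto
  moreover have "e5 \<in> ?Z"
  proof -
    \<comment> \<open>\<open>e5\<close> is annihilated by the positive root vectors, so each product
      of a positive and a negative root vector collapses to a coroot.\<close>
    have t: "brk z (brk f e5) = brk (brk z f) e5" if "low z" for z f using brk_e5[OF that] by (simp add: brk_brk)
    have "B (adj_casimir e5) v = B (scale (8 / \<kappa>) e5) v" for v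
    proof -
      have "\<kappa> * casimir (\<lambda>a b. B (brk a (brk b e5)) v) = 8 * B e5 v"
        unfolding casimir_root[OF bilin_brk]
        by (simp add: t low_e brk_e5 coroots wt_e[unfolded wt_def] brk_lin B_lin ef)
      then show ?thesis using kappa_nonzero by (simp add: B_adj_casimir B_lin field_simps)
    qed
    then show ?thesis using B_ext by blast
  qed
  moreover have "e5 \<noteq> 0" using B_ef(6) kappa_nonzero by (auto simp: B_lin)
  ultimately show ?thesis by auto
qed

subsection \<open>The compact real form\<close>

definition tau_list where "tau_list = [- f5, f4, - f3, f2, - f1, - f0, - h0, - h1, - e0, - e1, e2, - e3, e4, - e5]"

text \<open>The antilinear involution whose fixed points are the compact real form spanned over the reals by
  the elements \<open>y i\<close> below. The signs in \<open>tau_list\<close> compensate those in \<open>B_ef\<close>.\<close>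

definition \<tau> :: "'g \<Rightarrow> 'g" where
  "\<tau> u = (\<Sum>i<14. scale (cnj (B (dl ! i) u)) (tau_list ! i))"

lemma tau_add: "\<tau> (u + v) = \<tau> u + \<tau> v"
  by (simp add: \<tau>_def B_lin scale_left_distrib sum.distrib)

lemma tau_scale: "\<tau> (scale c u) = scale (cnj c) (\<tau> u)"
  by (simp add: \<tau>_def B_lin scale_sum_right)

lemma tau_zero [simp]: "\<tau> 0 = 0" by (simp add: \<tau>_def B_lin)

lemma tau_minus: "\<tau> (- u) = - \<tau> u" using tau_scale[of "-1" u] by simp

lemma tau_diff: "\<tau> (u - v) = \<tau> u - \<tau> v" using tau_add[of u "- v"] tau_minus[of v] by simp

lemmas tau_lin = tau_add tau_scale tau_minus tau_diff

lemma tau_sum: "\<tau> (\<Sum>i\<in>I. z i) = (\<Sum>i\<in>I. \<tau> (z i))"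
  by (induction I rule: infinite_finite_induct) (simp_all add: tau_add)

lemma tau_bl: "\<tau> e0 = - f0" "\<tau> e1 = - f1" "\<tau> e2 = f2" "\<tau> e3 = - f3" "\<tau> e4 = f4" "\<tau> e5 = - f5" "\<tau> h0 = - h0" "\<tau> h1 = - h1"
  "\<tau> f0 = - e0" "\<tau> f1 = - e1" "\<tau> f2 = e2" "\<tau> f3 = - e3" "\<tau> f4 = e4" "\<tau> f5 = - e5"
  using kappa_nonzero by (simp_all add: \<tau>_def sum14 dl_def tau_list_def B_lin B_table)

text \<open>Compatibility in \<open>u\<close> passes to sums, multiples and brackets, so
  \<open>u\<close> may be a Chevalley generator while \<open>v\<close> runs through
  \<open>bl\<close>.\<close>

lemma tau_brk: "\<tau> (brk u v) = brk (\<tau> u) (\<tau> v)"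
proof -
  have "\<forall>v. \<tau> (brk u v) = brk (\<tau> u) (\<tau> v)"
    if "u \<in> lie_subalgebra_generated scale brk {e0, e1, f0, f1, h0, h1}" for u
    using that
  proof induction
    case (gen u)
    show ?case
    proof
      fix v show "\<tau> (brk u v) = brk (\<tau> u) (\<tau> v)"
      proof (induction v rule: bl_induct)
        case (1 v)
        from gen bl_cases[OF 1] show ?case
          by (elim insertE emptyE disjE)
            (simp_all add: ad_all wt_all[unfolded wt_def] tau_bl tau_lin brk_lin)
      qed (simp_all add: tau_lin brk_lin)
    qed
  next
    case (brk u v)
    then show ?case by (simp add: brk_brk tau_lin)
  qed (simp_all add: tau_lin brk_lin)
  then show ?thesis using generated by auto
qed

text \<open>Normalises a vector of square length 2 N for - B / \<kappa>. For the root pairs below, N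
  is the modulus of the pairing in \<open>B_ef\<close> divided by \<kappa>.\<close>

definition rc :: "real \<Rightarrow> complex" where "rc N = complex_of_real (1 / sqrt (2 * N))"

lemma rc_mult: "N > 0 \<Longrightarrow> rc N * (rc N * z) = z / of_real (2 * N)"
proof -
  assume "N > 0"
  then have "(1 / sqrt (2 * N)) * (1 / sqrt (2 * N)) = 1 / (2 * N)" by (simp add: real_sqrt_mult_self)
  then have "rc N * rc N = of_real (1 / (2 * N))" unfolding rc_def by (simp only: flip: of_real_mult)
  then show ?thesis by (simp flip: mult.assoc)
qed

lemma cnj_rc [simp]: "cnj (rc N) = rc N" by (simp add: rc_def)

text \<open>An orthonormal basis of the compact real form for \<open>- B / \<kappa>\<close>.\<close>

definition yl where "yl = [
   scale (rc 36) (e5 - f5), scale (rc 36) (scale \<i> (e5 + f5)),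
   scale (rc 36) (e4 + f4), scale (rc 36) (scale \<i> (e4 - f4)),
   scale (rc 12) (e3 - f3), scale (rc 12) (scale \<i> (e3 + f3)),
   scale (rc 3) (e2 + f2), scale (rc 3) (scale \<i> (e2 - f2)),
   scale (rc 3) (e1 - f1), scale (rc 3) (scale \<i> (e1 + f1)),
   scale (rc 1) (e0 - f0), scale (rc 1) (scale \<i> (e0 + f0)),
   scale (rc 1) (scale \<i> h0), scale (rc 3) (scale \<i> (scale 3 h0 + scale 2 h1))]"

definition y where "y i = yl ! i"

lemma casimir_y:
  assumes \<beta>: "bilin scale \<beta>"
  shows "casimir \<beta> = - (1 / \<kappa>) * (\<Sum>i<14. \<beta> (y i) (y i))"
proof -
  have "\<i> * (\<i> * z) = - z" for z by (simp flip: mult.assoc)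
  then have i: "\<beta> (scale \<i> u) (scale \<i> u) = - \<beta> u u" for u by (simp add: bilinD[OF \<beta>])
  have r: "\<beta> (scale (rc N) u) (scale (rc N) u) = \<beta> u u / of_real (2 * N)" if "N > 0" for N u
    using rc_mult[OF that] by (simp add: bilinD[OF \<beta>])
  \<comment> \<open>Each root pair contributes squares of \<open>u - v\<close> and
    \<open>u + v\<close> with opposite signs, the factor \<i> supplying the minus sign, so that only
    the mixed terms survive.\<close>
  have p: "\<beta> (u - v) (u - v) / c - \<beta> (u + v) (u + v) / c = - (2 * (\<beta> u v + \<beta> v u) / c)"
    "\<beta> (u + v) (u + v) / c - \<beta> (u - v) (u - v) / c = 2 * (\<beta> u v + \<beta> v u) / c" for u v and c :: complex
    by (simp_all add: bilinD[OF \<beta>] diff_divide_distrib add_divide_distrib)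
  \<comment> \<open>\<open>3 h0 + 2 h1\<close> is orthogonal to \<open>h0\<close> and has square 6
    \<kappa>; the two Cartan squares together give the inverse Gram matrix.\<close>
  have q: "\<beta> (scale 3 h0 + scale 2 h1) (scale 3 h0 + scale 2 h1) / 6
     = 3 / 2 * \<beta> h0 h0 + \<beta> h0 h1 + \<beta> h1 h0 + 2 / 3 * \<beta> h1 h1"
    by (simp add: bilinD[OF \<beta>] add_divide_distrib)
  have "(\<Sum>i<14. \<beta> (y i) (y i)) =
      (\<beta> (e5 - f5) (e5 - f5) / 72 - \<beta> (e5 + f5) (e5 + f5) / 72)
    + (\<beta> (e4 + f4) (e4 + f4) / 72 - \<beta> (e4 - f4) (e4 - f4) / 72)
    + (\<beta> (e3 - f3) (e3 - f3) / 24 - \<beta> (e3 + f3) (e3 + f3) / 24)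
    + (\<beta> (e2 + f2) (e2 + f2) / 6 - \<beta> (e2 - f2) (e2 - f2) / 6)
    + (\<beta> (e1 - f1) (e1 - f1) / 6 - \<beta> (e1 + f1) (e1 + f1) / 6)
    + (\<beta> (e0 - f0) (e0 - f0) / 2 - \<beta> (e0 + f0) (e0 + f0) / 2)
    - \<beta> h0 h0 / 2 - \<beta> (scale 3 h0 + scale 2 h1) (scale 3 h0 + scale 2 h1) / 6"
    by (simp add: sum14 y_def yl_def r i del: scale_scale)
  also have "\<dots> = - (\<kappa> * casimir \<beta>)"
    unfolding casimir_root[OF \<beta>] p q by (simp add: add_divide_distrib)
  finally have "(\<Sum>i<14. \<beta> (y i) (y i)) = - (\<kappa> * casimir \<beta>)" .
  then show ?thesis using kappa_nonzero by simp
qed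

text \<open>\<open>casimir_y\<close> for the product \<open>B a u * B b v\<close> transports the
  expansion along the orthonormal basis \<open>x\<close> to the family \<open>y\<close>.\<close>

lemma y_expand: "u = (\<Sum>i<14. scale (- (1 / \<kappa>) * B (y i) u) (y i))"
proof (rule B_ext)
  fix v
  have bil: "bilin scale (\<lambda>a b. B a u * B b v)" by (simp add: bilin_def B_lin algebra_simps)
  have "B u v = B (\<Sum>i<n. scale (B (x i) u) (x i)) v" by (simp flip: x_expand)
  also have "\<dots> = casimir (\<lambda>a b. B a u * B b v)" by (simp add: B_sum_left cas_def B_lin)
  also have "\<dots> = B (\<Sum>i<14. scale (- (1 / \<kappa>) * B (y i) u) (y i)) v"
    unfolding casimir_y[OF bil] by (simp add: B_sum_left B_lin sum_distrib_left sum_negf)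
  finally show "B u v = B (\<Sum>i<14. scale (- (1 / \<kappa>) * B (y i) u) (y i)) v" .
qed

lemma tau_y: assumes "i < 14" shows "\<tau> (y i) = y i"
  using nat14_cases[OF assms]
  by (elim disjE) (simp_all add: y_def yl_def tau_lin tau_bl scale_right_distrib scale_right_diff_distrib algebra_simps)

definition M :: "nat \<Rightarrow> nat \<Rightarrow> nat \<Rightarrow> real" where
  "M k i m = Re (- (1 / \<kappa>) * B (y m) (brk (y k) (y i)))"

lemma M_antisym: "M k i m = - M k m i"
  using B_skew[of "y m" "y k" "y i"] by (simp add: M_def)

lemma brk_y:
  assumes "k < 14" "i < 14"
  shows "brk (y k) (y i) = (\<Sum>m<14. scale (of_real (M k i m)) (y m))"
proof -
  define z where "z = brk (y k) (y i)"
  define a where "a m = - (1 / \<kappa>) * B (y m) z" for m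
  have z: "z = (\<Sum>m<14. scale (a m) (y m))" unfolding a_def by (rule y_expand)
  \<comment> \<open>Being fixed by \<tau>, the bracket has a second expansion with conjugate
    coefficients; the mean of the two expansions has real coefficients.\<close>
  have "z = \<tau> z" using assms by (simp add: z_def tau_brk tau_y)
  also have "\<dots> = (\<Sum>m<14. scale (cnj (a m)) (y m))"
    by (subst z) (simp add: tau_sum tau_scale tau_y)
  finally have "z + z = (\<Sum>m<14. scale (a m + cnj (a m)) (y m))"
    using z by (simp add: scale_left_distrib sum.distrib)
  then have "scale 2 z = (\<Sum>m<14. scale (of_real (2 * Re (a m))) (y m))"
    using scale_left_distrib[of 1 1 z] by (simp only: complex_add_cnj) simp
  then have "scale (1/2) (scale 2 z) = (\<Sum>m<14. scale (of_real (Re (a m))) (y m))"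
    by (simp only: scale_sum_right) simp
  then show ?thesis by (simp add: z_def M_def a_def)
qed

end

section \<open>Alternating forms annihilating the dual of the bracket\<close>

context simple_lie_algebra_with_basis
begin

text \<open>The contractions span the copy of the Lie algebra in its exterior square, written with
  the bracket instead of the structure constants. Forms are thus the functionals on the exterior
  algebra modulo the ideal generated by that copy.\<close>

definition FRel :: "(('g \<Rightarrow> 'g \<Rightarrow> complex) \<Rightarrow> complex) set" where
  "FRel = range (\<lambda>u \<beta>. \<beta> u u) \<union> range (\<lambda>u \<beta>. casimir (\<lambda>a b. \<beta> a (brk u b)))"

abbreviation form :: "('g list \<Rightarrow> complex) \<Rightarrow> bool" where "form \<equiv> qform scale FRel"

lemma rel_fun_FRel: "\<rho> \<in> FRel \<Longrightarrow> rel_fun \<rho>"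
  unfolding FRel_def rel_fun_def cas_def by (auto simp: sum.distrib sum_distrib_left)

lemmas form_mlin = qform_mlin[of scale FRel]
lemmas form_ctx = qform_ctx[of scale FRel]
lemmas form_Cons = qform_Cons[of scale FRel]

lemma form_add: "form w \<Longrightarrow> form w' \<Longrightarrow> form (\<lambda>t. w t + w' t)"
  by (rule qform_add[OF rel_fun_FRel])

lemma form_scale: "form w \<Longrightarrow> form (\<lambda>t. c * w t)"
  by (rule qform_scale[OF rel_fun_FRel])

lemma form_zero: "form (\<lambda>t. 0)"
  by (rule qform_0[OF rel_fun_FRel])

lemma form_sum: "(\<And>i. i \<in> I \<Longrightarrow> form (w i)) \<Longrightarrow> form (\<lambda>t. \<Sum>i\<in>I. w i t)"
  by (rule qform_sum[OF rel_fun_FRel])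

lemma form_lin_hull: "(\<And>w. w \<in> G \<Longrightarrow> form w) \<Longrightarrow> w \<in> lin_hull G \<Longrightarrow> form w"
  by (rule qform_lin_hull[OF rel_fun_FRel])

lemma form_same: "form w \<Longrightarrow> w (l @ u # u # r) = 0"
  using qform_rel[of scale FRel w "\<lambda>\<beta>. \<beta> u u" l r] by (simp add: FRel_def)

lemma form_contract: "form w \<Longrightarrow> casimir (\<lambda>a b. w (l @ a # brk u b # r)) = 0"
  using qform_rel[of scale FRel w "\<lambda>\<beta>. casimir (\<lambda>a b. \<beta> a (brk u b))" l r] by (simp add: FRel_def)

lemma formI:
  assumes "mlin scale w" "\<And>l u r. w (l @ u # u # r) = 0"
    "\<And>l u r. casimir (\<lambda>a b. w (l @ a # brk u b # r)) = 0"
  shows "form w"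
  unfolding qform_def FRel_def using assms by auto

lemma form_swap: "form w \<Longrightarrow> w (l @ u # v # r) = - w (l @ v # u # r)"
  by (rule alternating_swap[OF form_mlin form_same])

lemma form_swap0: "form w \<Longrightarrow> w (u # v # r) = - w (v # u # r)"
  using form_swap[of w "[]" u v r] by simp

text \<open>By invariance of the Casimir tensor, applying \<open>ad z\<close> to the relation of
  \<open>u\<close> gives the relation of \<open>brk z u\<close>.\<close>

lemma form_der:
  assumes w: "form w" shows "form (der (brk z) w)"
proof (rule qform_der[OF w])
  fix \<rho> and \<beta> :: "'g \<Rightarrow> 'g \<Rightarrow> complex"
  assume \<rho>: "\<rho> \<in> FRel" and \<beta>: "bilin scale \<beta>" and all: "\<And>\<rho>. \<rho> \<in> FRel \<Longrightarrow> \<rho> \<beta> = 0"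
  have alt: "\<beta> u u = 0" for u using all[of "\<lambda>\<beta>. \<beta> u u"] by (simp add: FRel_def)
  have con: "casimir (\<lambda>a b. \<beta> a (brk u b)) = 0" for u
    using all[of "\<lambda>\<beta>. casimir (\<lambda>a b. \<beta> a (brk u b))"] by (simp add: FRel_def)
  from \<rho> consider u where "\<rho> = (\<lambda>\<beta>. \<beta> u u)" | u where "\<rho> = (\<lambda>\<beta>. casimir (\<lambda>a b. \<beta> a (brk u b)))"
    unfolding FRel_def by auto
  then show "\<rho> (\<lambda>a b. \<beta> (brk z a) b + \<beta> a (brk z b)) = 0"
  proof cases
    case 1
    have "\<beta> (brk z u + u) (brk z u + u) = \<beta> (brk z u) u + \<beta> u (brk z u)"
      unfolding bilinD(1)[OF \<beta>] bilinD(2)[OF \<beta>] by (simp add: alt)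
    then show ?thesis by (simp add: 1 alt)
  next
    case 2
    have b2: "bilin scale (\<lambda>a b. \<beta> a (brk u b))"
      by (simp add: bilin_def brk_lin bilinD[OF \<beta>])
    have "\<beta> (brk z a) (brk u b) + \<beta> a (brk z (brk u b))
       = (\<beta> (brk z a) (brk u b) + \<beta> a (brk u (brk z b))) + \<beta> a (brk (brk z u) b)" for a b
      by (simp add: brk_jac[of z u] bilinD[OF \<beta>])
    then show ?thesis unfolding 2
      using casimir_inv[OF b2, of z] con[of "brk z u"] by (simp add: cas_def sum.distrib)
  qed
qed (simp_all add: brk_lin rel_fun_FRel)

text \<open>Alternation makes the contraction \<open>s u v\<close> antisymmetric in \<open>u\<close>
  and \<open>v\<close>. Moving one bracket across by invariance shows that
  \<open>s u v - s v u\<close> is the bracket contraction of \<open>brk u v\<close>, hence zero. So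
  \<open>s\<close> is symmetric as well and vanishes.\<close>

lemma form_contract2:
  assumes w: "form w" shows "casimir (\<lambda>a b. w (l @ brk a u # brk b v # r)) = 0"
proof -
  define \<beta> where "\<beta> a b = w (l @ a # b # r)" for a b
  have \<beta>: "bilin scale \<beta>" unfolding \<beta>_def by (rule mlin_bilin[OF form_mlin[OF w]])
  have sw: "\<beta> a b = - \<beta> b a" for a b unfolding \<beta>_def by (rule form_swap[OF w])
  have con: "casimir (\<lambda>a b. \<beta> a (brk u b)) = 0" for u unfolding \<beta>_def by (rule form_contract[OF w])
  have b2: "bilin scale (\<lambda>a b. \<beta> a (brk u b))" for u
    by (simp add: bilin_def brk_lin bilinD[OF \<beta>])
  define s where "s u v = casimir (\<lambda>a b. \<beta> (brk u a) (brk v b))" for u v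
  have 1: "s u v = - casimir (\<lambda>a b. \<beta> a (brk v (brk u b)))" for u v
    unfolding s_def by (rule casimir_inv'[OF b2])
  have 2: "s u v = - s v u" unfolding s_def cas_def sum_negf[symmetric] by (intro sum.cong refl sw)
  have "casimir (\<lambda>a b. \<beta> a (brk u (brk v b))) - casimir (\<lambda>a b. \<beta> a (brk v (brk u b)))
     = casimir (\<lambda>a b. \<beta> a (brk (brk u v) b))"
    by (simp add: cas_def brk_brk bilinD[OF \<beta>] sum_subtractf)
  then have "s u v + s u v = 0" using 1[of u v] 1[of v u] 2 con[of "brk u v"] by (simp add: algebra_simps)
  then have "s u v = 0" by simp
  moreover have "casimir (\<lambda>a b. \<beta> (brk a u) (brk b v)) = s u v"
    unfolding s_def cas_def by (intro sum.cong refl) (simp add: brk_anti[of _ u] brk_anti[of _ v] bilinD[OF \<beta>])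
  ultimately show ?thesis by (simp add: \<beta>_def)
qed

text \<open>The cross terms of the Casimir operator between one argument and all later ones.
  Exchanging the first two arguments moves \<open>brk a u\<close> past \<open>v\<close>, and the
  induction continues with the form in which \<open>v\<close> is fixed.\<close>

lemma form_mixed:
  assumes "form w" shows "casimir (\<lambda>a b. der (brk b) (\<lambda>s. w (brk a u # s)) us) = 0"
  using assms
proof (induction us arbitrary: w)
  case Nil show ?case by (simp add: cas_def)
next
  case (Cons v us)
  have "casimir (\<lambda>a b. der (brk b) (\<lambda>s. w (brk a u # v # s)) us)
     = - casimir (\<lambda>a b. der (brk b) (\<lambda>s. w (v # brk a u # s)) us)"
    unfolding cas_def sum_negf[symmetric] der_minus[symmetric]
    by (intro sum.cong refl der_cong_length form_swap0[OF Cons.prems])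
  also have "\<dots> = 0" using Cons.IH[OF form_Cons[OF Cons.prems, of v]] by simp
  finally show ?case using form_contract2[OF Cons.prems, of "[]" u v us]
    by (simp add: cas_def sum.distrib)
qed

lemma der_brk_lin:
  assumes "mlin scale w"
  shows "der (brk (a + b)) w us = der (brk a) w us + der (brk b) w us"
    "der (brk (scale c a)) w us = c * der (brk a) w us"
    "der (brk (- a)) w us = - der (brk a) w us"
    "der (brk (a - b)) w us = der (brk a) w us - der (brk b) w us"
    "der (brk 0) w us = 0"
proof -
  have e: "brk (a + b) = (\<lambda>u. brk a u + brk b u)" "brk (scale c a) = (\<lambda>u. scale c (brk a u))" for a b c
    by (simp_all add: fun_eq_iff brk_lin)
  show 1: "der (brk (a + b)) w us = der (brk a) w us + der (brk b) w us" for a b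
    unfolding e by (rule der_map_add) (rule mlin_plus[OF assms])
  show 2: "der (brk (scale c a)) w us = c * der (brk a) w us" for c a
    unfolding e by (rule der_map_scale[OF assms])
  show 3: "der (brk (- a)) w us = - der (brk a) w us" for a using 2[of "-1" a] by simp
  show "der (brk (a - b)) w us = der (brk a) w us - der (brk b) w us" using 1[of a "- b"] 3[of b] by simp
  show "der (brk 0) w us = 0" using 2[of 0 0] by simp
qed

lemma der_brk_brk:
  assumes "mlin scale w"
  shows "der (brk (brk a b)) w us = der (brk b) (der (brk a) w) us - der (brk a) (der (brk b) w) us"
proof -
  have "brk (brk a b) = (\<lambda>u. brk a (brk b u) - brk b (brk a u))" by (simp add: fun_eq_iff brk_brk)
  then show ?thesis using der_commutator[OF assms] by simp
qed

lemma mlin_der_brk: "mlin scale w \<Longrightarrow> mlin scale (der (brk a) w)"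
  by (rule mlin_der) (simp_all add: brk_lin)

lemma bilin_der2:
  assumes "mlin scale w" shows "bilin scale (\<lambda>a b. der (brk a) (der (brk b) w) us)"
proof -
  have "der (brk (a + b)) w = (\<lambda>us. der (brk a) w us + der (brk b) w us)"
    "der (brk (scale c a)) w = (\<lambda>us. c * der (brk a) w us)" for a b c
    by (simp_all add: fun_eq_iff der_brk_lin[OF assms])
  then show ?thesis unfolding bilin_def
    by (simp add: der_brk_lin[OF mlin_der_brk[OF assms]] der_add der_scale)
qed

end

section \<open>Casimir eigenvalues at highest weight lists\<close>

context G2
begin

lemma casimir_form:
  assumes "form w"
  shows "casimir (\<lambda>a b. der (brk a) (der (brk b) w) us) = of_nat (length us) * (8 / \<kappa>) * w us"
  using assms
proof (induction us arbitrary: w)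
  case Nil show ?case by (simp add: cas_def)
next
  case (Cons u us)
  have 1: "casimir (\<lambda>a b. w (brk b (brk a u) # us)) = 8 / \<kappa> * w (u # us)"
  proof -
    have "casimir (\<lambda>a b. w (brk b (brk a u) # us)) = w (adj_casimir u # us)"
      by (simp add: adj_casimir_def mlin_sum0[OF form_mlin[OF Cons.prems]] cas_def)
    then show ?thesis by (simp add: adj_casimir mlin_scale0[OF form_mlin[OF Cons.prems]])
  qed
  have 2: "casimir (\<lambda>a b. der (brk b) (\<lambda>s. w (brk a u # s)) us) = 0" by (rule form_mixed[OF Cons.prems])
  \<comment> \<open>Both factors are the same basis vector in each summand, so the two cross terms
    coincide; hence the factor 2.\<close>
  have "casimir (\<lambda>a b. der (brk a) (der (brk b) w) (u # us)) =
     casimir (\<lambda>a b. w (brk b (brk a u) # us)) + 2 * casimir (\<lambda>a b. der (brk b) (\<lambda>s. w (brk a u # s)) us)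
     + casimir (\<lambda>a b. der (brk a) (der (brk b) (\<lambda>s. w (u # s))) us)"
    by (simp add: cas_def sum.distrib der_add sum_distrib_left)
  then show ?case using Cons.IH[OF form_Cons[OF Cons.prems, of u]] 1 2 by (simp add: algebra_simps add_divide_distrib)
qed

text \<open>The image of the tensor \<open>t\<close> modulo the relations is zero or a highest
  weight vector of weight \<open>(m0, m1)\<close>; forms see nothing but this image.\<close>

definition highest :: "complex \<Rightarrow> complex \<Rightarrow> 'g list \<Rightarrow> bool" where
  "highest m0 m1 t \<longleftrightarrow> (\<forall>w. form w \<longrightarrow> (\<forall>z. low z \<longrightarrow> der (brk z) w t = 0) \<and>
     der (brk h0) w t = m0 * w t \<and> der (brk h1) w t = m1 * w t)"

text \<open>\<open>3 \<kappa>\<close> times the Casimir eigenvalue on a module of highest weight \<open>(a, b)\<close>; correspondingly 24 is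
  \<open>3 \<kappa>\<close> times the eigenvalue \<open>8 / \<kappa>\<close> of \<open>adj_casimir\<close>.\<close>

definition eig :: "complex \<Rightarrow> complex \<Rightarrow> complex" where
  "eig a b = 6 * a^2 + 6 * a * b + 2 * b^2 + 18 * a + 10 * b"

text \<open>The hypothesis on the pairs \<open>(e, f)\<close> makes the terms with \<open>e\<close>
  acting on the list vanish, and reordering the remaining ones leaves coroots. Their weighted sum is
  the linear part 18 a + 10 b of \<open>eig\<close>, the familiar shift by 2 \<rho>. Comparison with
  \<open>casimir_form\<close> gives the equation.\<close>

lemma casimir_highest:
  assumes w: "form w" and u: "wt a b u" and t: "highest m0 m1 t"
    and z: "\<And>e f. (e, f) \<in> {(e0, f0), (e1, f1), (e2, f2), (e3, f3), (e4, f4), (e5, f5)} \<Longrightarrow>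
        der (brk f) w (brk e u # t) = 0"
  shows "24 * (of_nat (length t) + 1) * w (u # t) = eig (a + m0) (b + m1) * w (u # t)"
proof -
  let ?\<beta> = "\<lambda>c d. der (brk c) (der (brk d) w) (u # t)"
  note ml = form_mlin[OF w]
  have H0: "der (brk h0) v (u # t) = (a + m0) * v (u # t)"
    and H1: "der (brk h1) v (u # t) = (b + m1) * v (u # t)" if "form v" for v
    using u t form_Cons[OF that, of u] by (simp_all add: wt_def highest_def mlin_scale0[OF form_mlin[OF that]] algebra_simps)
  have ef: "?\<beta> e f = 0" if "(e, f) \<in> {(e0, f0), (e1, f1), (e2, f2), (e3, f3), (e4, f4), (e5, f5)}" for e f
  proof -
    have "low e" using that low_e by auto
    then show ?thesis using z[OF that] t form_Cons[OF form_der[OF w, of f], of u] by (simp add: highest_def)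
  qed
  have fe: "?\<beta> f e = der (brk (brk e f)) w (u # t)"
    if "(e, f) \<in> {(e0, f0), (e1, f1), (e2, f2), (e3, f3), (e4, f4), (e5, f5)}" for e f
    using der_brk_brk[OF ml, of e f "u # t"] ef[OF that] by simp
  have hh: "?\<beta> h0 h0 = (a + m0)^2 * w (u # t)" "?\<beta> h0 h1 = (a + m0) * (b + m1) * w (u # t)"
    "?\<beta> h1 h0 = (a + m0) * (b + m1) * w (u # t)" "?\<beta> h1 h1 = (b + m1)^2 * w (u # t)"
    unfolding H0[OF form_der[OF w]] H1[OF form_der[OF w]] H0[OF w] H1[OF w] by (simp_all add: power2_eq_square)
  have "3 * (\<kappa> * casimir ?\<beta>) = eig (a + m0) (b + m1) * w (u # t)"
    unfolding casimir_root[OF bilin_der2[OF ml]] hh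
    by (simp only: ef fe insert_iff simp_thms coroots ad_e0_f(1) ad_e1_f(2) der_brk_lin[OF ml] H0[OF w] H1[OF w])
       (simp add: eig_def algebra_simps add_divide_distrib diff_divide_distrib)
  moreover have "3 * (\<kappa> * casimir ?\<beta>) = 24 * (of_nat (length t) + 1) * w (u # t)"
    unfolding casimir_form[OF w] using kappa_nonzero by (simp add: algebra_simps)
  ultimately show ?thesis by metis
qed

text \<open>A space of forms stable under the negative root vectors, where vanishing at a highest weight list
  propagates to all lists of that length.\<close>

definition family :: "('g list \<Rightarrow> complex) set \<Rightarrow> bool" where
  "family F \<longleftrightarrow> (\<forall>w\<in>F. form w \<and> der (brk f0) w \<in> F \<and> der (brk f1) w \<in> F) \<and>
    (\<forall>w\<in>F. \<forall>w'\<in>F. (\<lambda>t. w t + w' t) \<in> F) \<and> (\<forall>w\<in>F. \<forall>c. (\<lambda>t. c * w t) \<in> F)"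

lemma family_f:
  assumes F: "family F" and w: "w \<in> F" and f: "g \<in> {f0, f1, f2, f3, f4, f5}"
  shows "der (brk g) w \<in> F"
proof -
  have br: "\<forall>w\<in>F. der (brk (brk p q)) w \<in> F" if "\<forall>w\<in>F. der (brk p) w \<in> F" "\<forall>w\<in>F. der (brk q) w \<in> F" for p q
  proof
    fix w assume w: "w \<in> F"
    have add: "\<And>v v'. v \<in> F \<Longrightarrow> v' \<in> F \<Longrightarrow> (\<lambda>t. v t + v' t) \<in> F"
      and sc: "\<And>v c. v \<in> F \<Longrightarrow> (\<lambda>t. c * v t) \<in> F" using F unfolding family_def by simp_all
    have "(\<lambda>us. der (brk q) (der (brk p) w) us + - 1 * der (brk p) (der (brk q) w) us) \<in> F"
      by (intro add sc) (use w that in simp_all)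
    moreover have "der (brk (brk p q)) w = (\<lambda>us. der (brk q) (der (brk p) w) us + - 1 * der (brk p) (der (brk q) w) us)"
      using der_brk_brk[of w p q] F w form_mlin unfolding family_def by (auto simp: fun_eq_iff)
    ultimately show "der (brk (brk p q)) w \<in> F" by simp
  qed
  have 0: "\<forall>w\<in>F. der (brk f0) w \<in> F" "\<forall>w\<in>F. der (brk f1) w \<in> F" using F unfolding family_def by auto
  have 2: "\<forall>w\<in>F. der (brk f2) w \<in> F" unfolding f2_def by (rule br[OF 0(2) 0(1)])
  have 3: "\<forall>w\<in>F. der (brk f3) w \<in> F" unfolding f3_def by (rule br[OF 0(2) 2])
  have 4: "\<forall>w\<in>F. der (brk f4) w \<in> F" unfolding f4_def by (rule br[OF 0(2) 3])
  have 5: "\<forall>w\<in>F. der (brk f5) w \<in> F" unfolding f5_def by (rule br[OF 0(1) 4])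
  show ?thesis using f w 0 2 3 4 5 by auto
qed

lemma family_lin_hull:
  assumes "\<And>w. w \<in> G \<Longrightarrow> form w" "\<And>w. w \<in> G \<Longrightarrow> der (brk f0) w \<in> lin_hull G"
    "\<And>w. w \<in> G \<Longrightarrow> der (brk f1) w \<in> lin_hull G"
  shows "family (lin_hull G)"
proof -
  have d: "der d w \<in> lin_hull G" if "\<And>w. w \<in> G \<Longrightarrow> der d w \<in> lin_hull G" "w \<in> lin_hull G" for d w
    using that(2)
  proof induction
    case (add w w')
    have "der d (\<lambda>t. w t + w' t) = (\<lambda>t. der d w t + der d w' t)" by (simp add: fun_eq_iff der_add)
    then show ?case using lin_hull.add[OF add.IH] by simp
  next
    case (scale w c)
    have "der d (\<lambda>t. c * w t) = (\<lambda>t. c * der d w t)" by (simp add: fun_eq_iff der_scale)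
    then show ?case using lin_hull.scale[OF scale.IH] by simp
  qed (use that in blast)
  show ?thesis unfolding family_def
    using form_lin_hull[of G] assms(1) d[of "brk f0"] d[of "brk f1"] assms(2,3)
    by (auto intro: lin_hull.add lin_hull.scale)
qed

lemma lin_hull_vanish: "w \<in> lin_hull G \<Longrightarrow> (\<And>w. w \<in> G \<Longrightarrow> w t = 0) \<Longrightarrow> w t = 0"
  by (induction rule: lin_hull.induct) auto

definition determines :: "nat \<Rightarrow> 'g list \<Rightarrow> bool" where
  "determines p t \<longleftrightarrow> (\<forall>F. family F \<longrightarrow> (\<forall>w\<in>F. w t = 0) \<longrightarrow> (\<forall>w\<in>F. \<forall>us. length us = p \<longrightarrow> w us = 0))"

lemma wt_bl: assumes "k < 14" shows "wt (fst (wl ! k)) (fst (snd (wl ! k))) (bl ! k)"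
  using nat14_cases[OF assms] by (elim disjE) (simp_all add: wl_def bl_def wt_all)

text \<open>A whole family is needed rather than one form: the vanishing at earlier vectors is
  applied to \<open>der (brk f) w\<close>, because positive root vectors move \<open>bl ! k\<close>
  to earlier vectors. Indices whose eigenvalue happens to agree are left to the hypothesis
  \<open>k\<close>.\<close>

lemma vanish_step:
  assumes F: "family F" and t: "highest m0 m1 t" and p: "length t = p"
    and k: "\<And>k. k < 14 \<Longrightarrow> eig (fst (wl ! k) + m0) (fst (snd (wl ! k)) + m1) = 24 * (of_nat p + 1) \<Longrightarrow>
       \<forall>w\<in>F. w (bl ! k # t) = 0"
  shows "\<forall>w\<in>F. \<forall>u. w (u # t) = 0"
proof -
  have s: "\<forall>w\<in>F. \<forall>u\<in>span (set (take k bl)). w (u # t) = 0" if "k \<le> 14" for k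
    using that
  proof (induction k)
    case 0
    then show ?case using F mlin_zero0 form_mlin unfolding family_def by fastforce
  next
    case (Suc k)
    then have IH: "\<And>w u. w \<in> F \<Longrightarrow> u \<in> span (set (take k bl)) \<Longrightarrow> w (u # t) = 0" by simp
    have k14: "k < 14" using Suc.prems by simp
    have len: "length bl = 14" by (simp add: bl_def)
    have b: "w (bl ! k # t) = 0" if w: "w \<in> F" for w
    proof -
      have "24 * (of_nat (length t) + 1) * w (bl ! k # t)
          = eig (fst (wl ! k) + m0) (fst (snd (wl ! k)) + m1) * w (bl ! k # t)"
      proof (rule casimir_highest[OF _ wt_bl[OF k14] t])
        show "form w" using F w unfolding family_def by blast
        fix e f assume ef: "(e, f) \<in> {(e0, f0), (e1, f1), (e2, f2), (e3, f3), (e4, f4), (e5, f5)}"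
        then have "low e" using low_e by auto
        then show "der (brk f) w (brk e (bl ! k) # t) = 0"
          using ef family_f[OF F w, of f] by (intro IH low_nth k14) auto
      qed
      then show ?thesis using k[OF k14] p w by (cases "w (bl ! k # t) = 0") auto
    qed
    show ?case
    proof (intro ballI)
      fix w u assume w: "w \<in> F" and "u \<in> span (set (take (Suc k) bl))"
      then obtain c where "u - scale c (bl ! k) \<in> span (set (take k bl))"
        using k14 len by (auto simp: take_Suc_conv_app_nth span_breakdown_eq)
      then have "w ((u - scale c (bl ! k)) # t) = 0" by (rule IH[OF w])
      moreover have "mlin scale w" using F w form_mlin unfolding family_def by blast
      ultimately show "w (u # t) = 0" using b[OF w] by (simp add: mlin_diff0 mlin_scale0)
    qed
  qed
  show ?thesis using s[of 14] span_bl by (simp add: bl_def)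
qed

text \<open>Fixing the first argument commutes with \<open>der\<close> up to the term in which that
  argument itself is moved, and this term is another slice. Detection in degree p can therefore be
  applied to forms of degree p + 1.\<close>

lemma family_shift:
  assumes "family F" shows "family (lin_hull {\<lambda>s. w (u # s) |w u. w \<in> F})" (is "family (lin_hull ?G)")
proof (rule family_lin_hull)
  show "form w" if "w \<in> ?G" for w using that assms form_Cons unfolding family_def by blast
  have d: "der (brk f) w \<in> lin_hull ?G" if w: "w \<in> ?G" and f: "\<And>w. w \<in> F \<Longrightarrow> der (brk f) w \<in> F" for w f
  proof -
    obtain v u where v: "w = (\<lambda>s. v (u # s))" "v \<in> F" using w by blast
    have e: "der (brk f) w = (\<lambda>s. der (brk f) v (u # s) + - 1 * v (brk f u # s))" by (simp add: v fun_eq_iff)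
    have "(\<lambda>s. der (brk f) v (u # s)) \<in> ?G" "(\<lambda>s. v (brk f u # s)) \<in> ?G" using v f by blast+
    then show ?thesis unfolding e by (intro lin_hull.add lin_hull.scale lin_hull.base)
  qed
  show "der (brk f0) w \<in> lin_hull ?G" "der (brk f1) w \<in> lin_hull ?G" if "w \<in> ?G" for w
    using d[OF that] assms unfolding family_def by blast+
qed

lemma determines_step:
  assumes "determines p t" "family F" "\<forall>w\<in>F. \<forall>u. w (u # t) = 0"
  shows "\<forall>w\<in>F. \<forall>us. length us = Suc p \<longrightarrow> w us = 0"
proof (intro ballI allI impI)
  fix w and us :: "'g list" assume w: "w \<in> F" and us: "length us = Suc p"
  let ?G = "{\<lambda>s. w (u # s) |w u. w \<in> F}"
  have "\<forall>w\<in>lin_hull ?G. w t = 0" using lin_hull_vanish[of _ ?G t] assms(3) by blast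
  then have v: "\<forall>w\<in>lin_hull ?G. \<forall>us. length us = p \<longrightarrow> w us = 0"
    using assms(1) family_shift[OF assms(2)] unfolding determines_def by blast
  obtain u vs where uv: "us = u # vs" "length vs = p" using us by (cases us) auto
  have "(\<lambda>s. w (u # s)) \<in> lin_hull ?G" using w by (intro lin_hull.base) blast
  from bspec[OF v this] show "w us = 0" using uv by simp
qed

lemma form_top:
  assumes "form w"
  shows "w (e5 # e5 # r) = 0" "w (e4 # e4 # r) = 0" "w (e5 # e4 # e5 # r) = 0" "w (e3 # e3 # r) = 0"
    "w (e4 # e3 # e4 # r) = 0" "w (e5 # e3 # e4 # e5 # r) = 0"
proof -
  note s = form_same[OF assms, of "[]", simplified] form_same[OF assms, of "[_]", simplified]
     form_same[OF assms, of "[_, _]", simplified]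
  note sw = form_swap0[OF assms] form_swap[OF assms, of "[_]", simplified]
  show "w (e5 # e5 # r) = 0" "w (e4 # e4 # r) = 0" "w (e3 # e3 # r) = 0" by (fact s)+
  show "w (e5 # e4 # e5 # r) = 0" by (subst sw(1)) (simp add: s)
  show "w (e4 # e3 # e4 # r) = 0" by (subst sw(1)) (simp add: s)
  show "w (e5 # e3 # e4 # e5 # r) = 0" by (subst sw(1), subst sw(2)) (simp add: s)
qed

text \<open>Positive root vectors send each of \<open>e5\<close>, \<open>e4\<close>,
  \<open>e3\<close> into the span of the preceding ones, so every term repeats an argument. The
  weights are the partial sums of the weights of these three vectors.\<close>

lemma highest_top: "highest 0 0 []" "highest 1 0 [e5]" "highest 0 3 [e4, e5]" "highest 0 4 [e3, e4, e5]"
proof -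
  note wts = wt_e[unfolded wt_def]
  show "highest 0 0 []" by (simp add: highest_def)
  show "highest 1 0 [e5]"
    unfolding highest_def by (auto simp: brk_e5 wts mlin_zero0[OF form_mlin])
  show "highest 0 3 [e4, e5]" unfolding highest_def
  proof (intro allI impI conjI)
    fix w assume w: "form w"
    note l = mlin_scale0[OF form_mlin[OF w]] mlin_scale[OF form_mlin[OF w], of "[_]", simplified]
      mlin_zero[OF form_mlin[OF w], of "[_]", simplified] mlin_uminus0[OF form_mlin[OF w]]
    show "der (brk h0) w [e4, e5] = 0 * w [e4, e5]" "der (brk h1) w [e4, e5] = 3 * w [e4, e5]"
      by (simp_all add: wts l)
    fix z assume z: "low z"
    obtain c where "brk z e4 = scale c e5" using brk_e4[OF z] by blast
    then show "der (brk z) w [e4, e5] = 0" by (simp add: brk_e5[OF z] l form_top[OF w])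
  qed
  show "highest 0 4 [e3, e4, e5]" unfolding highest_def
  proof (intro allI impI conjI)
    fix w assume w: "form w"
    note l = mlin_scale0[OF form_mlin[OF w]] mlin_scale[OF form_mlin[OF w], of "[_]", simplified]
      mlin_scale[OF form_mlin[OF w], of "[_, _]", simplified]
      mlin_zero[OF form_mlin[OF w], of "[_, _]", simplified] mlin_uminus[OF form_mlin[OF w], of "[_]", simplified]
      mlin_plus0[OF form_mlin[OF w]] mlin_zero0[OF form_mlin[OF w]]
    show "der (brk h0) w [e3, e4, e5] = 0 * w [e3, e4, e5]" "der (brk h1) w [e3, e4, e5] = 4 * w [e3, e4, e5]"
      by (simp_all add: wts l)
    fix z assume z: "low z"
    obtain c where c: "brk z e4 = scale c e5" using brk_e4[OF z] by blast
    obtain a b where "brk z e3 = scale a e5 + scale b e4" using brk_e3[OF z] by blast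
    then show "der (brk z) w [e3, e4, e5] = 0"
      using form_same[OF w, of "[_]", simplified]
      by (simp add: c brk_e5[OF z] l form_top[OF w])
  qed
qed

text \<open>A check over the 14 weights. The surviving sums (1, 0), (0, 3), (0, 4) have
  \<open>eig\<close> equal to 24, 48, 72. In the last line, adding \<open>e2\<close>, which does not
  commute with \<open>e3\<close>, would give 90 instead of 96.\<close>

lemma eig_exceptional:
  assumes "k < 14"
  shows "eig (fst (wl ! k) + 0) (fst (snd (wl ! k)) + 0) = 24 * (of_nat 0 + 1) \<Longrightarrow> k = 0"
    "eig (fst (wl ! k) + 1) (fst (snd (wl ! k)) + 0) = 24 * (of_nat 1 + 1) \<Longrightarrow> k = 1"
    "eig (fst (wl ! k) + 0) (fst (snd (wl ! k)) + 3) = 24 * (of_nat 2 + 1) \<Longrightarrow> k = 2"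
    "eig (fst (wl ! k) + 0) (fst (snd (wl ! k)) + 4) \<noteq> 24 * (of_nat 3 + 1)"
  using nat14_cases[OF assms] by - (elim disjE; simp add: wl_def eig_def)+

lemma determines_Suc:
  assumes d: "determines p t" and t: "highest m0 m1 t" "length t = p"
    and k: "\<And>k. k < 14 \<Longrightarrow> eig (fst (wl ! k) + m0) (fst (snd (wl ! k)) + m1) = 24 * (of_nat p + 1) \<Longrightarrow> k = j"
  shows "determines (Suc p) (bl ! j # t)"
  unfolding determines_def
proof (intro allI impI)
  fix F assume F: "family F" and z: "\<forall>w\<in>F. w (bl ! j # t) = 0"
  have "\<forall>w\<in>F. \<forall>u. w (u # t) = 0"
    by (rule vanish_step[OF F t]) (use k z in blast)
  then show "\<forall>w\<in>F. \<forall>us. length us = Suc p \<longrightarrow> w us = 0" by (rule determines_step[OF d F])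
qed

lemma determines_top: "determines 0 []" "determines 1 [e5]" "determines 2 [e4, e5]" "determines 3 [e3, e4, e5]"
proof -
  have bl: "bl ! 0 = e5" "bl ! 1 = e4" "bl ! 2 = e3" by (simp_all add: bl_def)
  show 0: "determines 0 []" by (simp add: determines_def)
  show 1: "determines 1 [e5]"
    using determines_Suc[OF 0 highest_top(1) _ eig_exceptional(1)] by (simp add: bl)
  show 2: "determines 2 [e4, e5]"
    using determines_Suc[OF 1 highest_top(2) _ eig_exceptional(2)] by (simp add: bl(2)[simplified] numeral_2_eq_2)
  show "determines 3 [e3, e4, e5]"
    using determines_Suc[OF 2 highest_top(3) _ eig_exceptional(3)] by (simp add: bl_def numeral_3_eq_3 numeral_2_eq_2)
qed

lemma family_form: "family {w. form w}"
  unfolding family_def using form_der form_add form_scale by auto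

lemma form_4: assumes "form w" "length us \<ge> 4" shows "w us = 0"
proof -
  have "\<forall>w\<in>{w. form w}. \<forall>u. w (u # [e3, e4, e5]) = 0"
    by (rule vanish_step[OF family_form highest_top(4)]) (use eig_exceptional(4) in auto)
  then have 4: "\<forall>w\<in>{w. form w}. \<forall>us. length us = Suc 3 \<longrightarrow> w us = 0"
    using determines_step[OF determines_top(4) family_form] by blast
  \<comment> \<open>For longer lists the arguments after the fourth are held fixed.\<close>
  have "form (\<lambda>t. w (t @ drop 4 us))" using form_ctx[OF assms(1), of "[]" "drop 4 us"] by simp
  then have "w (take 4 us @ drop 4 us) = 0"
    using 4[rule_format, of "\<lambda>t. w (t @ drop 4 us)" "take 4 us"] assms(2) by simp
  then show ?thesis by simp
qed

end

section \<open>Invariant pairs of forms\<close>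

context simple_lie_algebra_with_basis
begin

definition pairform :: "('g list \<Rightarrow> 'g list \<Rightarrow> complex) \<Rightarrow> bool" where
  "pairform P \<longleftrightarrow> (\<forall>vs. form (\<lambda>us. P us vs)) \<and> (\<forall>us. form (P us))"

definition invariant :: "('g list \<Rightarrow> 'g list \<Rightarrow> complex) \<Rightarrow> bool" where
  "invariant P \<longleftrightarrow> (\<forall>z us vs. der (brk z) (\<lambda>t. P t vs) us + der (brk z) (P us) vs = 0)"

lemma pairformD: "pairform P \<Longrightarrow> form (\<lambda>us. P us vs)" "pairform P \<Longrightarrow> form (P us)"
  by (simp_all add: pairform_def)

lemma invariantD:
  "invariant P \<Longrightarrow> der (brk z) (\<lambda>t. P t vs) us = - der (brk z) (P us) vs"
  "invariant P \<Longrightarrow> der (brk z) (P us) vs = - der (brk z) (\<lambda>t. P t vs) us"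
  by (simp_all add: invariant_def eq_neg_iff_add_eq_0 add.commute)

text \<open>For an invariant pair the action on one side is minus the action on the other, where
  \<open>der\<close> replaces single arguments of \<open>r\<close>. Hence the span of all slices of
  a given degree is stable under the Lie algebra.\<close>

lemma der_in_lin_hull:
  assumes "length r = q"
  shows "(\<lambda>s. der d (P s) r) \<in> lin_hull {\<lambda>s. P s r |r. length r = q}"
proof -
  have "(\<lambda>s. der d (\<lambda>t. P s (pre @ t)) r) \<in> lin_hull {\<lambda>s. P s r |r. length r = q}"
    if "length pre + length r = q" for pre r
    using that
  proof (induction r arbitrary: pre)
    case Nil
    then have "(\<lambda>s. 0 * P s pre) \<in> lin_hull {\<lambda>s. P s r |r. length r = q}"
      by (intro lin_hull.scale lin_hull.base) auto
    then show ?case by simp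
  next
    case (Cons u r)
    have "(\<lambda>s. P s (pre @ d u # r)) \<in> lin_hull {\<lambda>s. P s r |r. length r = q}"
      using Cons.prems by (intro lin_hull.base) auto
    moreover have "(\<lambda>s. der d (\<lambda>t. P s ((pre @ [u]) @ t)) r) \<in> lin_hull {\<lambda>s. P s r |r. length r = q}"
      using Cons.prems by (intro Cons.IH) simp
    ultimately have "(\<lambda>s. P s (pre @ d u # r) + der d (\<lambda>t. P s ((pre @ [u]) @ t)) r)
       \<in> lin_hull {\<lambda>s. P s r |r. length r = q}" by (rule lin_hull.add)
    then show ?case by simp
  qed
  from this[of "[]" r] assms show ?thesis by simp
qed

lemma lin_hull_mono: "w \<in> lin_hull G \<Longrightarrow> G \<subseteq> H \<Longrightarrow> w \<in> lin_hull H"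
  by (induction rule: lin_hull.induct) (auto intro: lin_hull.intros)

lemma lin_hull_minus: "w \<in> lin_hull G \<Longrightarrow> (\<lambda>t. - w t) \<in> lin_hull G"
  using lin_hull.scale[of w G "-1"] by simp

lemma lin_hull_zero: "w \<in> G \<Longrightarrow> (\<lambda>t. 0) \<in> lin_hull G"
  using lin_hull.scale[OF lin_hull.base, of w G 0] by simp

lemma form_move: "form w \<Longrightarrow> w (l @ u # r) = (-1) ^ length l * w (u # l @ r)"
proof (induction l arbitrary: w)
  case (Cons v l)
  have "w (v # l @ u # r) = (-1) ^ length l * w (v # u # l @ r)"
    using Cons.IH[OF form_Cons[OF Cons.prems, of v]] .
  then show ?case using form_swap0[OF Cons.prems, of v u "l @ r"] by simp
qed simp

end

context G2
begin

text \<open>From 3 on the list stays the same, since no forms exist in higher degrees;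
  \<open>top_bottom_min\<close> makes use of this truncation.\<close>

fun top :: "nat \<Rightarrow> 'g list" where
  "top 0 = []" | "top (Suc 0) = [e5]" | "top (Suc (Suc 0)) = [e4, e5]" | "top _ = [e3, e4, e5]"

fun bottom :: "nat \<Rightarrow> 'g list" where
  "bottom 0 = []" | "bottom (Suc 0) = [f5]" | "bottom (Suc (Suc 0)) = [f4, f5]" | "bottom _ = [f3, f4, f5]"

text \<open>\<open>tw0\<close> and \<open>tw1\<close> are the weights of \<open>top p\<close> from
  \<open>highest_top\<close>. They differ for different degrees up to 3, which will separate the
  bidegrees.\<close>

fun tw0 :: "nat \<Rightarrow> complex" where "tw0 p = (if p = 1 then 1 else 0)"
fun tw1 :: "nat \<Rightarrow> complex" where "tw1 p = (if p = 2 then 3 else if p = 3 then 4 else 0)"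

lemma le3_cases: "p \<le> 3 \<Longrightarrow> p = 0 \<or> p = 1 \<or> p = 2 \<or> p = (3::nat)" by linarith

lemma top_facts: assumes "p \<le> 3"
  shows "highest (tw0 p) (tw1 p) (top p)" "determines p (top p)"
  using le3_cases[OF assms] highest_top determines_top
  by (auto simp: numeral_2_eq_2 numeral_3_eq_3)

lemma low_top: "form w \<Longrightarrow> p \<le> 3 \<Longrightarrow> low z \<Longrightarrow> der (brk z) w (top p) = 0"
  "form w \<Longrightarrow> p \<le> 3 \<Longrightarrow> der (brk h0) w (top p) = tw0 p * w (top p)"
  "form w \<Longrightarrow> p \<le> 3 \<Longrightarrow> der (brk h1) w (top p) = tw1 p * w (top p)"
  using top_facts(1)[of p] unfolding highest_def by blast+

definition family_minus :: "('g list \<Rightarrow> complex) set \<Rightarrow> bool" where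
  "family_minus F \<longleftrightarrow> (\<forall>w\<in>F. form w \<and> der (brk e0) w \<in> F \<and> der (brk e1) w \<in> F) \<and>
    (\<forall>w\<in>F. \<forall>w'\<in>F. (\<lambda>t. w t + w' t) \<in> F) \<and> (\<forall>w\<in>F. \<forall>c. (\<lambda>t. c * w t) \<in> F)"

lemma bottom_facts: assumes p: "p \<le> 3"
  shows determines_bottom: "family_minus F \<Longrightarrow> \<forall>w\<in>F. w (bottom p) = 0 \<Longrightarrow> w \<in> F \<Longrightarrow> length us = p \<Longrightarrow> w us = 0"
    and low_bottom: "form w \<Longrightarrow> z \<in> {f0, f1, f2, f3, f4, f5} \<Longrightarrow> der (brk z) w (bottom p) = 0"
       "form w \<Longrightarrow> der (brk h0) w (bottom p) = - tw0 p * w (bottom p)"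
       "form w \<Longrightarrow> der (brk h1) w (bottom p) = - tw1 p * w (bottom p)"
    and family_minus_lin_hull: "(\<And>w. w \<in> G \<Longrightarrow> form w) \<Longrightarrow> (\<And>w. w \<in> G \<Longrightarrow> der (brk e0) w \<in> lin_hull G) \<Longrightarrow>
      (\<And>w. w \<in> G \<Longrightarrow> der (brk e1) w \<in> lin_hull G) \<Longrightarrow> family_minus (lin_hull G)"
proof -
  interpret sw: G2 scale brk B n x f f0 f1 e0 e1 "- h0" "- h1" by (rule swap)
  have d: "sw.e2 = f2" "sw.e3 = f3" "sw.e4 = f4" "sw.e5 = f5"
    by (simp_all add: sw.e2_def sw.e3_def sw.e4_def sw.e5_def f2_def f3_def f4_def f5_def)
  have t: "sw.top p = bottom p" using le3_cases[OF p] by (auto simp: numeral_2_eq_2 numeral_3_eq_3 d)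
  have F: "sw.family F = family_minus F" for F by (simp add: sw.family_def family_minus_def)
  show "family_minus F \<Longrightarrow> \<forall>w\<in>F. w (bottom p) = 0 \<Longrightarrow> w \<in> F \<Longrightarrow> length us = p \<Longrightarrow> w us = 0"
    using sw.top_facts(2)[OF p] unfolding sw.determines_def t F by blast
  show "family_minus (lin_hull G)" if "\<And>w. w \<in> G \<Longrightarrow> form w" "\<And>w. w \<in> G \<Longrightarrow> der (brk e0) w \<in> lin_hull G"
      "\<And>w. w \<in> G \<Longrightarrow> der (brk e1) w \<in> lin_hull G"
    unfolding F[symmetric] using that by (rule sw.family_lin_hull)
  assume w: "form w"
  show "z \<in> {f0, f1, f2, f3, f4, f5} \<Longrightarrow> der (brk z) w (bottom p) = 0"
    using sw.low_top(1)[OF w p, of z] sw.low_e by (auto simp: t d)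
  show "der (brk h0) w (bottom p) = - tw0 p * w (bottom p)" "der (brk h1) w (bottom p) = - tw1 p * w (bottom p)"
    using sw.low_top(2,3)[OF w p] unfolding t der_brk_lin(3)[OF form_mlin[OF w]]
    by (metis minus_minus mult_minus_left)+
qed

lemma tw_inj: "p \<le> 3 \<Longrightarrow> q \<le> 3 \<Longrightarrow> tw0 p = tw0 q \<Longrightarrow> tw1 p = tw1 q \<Longrightarrow> p = q"
  using le3_cases[of p] le3_cases[of q] by auto

text \<open>Two propagations. Raising operators kill \<open>top p\<close>, hence by invariance the
  form \<open>P (top p)\<close>; its multiples are a family for the opposite Borel subalgebra,
  detected at \<open>bottom q\<close>. After that, the slices in the first variable are a family
  detected at \<open>top p\<close>.\<close>

lemma invariant_vanish_aux:
  assumes P: "pairform P" and inv: "invariant P" and pq: "p \<le> 3" "q \<le> 3"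
    and z: "P (top p) (bottom q) = 0" and us: "length us = p" "length vs = q"
  shows "P us vs = 0"
proof -
  have top0: "P (top p) vs = 0" if "length vs = q" for vs
  proof -
    have d: "der (brk e) (P (top p)) \<in> lin_hull {P (top p)}" if "low e" for e
    proof -
      have "der (brk e) (P (top p)) = (\<lambda>t. 0)"
        using low_top(1)[OF pairformD(1)[OF P] pq(1) that] by (simp add: fun_eq_iff invariantD(2)[OF inv])
      then show ?thesis using lin_hull_zero[of "P (top p)"] by auto
    qed
    have "family_minus (lin_hull {P (top p)})"
      using d low_e pairformD(2)[OF P] by (intro family_minus_lin_hull[OF pq(1)]) auto
    then show ?thesis
      using lin_hull_vanish[of _ "{P (top p)}" "bottom q"] z that
      by (intro determines_bottom[OF pq(2), of "lin_hull {P (top p)}"]) (auto intro: lin_hull.base)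
  qed
  let ?G = "{\<lambda>s. P s r |r. length r = q}"
  have d: "der (brk g) w \<in> lin_hull ?G" if wG: "w \<in> ?G" for w g
  proof -
    obtain r where r: "w = (\<lambda>s. P s r)" "length r = q" using wG by blast
    have "der (brk g) w = (\<lambda>s. - der (brk g) (P s) r)" by (simp add: r fun_eq_iff invariantD(1)[OF inv])
    then show ?thesis using lin_hull_minus[OF der_in_lin_hull[OF r(2), of "brk g" P]] by simp
  qed
  have fam: "family (lin_hull ?G)"
    using d pairformD(1)[OF P] by (intro family_lin_hull) auto
  have "\<forall>w\<in>lin_hull ?G. w (top p) = 0"
    using lin_hull_vanish[of _ ?G "top p"] top0 by blast
  then have "\<forall>w\<in>lin_hull ?G. \<forall>us. length us = p \<longrightarrow> w us = 0"
    using top_facts(2)[OF pq(1)] fam unfolding determines_def by blast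
  moreover have "(\<lambda>s. P s vs) \<in> lin_hull ?G" using us by (intro lin_hull.base) blast
  ultimately show ?thesis using us by fastforce
qed

lemma invariant_vanish:
  assumes P: "pairform P" and inv: "invariant P"
    and z: "length us = length vs \<Longrightarrow> P (top (length us)) (bottom (length us)) = 0"
  shows "P us vs = 0"
proof (cases "length us \<le> 3 \<and> length vs \<le> 3")
  case True
  let ?p = "length us" and ?q = "length vs"
  have z': "P (top ?p) (bottom ?q) = 0"
  proof (cases "?p = ?q")
    case False
    \<comment> \<open>The weights of the top and bottom lists enter with opposite signs, so
      invariance under \<open>h0\<close> and \<open>h1\<close> allows a nonzero value only for equal
      weights.\<close>
    have "(tw0 ?p - tw0 ?q) * P (top ?p) (bottom ?q) = 0" "(tw1 ?p - tw1 ?q) * P (top ?p) (bottom ?q) = 0"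
      using inv[unfolded invariant_def, rule_format, of h0 "bottom ?q" "top ?p"]
        inv[unfolded invariant_def, rule_format, of h1 "bottom ?q" "top ?p"]
        low_top(2,3)[OF pairformD(1)[OF P], of ?p] low_bottom(2,3)[OF _ pairformD(2)[OF P], of ?q] True
      by (simp_all only: left_diff_distrib) simp_all
    then show ?thesis using tw_inj[of ?p ?q] True False by (metis eq_iff_diff_eq_0 mult_eq_0_iff)
  qed (use z in simp)
  show ?thesis by (rule invariant_vanish_aux[OF P inv conjunct1[OF True] conjunct2[OF True] z' refl refl])
next
  case False
  then show ?thesis using form_4[OF pairformD(1)[OF P], of us] form_4[OF pairformD(2)[OF P], of vs] by auto
qed

subsection \<open>The mixed contraction\<close>

text \<open>The value on the mixed bracket relation of \<open>z\<close>, with one argument of each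
  form contracted away. Its vanishing is what lets \<open>P\<close> descend to A.\<close>

definition contr :: "('g list \<Rightarrow> 'g list \<Rightarrow> complex) \<Rightarrow> 'g \<Rightarrow> 'g list \<Rightarrow> 'g list \<Rightarrow> complex" where
  "contr P z a b = casimir (\<lambda>u v. P (u # a) (brk z v # b))"

lemma bilin_pair:
  assumes "pairform P" shows "bilin scale (\<lambda>u v. P (l @ u # a) (l' @ v # b))"
  unfolding bilin_def using mlin_plus[OF form_mlin[OF pairformD(1)[OF assms]]] mlin_plus[OF form_mlin[OF pairformD(2)[OF assms]]]
    mlin_scale[OF form_mlin[OF pairformD(1)[OF assms]]] mlin_scale[OF form_mlin[OF pairformD(2)[OF assms]]]
  by blast

lemmas bilin_pair0 = bilin_pair[of _ "[]" _ "[]", simplified]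

lemma form_contr:
  assumes "pairform P" shows "form (\<lambda>a. contr P z a b)" "form (contr P z a)"
  unfolding contr_def[abs_def] cas_def using assms
  by (auto intro!: form_sum form_Cons[of "\<lambda>t. P t _"] form_Cons[of "P _"] simp: pairform_def)

lemma contr_lin:
  assumes "pairform P"
  shows "contr P (z + z') a b = contr P z a b + contr P z' a b" "contr P (scale c z) a b = c * contr P z a b"
    "contr P (- z) a b = - contr P z a b" "contr P (z - z') a b = contr P z a b - contr P z' a b"
  using bilinD[OF bilin_pair0[OF assms]]
  by (simp_all add: contr_def cas_def brk_lin sum.distrib sum_distrib_left sum_negf sum_subtractf)

lemma contr_flip:
  assumes "pairform P" shows "contr P z a b = - casimir (\<lambda>u v. P (brk z u # a) (v # b))"
  using casimir_inv'[OF bilin_pair0[OF assms], of z a b] by (simp add: contr_def)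

lemma contr_invariant:
  assumes P: "pairform P" and inv: "invariant P"
  shows "der (brk s) (\<lambda>a. contr P z a b) a + der (brk s) (contr P z a) b + contr P (brk s z) a b = 0"
proof -
  note b = bilinD[OF bilin_pair0[OF P]]
  have i: "der (brk s) (\<lambda>t. P (u # t) (v # b)) a + der (brk s) (\<lambda>t. P (u # a) (v # t)) b
     = - P (brk s u # a) (v # b) - P (u # a) (brk s v # b)" for u v
    using inv[unfolded invariant_def, rule_format, of s "v # b" "u # a"] by (simp add: algebra_simps eq_neg_iff_add_eq_0)
  have "der (brk s) (\<lambda>a. contr P z a b) a + der (brk s) (contr P z a) b
    = casimir (\<lambda>u v. der (brk s) (\<lambda>t. P (u # t) (brk z v # b)) a + der (brk s) (\<lambda>t. P (u # a) (brk z v # t)) b)"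
    unfolding contr_def[abs_def] cas_def by (simp add: der_sum sum.distrib)
  also have "\<dots> = - casimir (\<lambda>u v. P (brk s u # a) (brk z v # b)) - casimir (\<lambda>u v. P (u # a) (brk s (brk z v) # b))"
    by (simp add: i cas_def sum_negf sum_subtractf)
  also have "casimir (\<lambda>u v. P (brk s u # a) (brk z v # b)) = - casimir (\<lambda>u v. P (u # a) (brk z (brk s v) # b))"
    by (rule casimir_inv') (simp add: bilin_def b brk_lin)
  also have "casimir (\<lambda>u v. P (u # a) (brk s (brk z v) # b)) =
     contr P (brk s z) a b + casimir (\<lambda>u v. P (u # a) (brk z (brk s v) # b))"
    by (simp add: contr_def brk_jac[of s z] b cas_def sum.distrib)
  finally show ?thesis by simp
qed

text \<open>\<open>contr_flip\<close> puts the bracket into the first form. Summing over the basis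
  then gives, for each fixed \<open>x j\<close> in the second form, a cross term of the kind treated
  in \<open>form_mixed\<close>.\<close>

lemma contr_casimir:
  assumes P: "pairform P"
  shows "casimir (\<lambda>p p'. der (brk p') (\<lambda>s. contr P p s b) a) = 0"
proof -
  have "casimir (\<lambda>p p'. der (brk p') (\<lambda>s. contr P p s b) a)
     = - (\<Sum>i<n. \<Sum>j<n. der (brk (x i)) (\<lambda>s. P (brk (x i) (x j) # s) (x j # b)) a)"
    unfolding contr_flip[OF P] by (simp add: cas_def der_minus der_sum sum_negf)
  also have "\<dots> = - (\<Sum>j<n. casimir (\<lambda>p p'. der (brk p') (\<lambda>s. P (brk p (x j) # s) (x j # b)) a))"
    unfolding cas_def by (subst sum.swap) simp
  also have "\<dots> = 0" using form_mixed[OF pairformD(1)[OF P]] by simp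
  finally show ?thesis .
qed

lemma contr_top:
  assumes P: "pairform P" and inv: "invariant P"
  shows "contr P z (top 2) (bottom 2) = 0"
proof -
  let ?a = "top 2" and ?b = "bottom 2"
  let ?c = "\<lambda>z. contr P z ?a ?b"
  note lin = contr_lin[OF P]
  have ci: "?c (brk s z) = - der (brk s) (\<lambda>a. contr P z a ?b) ?a - der (brk s) (contr P z ?a) ?b" for s z
    using contr_invariant[OF P inv, of s z ?b ?a] by (simp add: algebra_simps eq_neg_iff_add_eq_0)
  have hi: "der (brk z) (\<lambda>a. contr P u a ?b) ?a = 0" if "low z" for z u
    using low_top(1)[OF form_contr(1)[OF P] _ that] by simp
  have lo: "der (brk z) (contr P u ?a) ?b = 0" if "z \<in> {f0, f1, f2, f3, f4, f5}" for z u
    using low_bottom(1)[OF _ form_contr(2)[OF P] that] by simp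
  have h: "der (brk h0) (\<lambda>a. contr P u a ?b) ?a = 0" "der (brk h1) (\<lambda>a. contr P u a ?b) ?a = 3 * ?c u"
    "der (brk h0) (contr P u ?a) ?b = 0" "der (brk h1) (contr P u ?a) ?b = - 3 * ?c u" for u
    using low_top(2,3)[OF form_contr(1)[OF P], of 2] low_bottom(2,3)[OF _ form_contr(2)[OF P], of 2] by simp_all
  have c0: "?c h0 = 0"
  proof -
    \<comment> \<open>\<open>ad e0\<close> kills \<open>f4\<close> and sends \<open>f5\<close> to
      \<open>f4\<close>, so \<open>e0\<close> annihilates the list \<open>[f4, f5]\<close> although
      it is a raising operator. As it also annihilates \<open>top 2\<close>, the value at
      \<open>h0 = brk e0 f0\<close> is zero.\<close>
    have "der (brk e0) w ?b = 0" if "form w" for w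
      using form_same[OF that, of "[]"] mlin_zero0[OF form_mlin[OF that]]
      by (simp add: numeral_2_eq_2 ad_all)
    then show ?thesis using ci[of e0 f0] hi[OF low_e(1), of f0] form_contr(2)[OF P] by (simp add: ef)
  qed
  let ?\<beta> = "\<lambda>p p'. der (brk p') (\<lambda>s. contr P p s ?b) ?a"
  have bil: "bilin scale ?\<beta>"
  proof -
    have "(\<lambda>s. contr P (u + v) s ?b) = (\<lambda>s. contr P u s ?b + contr P v s ?b)"
      "(\<lambda>s. contr P (scale c u) s ?b) = (\<lambda>s. c * contr P u s ?b)" for u v c
      by (simp_all add: contr_lin[OF P])
    then show ?thesis unfolding bilin_def
      by (simp add: der_add der_scale der_brk_lin[OF form_mlin[OF form_contr(1)[OF P]]])
  qed
  have fe: "?\<beta> g e = 0" if "low e" for e g by (rule hi[OF that])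
  have ef': "?\<beta> e g = ?c (brk e g)" if "g \<in> {f0, f1, f2, f3, f4, f5}" for e g
    using ci[of g e] lo[OF that, of e] brk_anti[of g e] by (simp add: lin)
  have "casimir ?\<beta> = 0" by (rule contr_casimir[OF P])
  \<comment> \<open>The coroots contribute 6 for \<open>h0\<close> and 10/3 for \<open>h1\<close>;
    the weight (0, 3) of \<open>top 2\<close> adds 3 and 2 through the Cartan part of the Casimir
    tensor.\<close>
  then have "9 * ?c h0 + 16 / 3 * ?c h1 = 0"
    using casimir_root[OF bil]
    by (simp add: fe low_e ef' h coroots ef lin add_divide_distrib diff_divide_distrib add.commute)
  then have c1: "?c h1 = 0" using c0 by simp
  \<comment> \<open>The weights of the two lists cancel, so only a vector of weight zero can have a
    nonzero value.\<close>
  have root: "?c u = 0" if "wt m0 m1 u" "m0 \<noteq> 0 \<or> m1 \<noteq> 0" for u m0 m1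
  proof -
    have "m0 * ?c u = 0" "m1 * ?c u = 0"
      using ci[of h0 u] ci[of h1 u] that(1) by (simp_all add: wt_def h lin)
    then show ?thesis using that(2) by auto
  qed
  show "?c z = 0"
  proof (induction z rule: bl_induct)
    case (1 u)
    show ?case using bl_cases[OF 1] c0 c1
      by (elim disjE) (simp_all add: wt_all[THEN root])
  qed (simp_all add: lin)
qed

text \<open>The propagation of \<open>invariant_vanish_aux\<close> with an additional parameter:
  equivariance moves the action partly into \<open>z\<close>, so the slices for all \<open>z\<close>
  are spanned together.\<close>

lemma contr_zero:
  assumes P: "pairform P" and inv: "invariant P" and ab: "length a = 2" "length b = 2"
  shows "contr P z a b = 0"
proof -
  have top0: "contr P z (top 2) b = 0" if "length b = 2" for z b
  proof -
    let ?G = "range (\<lambda>z. contr P z (top 2))"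
    have d: "der (brk e) w \<in> lin_hull ?G" if "low e" "w \<in> ?G" for e w
    proof -
      obtain z where z: "w = contr P z (top 2)" using \<open>w \<in> ?G\<close> by blast
      have "der (brk e) w = (\<lambda>b. - contr P (brk e z) (top 2) b)"
        using contr_invariant[OF P inv, of e z _ "top 2"] low_top(1)[OF form_contr(1)[OF P] _ \<open>low e\<close>, of 2 z]
        by (simp add: z fun_eq_iff eq_neg_iff_add_eq_0)
      then show ?thesis using lin_hull_minus[OF lin_hull.base, of "contr P (brk e z) (top 2)" ?G] by simp
    qed
    have "family_minus (lin_hull ?G)"
      using d low_e form_contr(2)[OF P] by (intro family_minus_lin_hull[of 2]) auto
    then show ?thesis
      using lin_hull_vanish[of _ ?G "bottom 2"] contr_top[OF P inv] that
      by (intro determines_bottom[of 2 "lin_hull ?G"]) (auto intro: lin_hull.base)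
  qed
  let ?G = "{\<lambda>a. contr P z a b |z b. length b = 2}"
  have d: "der (brk g) w \<in> lin_hull ?G" if wG: "w \<in> ?G" for w g
  proof -
    obtain z r where r: "w = (\<lambda>a. contr P z a r)" "length r = 2" using wG by blast
    have e: "der (brk g) w = (\<lambda>a. - der (brk g) (contr P z a) r + - contr P (brk g z) a r)"
      using contr_invariant[OF P inv, of g z r] by (auto simp: r fun_eq_iff algebra_simps eq_neg_iff_add_eq_0)
    have "(\<lambda>a. der (brk g) (contr P z a) r) \<in> lin_hull ?G"
      by (rule lin_hull_mono[OF der_in_lin_hull[OF r(2)]]) blast
    moreover have "(\<lambda>a. contr P (brk g z) a r) \<in> lin_hull ?G" using r(2) by (intro lin_hull.base) blast
    ultimately show ?thesis unfolding e by (intro lin_hull.add lin_hull_minus)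
  qed
  have fam: "family (lin_hull ?G)"
    using d form_contr(1)[OF P] by (intro family_lin_hull) auto
  have "\<forall>w\<in>lin_hull ?G. w (top 2) = 0"
    using lin_hull_vanish[of _ ?G "top 2"] top0 by blast
  then have "\<forall>w\<in>lin_hull ?G. \<forall>us. length us = 2 \<longrightarrow> w us = 0"
    using top_facts(2)[of 2] fam unfolding determines_def by simp
  moreover have "(\<lambda>a. contr P z a b) \<in> lin_hull ?G" using ab by (intro lin_hull.base) blast
  ultimately show ?thesis using ab by fastforce
qed

text \<open>The contracted arguments are moved to the front with signs; support in bidegree (3, 3)
  leaves two arguments on each side, the case of \<open>contr_zero\<close>.\<close>

lemma contract_mixed:
  assumes P: "pairform P" and inv: "invariant P"
    and supp: "\<And>us vs. P us vs \<noteq> 0 \<Longrightarrow> length us = 3 \<and> length vs = 3"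
  shows "casimir (\<lambda>u v. P (l @ u # r) (l' @ brk z v # r')) = 0"
proof -
  have "P (l @ u # r) (l' @ v # r') = (-1) ^ length l * ((-1) ^ length l' * P (u # l @ r) (v # l' @ r'))" for u v
    using form_move[OF pairformD(1)[OF P], of l u r "l' @ v # r'"] form_move[OF pairformD(2)[OF P], of "u # l @ r" l' v r']
    by simp
  then have "casimir (\<lambda>u v. P (l @ u # r) (l' @ brk z v # r'))
    = (-1) ^ length l * ((-1) ^ length l' * contr P z (l @ r) (l' @ r'))"
    by (simp add: contr_def cas_def sum_distrib_left)
  moreover have "contr P z (l @ r) (l' @ r') = 0"
  proof (cases "length (l @ r) = 2 \<and> length (l' @ r') = 2")
    case True then show ?thesis by (intro contr_zero[OF P inv]) auto
  next
    case False
    then have "P (u # l @ r) (v # l' @ r') = 0" for u v using supp[of "u # l @ r" "v # l' @ r'"] by auto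
    then show ?thesis by (simp add: contr_def cas_def)
  qed
  ultimately show ?thesis by simp
qed

end

subsection \<open>An invariant pair of 3-forms\<close>

context G2
begin

abbreviation W3 :: "nat list set" where "W3 \<equiv> words {..<14} 3"

lemma finite_W3: "finite W3" by (simp add: finite_words)

lemma form_restrict: assumes "form w" shows "form (\<lambda>us. if length us = k then w us else 0)"
proof (rule formI)
  note ml = form_mlin[OF assms]
  show "mlin scale (\<lambda>us. if length us = k then w us else 0)"
    by (rule mlinI) (simp_all add: mlin_plus[OF ml] mlin_scale[OF ml])
  show "(if length (l @ u # u # r) = k then w (l @ u # u # r) else 0) = 0" for l u r
    by (simp add: form_same[OF assms])
  show "casimir (\<lambda>a b. if length (l @ a # brk u b # r) = k then w (l @ a # brk u b # r) else 0) = 0" for l u r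
    using form_contract[OF assms, of l u r]
    by (cases "Suc (Suc (length l + length r)) = k") (simp_all add: cas_def)
qed

definition bar :: "('g list \<Rightarrow> complex) \<Rightarrow> 'g list \<Rightarrow> complex" where
  "bar w us = cnj (w (map \<tau> us))"

lemma form_bar: assumes "form w" shows "form (bar w)"
proof (rule formI)
  note ml = form_mlin[OF assms]
  show mlb: "mlin scale (bar w)"
    by (rule mlinI) (simp_all add: bar_def tau_lin mlin_plus[OF ml] mlin_scale[OF ml])
  show "bar w (l @ u # u # r) = 0" for l u r by (simp add: bar_def form_same[OF assms])
  fix l u r
  have b1: "bilin scale (\<lambda>a b. bar w (l @ a # brk u b # r))"
    using mlin_bilin[OF mlb, of l r] by (simp add: bilin_def brk_lin)
  have b2: "bilin scale (\<lambda>a b. w (map \<tau> l @ a # brk (\<tau> u) b # map \<tau> r))"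
    using mlin_bilin[OF ml, of "map \<tau> l" "map \<tau> r"] by (simp add: bilin_def brk_lin)
  \<comment> \<open>In the basis \<open>y\<close> of \<tau>-fixed vectors the contraction can be
    conjugated term by term.\<close>
  have "(\<Sum>i<14. w (map \<tau> l @ y i # brk (\<tau> u) (y i) # map \<tau> r)) = 0"
    using casimir_y[OF b2] form_contract[OF assms] kappa_nonzero by simp
  then have "(\<Sum>i<14. bar w (l @ y i # brk u (y i) # r)) = 0"
    by (simp add: bar_def tau_brk tau_y flip: cnj_sum)
  then show "casimir (\<lambda>a b. bar w (l @ a # brk u b # r)) = 0" by (simp add: casimir_y[OF b1])
qed

lemma der_bar: "der (brk z) (bar w) us = cnj (der (brk (\<tau> z)) w (map \<tau> us))"
proof (induction us arbitrary: w)
  case (Cons u us)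
  have "(\<lambda>t. bar w (u # t)) = bar (\<lambda>t. w (\<tau> u # t))" by (simp add: bar_def fun_eq_iff)
  then show ?case by (simp add: Cons.IH) (simp add: bar_def tau_brk)
qed simp

lemma bar_y: assumes "w \<in> words {..<14} k" shows "bar q (map y w) = cnj (q (map y w))"
proof -
  have "map \<tau> (map y w) = map y w"
    using assms by (induction k arbitrary: w) (auto simp: tau_y)
  then show ?thesis by (simp only: bar_def)
qed

lemma y_eq_0:
  assumes "mlin scale w" "\<And>v. v \<in> words {..<14} (length us) \<Longrightarrow> w (map y v) = 0"
  shows "w us = 0"
  by (rule mlin_eq_0[where s = scale and z = y and c = "\<lambda>i u. - (1 / \<kappa>) * B (y i) u", OF finite_lessThan y_expand assms])

text \<open>Summing over the orthonormal basis turns the contraction into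
  \<open>- B p (brk u q)\<close>, which invariance rewrites as \<open>B u (brk p q)\<close>.\<close>

lemma commuting_wedge:
  assumes "brk p q = 0"
  shows "casimir (\<lambda>a b. B p a * B q (brk u b)) = 0"
proof -
  have "casimir (\<lambda>a b. B p a * B q (brk u b)) = B p (\<Sum>i<n. scale (- B (x i) (brk u q)) (x i))"
    by (simp add: cas_def bilin_sum_right[OF B_bilin] B_lin B_skew[of q] mult.commute)
  also have "\<dots> = - B p (\<Sum>i<n. scale (B (x i) (brk u q)) (x i))" by (simp add: bilin_sum_right[OF B_bilin] B_lin sum_negf)
  also have "\<dots> = - B p (brk u q)" by (simp flip: x_expand)
  also have "B p (brk u q) = - B u (brk p q)" using form_invariant[of p u q] B_inv[of p u q] by simp
  finally show ?thesis using assms by (simp add: B_lin)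
qed

text \<open>The wedge product of \<open>B e3\<close>, \<open>B e4\<close>, \<open>B e5\<close>: the contractions vanish as these vectors commute.\<close>

lemma nontrivial_3form: "\<exists>w. form w \<and> w [f3, f4, f5] \<noteq> 0"
proof -
  define D where "D a b c = B e3 a * (B e4 b * B e5 c - B e5 b * B e4 c)
     + B e4 a * (B e5 b * B e3 c - B e3 b * B e5 c) + B e5 a * (B e3 b * B e4 c - B e4 b * B e3 c)" for a b c
  define w where "w us = (case us of [a, b, c] \<Rightarrow> D a b c | _ \<Rightarrow> 0)" for us
  have e24: "brk e2 e4 = 0" unfolding e2_def brk_brk by (simp add: ad_all)
  have e34: "brk e3 e4 = 0" unfolding e3_def brk_brk by (simp add: ad_all e24)
  have e43: "brk e4 e3 = 0" using brk_anti[of e4 e3] e34 by simp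
  have e5z: "brk z e5 = 0" "brk e5 z = 0" if "low z" for z using brk_e5[OF that] brk_anti[of e5 z] by simp_all
  note com = e34 e43 e5z(1)[OF low_e(4)] e5z(1)[OF low_e(5)] e5z(2)[OF low_e(4)] e5z(2)[OF low_e(5)]
  note cw = commuting_wedge[OF com(1)] commuting_wedge[OF com(2)] commuting_wedge[OF com(3)]
    commuting_wedge[OF com(4)] commuting_wedge[OF com(5)] commuting_wedge[OF com(6)]
  have D: "D (a + a') b c = D a b c + D a' b c" "D a (b + b') c = D a b c + D a b' c" "D a b (c + c') = D a b c + D a b c'"
    "D (scale k a) b c = k * D a b c" "D a (scale k b) c = k * D a b c" "D a b (scale k c) = k * D a b c"
    "D a a c = 0" "D a b b = 0" for a a' b b' c c' k
    by (simp_all add: D_def B_lin algebra_simps)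
  have C1: "casimir (\<lambda>a b. D a (brk u b) c) = 0" for u c
  proof -
    have "D a b c = (B e3 a * B e4 b) * B e5 c + - (B e3 a * B e5 b) * B e4 c + (B e4 a * B e5 b) * B e3 c
       + - (B e4 a * B e3 b) * B e5 c + (B e5 a * B e3 b) * B e4 c + - (B e5 a * B e4 b) * B e3 c" for a b
      by (simp add: D_def algebra_simps)
    then have "casimir (\<lambda>a b. D a (brk u b) c) =
        casimir (\<lambda>a b. B e3 a * B e4 (brk u b)) * B e5 c + - casimir (\<lambda>a b. B e3 a * B e5 (brk u b)) * B e4 c
      + casimir (\<lambda>a b. B e4 a * B e5 (brk u b)) * B e3 c + - casimir (\<lambda>a b. B e4 a * B e3 (brk u b)) * B e5 c
      + casimir (\<lambda>a b. B e5 a * B e3 (brk u b)) * B e4 c + - casimir (\<lambda>a b. B e5 a * B e4 (brk u b)) * B e3 c"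
      by (simp only: cas_def sum.distrib sum_distrib_right sum_negf[symmetric])
    then show ?thesis by (simp add: cw)
  qed
  have "D c a b = D a b c" for a b c by (simp add: D_def algebra_simps)
  then have C2: "casimir (\<lambda>a b. D c a (brk u b)) = 0" for u c
    using C1[of u c] by (simp only: cas_def)
  have "form w"
  proof (rule formI)
    have len: "w us = 0" if "length us \<noteq> 3" for us
      using that unfolding w_def by (auto split: list.splits)
    have split3: "(l = [] \<and> (\<exists>b c. r = [b, c])) \<or> (\<exists>a c. l = [a] \<and> r = [c]) \<or> (\<exists>a b. l = [a, b] \<and> r = [])"
      if "length l + length r = 2" for l r :: "'g list"
      using that by (cases l; cases r; cases "tl l"; cases "tl r") (auto simp: length_Suc_conv numeral_2_eq_2)
    have split2: "(l = [] \<and> (\<exists>c. r = [c])) \<or> (\<exists>a. l = [a] \<and> r = [])"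
      if "length l + length r = 1" for l r :: "'g list"
      using that by (cases l; cases r) auto
    show "mlin scale w"
    proof (rule mlinI)
      fix l r u v
      show "w (l @ (u + v) # r) = w (l @ u # r) + w (l @ v # r)"
      proof (cases "length l + length r = 2")
        case True then show ?thesis using split3[OF True] by (elim disjE exE conjE) (simp_all add: w_def D)
      qed (simp add: len)
    next
      fix l r k u
      show "w (l @ scale k u # r) = k * w (l @ u # r)"
      proof (cases "length l + length r = 2")
        case True then show ?thesis using split3[OF True] by (elim disjE exE conjE) (simp_all add: w_def D)
      qed (simp add: len)
    qed
    fix l u r
    show "w (l @ u # u # r) = 0"
    proof (cases "length l + length r = 1")
      case True then show ?thesis using split2[OF True] by (elim disjE exE conjE) (simp_all add: w_def D)
    qed (simp add: len)
    show "casimir (\<lambda>a b. w (l @ a # brk u b # r)) = 0"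
    proof (cases "length l + length r = 1")
      case True then show ?thesis using split2[OF True] C1 C2 by (elim disjE exE conjE) (simp_all add: w_def)
    next
      case False then show ?thesis by (simp add: len cas_def)
    qed
  qed
  moreover have "w [f3, f4, f5] \<noteq> 0" by (simp add: w_def D_def B_table kappa_nonzero)
  ultimately show ?thesis by blast
qed

text \<open>The form representing evaluation at the word \<open>v0\<close>: the indicator function
  of \<open>v0\<close>, projected orthogonally onto the forms.\<close>

lemma projection_form:
  assumes "v0 \<in> W3"
  shows "\<exists>q. form q \<and> (\<forall>u. form u \<longrightarrow> (\<Sum>v\<in>W3. q (map y v) * cnj (u (map y v))) = cnj (u (map y v0)))"
proof -
  obtain q where q: "form q"
    "\<And>u. form u \<Longrightarrow> (\<Sum>t\<in>W3. ((if t = v0 then 1 else 0) - q (map y t)) * cnj (u (map y t))) = 0"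
    using projection_exists_on[OF finite_W3, of "{w. form w}" "\<lambda>t. if t = v0 then 1 else 0" "map y"]
      form_zero form_add form_scale by auto
  have "(\<Sum>v\<in>W3. q (map y v) * cnj (u (map y v))) = cnj (u (map y v0))" if "form u" for u
  proof -
    have "(\<Sum>t\<in>W3. ((if t = v0 then 1 else 0) - q (map y t)) * cnj (u (map y t)))
       = (\<Sum>t\<in>W3. (if t = v0 then cnj (u (map y t)) else 0)) - (\<Sum>t\<in>W3. q (map y t) * cnj (u (map y t)))"
      unfolding sum_subtractf[symmetric] by (intro sum.cong refl) (simp add: algebra_simps)
    then show ?thesis using q(2)[OF that] assms by (simp add: finite_W3)
  qed
  then show ?thesis using q(1) by blast
qed

text \<open>Representing forms transform like the words they represent. The discrepancy
  \<open>d\<close> is orthogonal to all forms, because \<open>y k\<close> acts by a skew-Hermitian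
  operator, and it is itself a form, so it vanishes on all words in \<open>y\<close>.\<close>

lemma der_proj:
  assumes q: "\<And>w. w \<in> W3 \<Longrightarrow> form (q w)"
    and proj: "\<And>w u. w \<in> W3 \<Longrightarrow> form u \<Longrightarrow> (\<Sum>v\<in>W3. q w (map y v) * cnj (u (map y v))) = cnj (u (map y w))"
    and k: "k < 14" and w: "w \<in> W3" and us: "length us = 3"
  shows "der (brk (y k)) (q w) us = - (\<Sum>w'\<in>W3. of_real (der_matrix (M k) w w') * q w' us)"
proof -
  let ?m = "der_matrix (M k)"
  define d where "d us = der (brk (y k)) (q w) us + (\<Sum>w'\<in>W3. of_real (?m w w') * q w' us)" for us
  have fd: "form d" unfolding d_def using q w
    by (intro form_add form_sum form_scale form_der) auto
  have Mb: "brk (y k) (y i) = (\<Sum>j<14. scale (of_real (M k i j)) (y j))" if "i \<in> {..<14}" for i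
    using brk_y[OF k] that by simp
  have "(\<Sum>v\<in>W3. d (map y v) * cnj (u (map y v))) = 0" if u: "form u" for u
  proof -
    have "(\<Sum>v\<in>W3. der (brk (y k)) (q w) (map y v) * cnj (u (map y v)))
       = - (\<Sum>v\<in>W3. q w (map y v) * cnj (der (brk (y k)) u (map y v)))"
      by (rule der_skew[where z = y and d = "brk (y k)" and s = scale and M = "M k",
        OF finite_lessThan Mb M_antisym form_mlin[OF q[OF w]] form_mlin[OF u]])
    also have "\<dots> = - cnj (der (brk (y k)) u (map y w))" using proj[OF w form_der[OF u]] by simp
    also have "der (brk (y k)) u (map y w) = (\<Sum>w'\<in>W3. of_real (?m w w') * u (map y w'))"
      by (rule der_expand[where z = y and d = "brk (y k)" and s = scale and M = "M k",
        OF finite_lessThan Mb form_mlin[OF u] w])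
    finally have 1: "(\<Sum>v\<in>W3. der (brk (y k)) (q w) (map y v) * cnj (u (map y v)))
       = - (\<Sum>w'\<in>W3. of_real (?m w w') * cnj (u (map y w')))" by simp
    have "(\<Sum>v\<in>W3. (\<Sum>w'\<in>W3. of_real (?m w w') * q w' (map y v)) * cnj (u (map y v)))
       = (\<Sum>w'\<in>W3. of_real (?m w w') * (\<Sum>v\<in>W3. q w' (map y v) * cnj (u (map y v))))"
      unfolding sum_distrib_right sum_distrib_left mult.assoc by (rule sum.swap)
    also have "\<dots> = (\<Sum>w'\<in>W3. of_real (?m w w') * cnj (u (map y w')))"
      using proj[OF _ u] by simp
    finally show ?thesis using 1 by (simp add: d_def distrib_right sum.distrib)
  qed
  from this[OF fd] have "(\<Sum>v\<in>W3. d (map y v) * cnj (d (map y v))) = 0" .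
  from sum_mult_cnj_eq_0[OF finite_W3 this]
  have "\<And>v. v \<in> words {..<14} (length us) \<Longrightarrow> d (map y v) = 0" using us by simp
  from y_eq_0[OF form_mlin[OF fd] this] have "d us = 0" .
  then show ?thesis unfolding d_def by (simp only: eq_neg_iff_add_eq_0)
qed

lemma invariantI_y:
  assumes P: "pairform P" and "\<And>k us vs. k < 14 \<Longrightarrow> der (brk (y k)) (\<lambda>t. P t vs) us + der (brk (y k)) (P us) vs = 0"
  shows "invariant P"
  unfolding invariant_def
proof (intro allI)
  fix z us vs
  define d where "d z = der (brk z) (\<lambda>t. P t vs) us + der (brk z) (P us) vs" for z
  have lin: "d (a + b) = d a + d b" "d (scale c a) = c * d a" "d 0 = 0" for a b c
    by (simp_all add: d_def der_brk_lin[OF form_mlin[OF pairformD(1)[OF P]]]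
      der_brk_lin[OF form_mlin[OF pairformD(2)[OF P]]] algebra_simps)
  have "d (\<Sum>i\<in>I. scale (c i) (y i)) = (\<Sum>i\<in>I. c i * d (y i))" for I c
    by (induction I rule: infinite_finite_induct) (simp_all add: lin)
  from this[of "\<lambda>i. - (1 / \<kappa>) * B (y i) z" "{..<14}"]
  have "d z = (\<Sum>i<14. - (1 / \<kappa>) * B (y i) z * d (y i))" by (simp only: y_expand[symmetric])
  also have "d (y i) = 0" if "i < 14" for i using assms(2)[OF that] by (simp add: d_def)
  then have "(\<Sum>i<14. - (1 / \<kappa>) * B (y i) z * d (y i)) = 0" by simp
  finally have "d z = 0" .
  then show "der (brk z) (\<lambda>t. P t vs) us + der (brk z) (P us) vs = 0" by (simp add: d_def)
qed

text \<open>Invariance of the kernel is the cancellation of two double sums by antisymmetry of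
  \<open>der_matrix\<close>. The trace is a sum of squared moduli; were it zero, all representing
  forms would vanish on words, and with them every 3-form.\<close>

lemma invariant_3form_exists:
  "\<exists>P. pairform P \<and> invariant P \<and> (\<forall>us vs. P us vs \<noteq> 0 \<longrightarrow> length us = 3 \<and> length vs = 3) \<and>
     (\<Sum>w\<in>W3. P (map y w) (map y w)) \<noteq> 0"
proof -
  have "\<forall>w\<in>W3. \<exists>q. form q \<and> (\<forall>u. form u \<longrightarrow> (\<Sum>v\<in>W3. q (map y v) * cnj (u (map y v))) = cnj (u (map y w)))"
    using projection_form by blast
  from bchoice[OF this] obtain q0 where q0: "\<And>w. w \<in> W3 \<Longrightarrow> form (q0 w)"
    "\<And>w u. w \<in> W3 \<Longrightarrow> form u \<Longrightarrow> (\<Sum>v\<in>W3. q0 w (map y v) * cnj (u (map y v))) = cnj (u (map y w))"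
    by blast
  \<comment> \<open>The projection controls lists of length 3 only, so the components of other
    degrees are discarded.\<close>
  define q where "q w us = (if length us = 3 then q0 w us else 0)" for w us
  have q: "form (q w)" if "w \<in> W3" for w unfolding q_def[abs_def] by (rule form_restrict[OF q0(1)[OF that]])
  have len: "length v = 3" if "v \<in> W3" for v using length_words[OF that] .
  have proj: "(\<Sum>v\<in>W3. q w (map y v) * cnj (u (map y v))) = cnj (u (map y w))" if "w \<in> W3" "form u" for w u
    using q0(2)[OF that] by (simp add: q_def len cong: sum.cong)
  define P where "P us vs = (\<Sum>w\<in>W3. q w us * bar (q w) vs)" for us vs
  have P: "pairform P" unfolding pairform_def P_def
    by (auto intro!: form_sum form_scale form_bar q) (simp add: mult.commute[of _ "bar _ _"], auto intro!: form_sum form_scale q)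
  have supp: "length us = 3 \<and> length vs = 3" if "P us vs \<noteq> 0" for us vs
    using that unfolding P_def q_def bar_def by (auto intro: ccontr)
  have inv: "invariant P"
  proof (rule invariantI_y[OF P])
    fix k us vs assume k: "k < (14::nat)"
    let ?m = "der_matrix (M k)"
    show "der (brk (y k)) (\<lambda>t. P t vs) us + der (brk (y k)) (P us) vs = 0"
    proof (cases "length us = 3 \<and> length vs = 3")
      case True
      then have us: "length us = 3" and vs: "length (map \<tau> vs) = 3" by auto
      have dq: "der (brk (y k)) (q w) us = - (\<Sum>w'\<in>W3. of_real (?m w w') * q w' us)"
        if "w \<in> W3" "length us = 3" for w us by (rule der_proj[OF q proj k that])
      have "der (brk (y k)) (\<lambda>t. P t vs) us = (\<Sum>w\<in>W3. der (brk (y k)) (q w) us * bar (q w) vs)"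
        unfolding P_def by (simp add: der_sum mult.commute[of _ "bar _ _"] der_scale)
      also have "\<dots> = (\<Sum>w\<in>W3. - (\<Sum>w'\<in>W3. of_real (?m w w') * q w' us) * bar (q w) vs)"
        by (intro sum.cong refl arg_cong2[where f = "(*)"] dq[OF _ us])
      also have "\<dots> = - (\<Sum>w\<in>W3. \<Sum>w'\<in>W3. of_real (?m w w') * q w' us * bar (q w) vs)"
        by (simp add: sum_negf sum_distrib_right)
      also have "\<dots> = (\<Sum>w'\<in>W3. \<Sum>w\<in>W3. of_real (?m w' w) * q w' us * bar (q w) vs)"
      proof -
        have "- (of_real (?m w w') * q w' us * bar (q w) vs) = of_real (?m w' w) * q w' us * bar (q w) vs"
          if "w \<in> W3" "w' \<in> W3" for w w'
          unfolding der_matrix_antisym[of "{..<14}" "M k", OF M_antisym that] by simp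
        then show ?thesis unfolding sum_negf[symmetric] by (subst sum.swap) (intro sum.cong refl)
      qed
      finally have 1: "der (brk (y k)) (\<lambda>t. P t vs) us = (\<Sum>w'\<in>W3. \<Sum>w\<in>W3. of_real (?m w' w) * q w' us * bar (q w) vs)" .
      have "der (brk (y k)) (P us) vs = (\<Sum>w\<in>W3. q w us * der (brk (y k)) (bar (q w)) vs)"
        unfolding P_def by (simp add: der_sum der_scale)
      also have "\<dots> = (\<Sum>w\<in>W3. q w us * cnj (- (\<Sum>w'\<in>W3. of_real (?m w w') * q w' (map \<tau> vs))))"
        unfolding der_bar tau_y[OF k]
        by (intro sum.cong refl arg_cong2[where f = "(*)"] arg_cong[where f = cnj] dq[OF _ vs])
      also have "\<dots> = - (\<Sum>w\<in>W3. \<Sum>w'\<in>W3. of_real (?m w w') * q w us * bar (q w') vs)"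
        by (simp add: bar_def sum_negf sum_distrib_left mult.left_commute mult.assoc)
      finally show ?thesis using 1 by simp
    next
      case False
      have "der (brk (y k)) (\<lambda>t. P t vs) us = 0" "der (brk (y k)) (P us) vs = 0"
        using supp False by (auto intro!: der_eq_0 intro: ccontr)
      then show ?thesis by simp
    qed
  qed
  have "(\<Sum>w\<in>W3. P (map y w) (map y w)) \<noteq> 0"
  proof
    assume "(\<Sum>w\<in>W3. P (map y w) (map y w)) = 0"
    moreover have "(\<Sum>w\<in>W3. P (map y w) (map y w)) = of_real (\<Sum>v\<in>W3. \<Sum>w\<in>W3. (cmod (q w (map y v)))\<^sup>2)"
      unfolding P_def of_real_sum by (intro sum.cong refl) (simp only: bar_y complex_norm_square)
    ultimately have "complex_of_real (\<Sum>v\<in>W3. \<Sum>w\<in>W3. (cmod (q w (map y v)))\<^sup>2) = 0" by (simp only:)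
    then have "(\<Sum>v\<in>W3. \<Sum>w\<in>W3. (cmod (q w (map y v)))\<^sup>2) = 0" by (simp only: of_real_eq_0_iff)
    then have q0: "q w (map y v) = 0" if "v \<in> W3" "w \<in> W3" for v w
      using that by (simp add: sum_nonneg_eq_0_iff finite_W3 sum_nonneg)
    obtain u where u: "form u" "u [f3, f4, f5] \<noteq> 0" using nontrivial_3form by blast
    have uy: "u (map y w) = 0" if "w \<in> W3" for w
    proof -
      have "cnj (u (map y w)) = (\<Sum>v\<in>W3. 0)"
        unfolding proj[OF that u(1), symmetric] using q0[OF _ that] by (intro sum.cong refl) simp
      then show ?thesis by simp
    qed
    have "length [f3, f4, f5] = 3" by simp
    with uy have "\<And>w. w \<in> words {..<14} (length [f3, f4, f5]) \<Longrightarrow> u (map y w) = 0"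
      by (simp only:)
    from y_eq_0[OF form_mlin[OF u(1)] this] have "u [f3, f4, f5] = 0" .
    then show False using u by simp
  qed
  then show ?thesis using P inv supp by blast
qed

end

section \<open>Functionals on the free algebra\<close>

definition lin :: "('v list \<Rightarrow> complex) \<Rightarrow> 'v free_alg \<Rightarrow> complex" where
  "lin w p = (\<Sum>u\<in>Poly_Mapping.keys p. Poly_Mapping.lookup p u * w (letters u))"

lemma lin_superset:
  assumes "finite S" "Poly_Mapping.keys p \<subseteq> S"
  shows "lin w p = (\<Sum>u\<in>S. Poly_Mapping.lookup p u * w (letters u))"
  unfolding lin_def using assms by (intro sum.mono_neutral_left) (auto simp: in_keys_iff)

lemma lin_0 [simp]: "lin w 0 = 0" by (simp add: lin_def)

lemma lin_add: "lin w (p + q) = lin w p + lin w q"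
proof -
  let ?S = "Poly_Mapping.keys p \<union> Poly_Mapping.keys q"
  have "finite ?S" "Poly_Mapping.keys (p + q) \<subseteq> ?S" using keys_add[of p q] by auto
  then show ?thesis
    using lin_superset[of ?S "p + q"] lin_superset[of ?S p] lin_superset[of ?S q]
    by (simp add: lookup_add distrib_right sum.distrib)
qed

lemma lin_sum: "lin w (\<Sum>i\<in>I. p i) = (\<Sum>i\<in>I. lin w (p i))"
  by (induction I rule: infinite_finite_induct) (simp_all add: lin_add)

lemma lin_minus: "lin w (- p) = - lin w p"
  using lin_add[of w p "- p"] by (simp add: eq_neg_iff_add_eq_0 add.commute)

lemma lin_diff: "lin w (p - q) = lin w p - lin w q"
  using lin_add[of w p "- q"] by (simp add: lin_minus)

lemma lin_single [simp]: "lin w (Poly_Mapping.single u c) = c * w (letters u)"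
  by (simp add: lin_def)

lemma lin_fun_zero [simp]: "lin (\<lambda>t. 0) p = 0"
  by (simp add: lin_def)

lemma lin_fun_add: "lin (\<lambda>t. w t + w' t) p = lin w p + lin w' p"
  by (simp add: lin_def distrib_left sum.distrib)

lemma lin_fun_scale: "lin (\<lambda>t. c * w t) p = c * lin w p"
  by (simp add: lin_def sum_distrib_left mult.left_commute)

lemma lin_fun_sum: "lin (\<lambda>t. \<Sum>i\<in>I. w i t) p = (\<Sum>i\<in>I. lin (w i) p)"
  unfolding lin_def sum_distrib_left by (rule sum.swap)

lemma free_alg_sum: "p = (\<Sum>u\<in>Poly_Mapping.keys p. Poly_Mapping.single u (Poly_Mapping.lookup p u))"
proof (rule poly_mapping_eqI)
  fix k
  have "Poly_Mapping.lookup (\<Sum>u\<in>Poly_Mapping.keys p. Poly_Mapping.single u (Poly_Mapping.lookup p u)) k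
     = (\<Sum>u\<in>Poly_Mapping.keys p. if u = k then Poly_Mapping.lookup p k else 0)"
    unfolding lookup_sum by (intro sum.cong refl) (simp add: lookup_single)
  also have "\<dots> = Poly_Mapping.lookup p k" by (simp add: in_keys_iff)
  finally show "Poly_Mapping.lookup p k = Poly_Mapping.lookup (\<Sum>u\<in>Poly_Mapping.keys p. Poly_Mapping.single u (Poly_Mapping.lookup p u)) k" ..
qed

lemma free_alg_induct [case_names single add]:
  assumes "\<And>us c. P (Poly_Mapping.single (Word us) c)" "\<And>p q. P p \<Longrightarrow> P q \<Longrightarrow> P (p + q)"
  shows "P (p :: 'v free_alg)"
proof -
  have "P (\<Sum>u\<in>S. Poly_Mapping.single u (g u))" if "finite S" for S :: "'v word set" and g
    using that
  proof (induction S rule: finite_induct)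
    case empty show ?case using assms(1)[of "[]" 0] by simp
  next
    case (insert u S) then show ?case using assms(1)[of "letters u"] assms(2) by simp
  qed
  then show ?thesis by (subst free_alg_sum) simp
qed

text \<open>Functions on words separate the free algebra; identities in it thus reduce to identities
  for functions on lists.\<close>

lemma free_alg_eqI:
  assumes "\<And>w. lin w p = lin w q" shows "p = q"
proof (rule poly_mapping_eqI)
  fix k
  have "lin (\<lambda>us. if us = letters k then 1 else 0) r = Poly_Mapping.lookup r k" for r :: "'a free_alg"
  proof -
    have "lin (\<lambda>us. if us = letters k then 1 else 0) r = (\<Sum>u\<in>Poly_Mapping.keys r. if u = k then Poly_Mapping.lookup r k else 0)"
      unfolding lin_def by (intro sum.cong refl) (auto simp: word.expand)
    then show ?thesis by (simp add: in_keys_iff)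
  qed
  then show "Poly_Mapping.lookup p k = Poly_Mapping.lookup q k" using assms by metis
qed

lemma lin_mult: "lin w (p * q) = lin (\<lambda>us. lin (\<lambda>vs. w (us @ vs)) q) p"
proof (induction p rule: free_alg_induct)
  case (single us c)
  show ?case
    by (induction q rule: free_alg_induct)
       (simp_all add: mult_single plus_word_def distrib_left lin_add)
qed (simp add: distrib_right lin_add)

lemma lin_const [simp]: "lin w (const c) = c * w []"
  by (simp add: const_def zero_word_def)

lemma lin_one [simp]: "lin w 1 = w []"
proof -
  have "(1 :: 'a free_alg) = const 1" by (simp add: const_def)
  then show ?thesis using lin_const[of w 1] by (metis mult_1)
qed

lemma lin_const_mult [simp]: "lin w (const c * p) = c * lin w p" "lin w (p * const c) = c * lin w p"
  by (simp_all add: lin_mult lin_fun_scale)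

lemma const_commute: "p * const c = const c * p"
  by (rule free_alg_eqI) simp

lemma const_lin: "const (c + d) = const c + const d" "const (c * d) = const c * const d" "const 1 = 1" "const 0 = 0"
  by (rule free_alg_eqI; simp add: lin_add algebra_simps)+

lemma lin_letter [simp]: "lin w (letter v) = w [v]"
  by (simp add: letter_def)

lemma lin_letter_mult [simp]: "lin w (letter v * p) = lin (\<lambda>t. w (v # t)) p"
  by (simp add: lin_mult)

lemma der_eq_sum: "der d w us = (\<Sum>i<length us. w (us[i := d (us ! i)]))"
proof (induction us arbitrary: w)
  case (Cons u us)
  show ?case by (simp add: Cons.IH sum.lessThan_Suc_shift del: sum.lessThan_Suc)
qed simp

lemma lin_free_derivation: "lin w (free_derivation d p) = lin (der d w) p"
  unfolding free_derivation_def lin_sum lin_single word.sel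
  by (simp add: lin_def der_eq_sum sum_distrib_left)

lemma free_derivation_add: "free_derivation d (p + q) = free_derivation d p + free_derivation d q"
  by (rule free_alg_eqI) (simp add: lin_free_derivation lin_add)

lemma der_lin: "der d (\<lambda>us. lin (\<lambda>vs. w us vs) q) = (\<lambda>us. lin (\<lambda>vs. der d (\<lambda>us. w us vs) us) q)"
  unfolding lin_def by (simp add: fun_eq_iff der_sum der_scale)

lemma free_derivation_mult: "free_derivation d (p * q) = free_derivation d p * q + p * free_derivation d q"
  by (rule free_alg_eqI) (simp add: lin_free_derivation lin_add lin_mult der_append der_lin lin_fun_add)

lemma free_derivation_simps [simp]:
  "free_derivation d (const c) = 0" "free_derivation d (letter v) = letter (d v)" "free_derivation d 1 = 0"
  "free_derivation d 0 = 0"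
  by (rule free_alg_eqI; simp add: lin_free_derivation)+

lemma free_derivation_minus: "free_derivation d (p - q) = free_derivation d p - free_derivation d q"
  by (rule free_alg_eqI) (simp add: lin_free_derivation lin_diff)

section \<open>Ideals of the free algebra and functionals vanishing on them\<close>

definition two_sided :: "'a::ring_1 set \<Rightarrow> bool" where
  "two_sided K \<longleftrightarrow> 0 \<in> K \<and> (\<forall>p\<in>K. \<forall>q\<in>K. p + q \<in> K) \<and> (\<forall>p\<in>K. \<forall>r. r * p \<in> K \<and> p * r \<in> K)"

lemma two_sidedD:
  assumes "two_sided K"
  shows "0 \<in> K" "p \<in> K \<Longrightarrow> q \<in> K \<Longrightarrow> p + q \<in> K" "p \<in> K \<Longrightarrow> r * p \<in> K" "p \<in> K \<Longrightarrow> p * r \<in> K"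
    "p \<in> K \<Longrightarrow> - p \<in> K" "p \<in> K \<Longrightarrow> q \<in> K \<Longrightarrow> p - q \<in> K"
proof -
  note d = assms[unfolded two_sided_def]
  show "0 \<in> K" and a: "p \<in> K \<Longrightarrow> q \<in> K \<Longrightarrow> p + q \<in> K" for p q using d by auto
  show "p \<in> K \<Longrightarrow> r * p \<in> K" "p \<in> K \<Longrightarrow> p * r \<in> K" using d by auto
  show m: "p \<in> K \<Longrightarrow> - p \<in> K" for p using d by (metis mult_minus1)
  show "p \<in> K \<Longrightarrow> q \<in> K \<Longrightarrow> p - q \<in> K" using a[of p "- q"] m[of q] by simp
qed

lemma type_ring_simps [simp]:
  "carrier ring_of_type_algebra = UNIV" "x \<otimes>\<^bsub>ring_of_type_algebra\<^esub> y = x * y"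
  "x \<oplus>\<^bsub>ring_of_type_algebra\<^esub> y = x + y" "\<zero>\<^bsub>ring_of_type_algebra\<^esub> = 0" "\<one>\<^bsub>ring_of_type_algebra\<^esub> = 1"
  by (simp_all add: ring_of_type_algebra_def)

lemma ring_type_algebra: "ring (ring_of_type_algebra :: 'a::ring_1 ring)"
proof -
  have "\<exists>y. x + y = 0" for x :: 'a using add.right_inverse by blast
  then show ?thesis
    unfolding ring_of_type_algebra_def using add.right_inverse
    by unfold_locales (auto simp: algebra_simps Units_def)
qed

lemma a_minus_type: "x \<ominus>\<^bsub>ring_of_type_algebra\<^esub> y = x - (y :: 'a::ring_1)"
proof -
  interpret ring "ring_of_type_algebra :: 'a ring" by (rule ring_type_algebra)
  have "\<ominus>\<^bsub>ring_of_type_algebra\<^esub> y = - y" by (rule minus_equality) simp_all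
  then show ?thesis by (simp add: a_minus_def)
qed

lemma ideal_iff_two_sided: "ideal K (ring_of_type_algebra :: 'a::ring_1 ring) \<longleftrightarrow> two_sided K"
proof
  interpret ring "ring_of_type_algebra :: 'a ring" by (rule ring_type_algebra)
  assume i: "ideal K (ring_of_type_algebra :: 'a ring)"
  interpret ideal K "ring_of_type_algebra :: 'a ring" by (rule i)
  show "two_sided K" unfolding two_sided_def
    using I_l_closed I_r_closed a_closed zero_closed by auto
next
  interpret ring "ring_of_type_algebra :: 'a ring" by (rule ring_type_algebra)
  assume K: "two_sided K"
  show "ideal K (ring_of_type_algebra :: 'a ring)"
  proof (rule idealI)
    show "subgroup K (add_monoid (ring_of_type_algebra :: 'a ring))"
    proof (rule group.subgroupI)
      show "Group.group (add_monoid (ring_of_type_algebra :: 'a ring))" by (rule a_group)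
      fix a assume a: "a \<in> K"
      have "inv\<^bsub>add_monoid ring_of_type_algebra\<^esub> a = - a"
        by (rule group.inv_equality[OF a_group]) simp_all
      then show "inv\<^bsub>add_monoid ring_of_type_algebra\<^esub> a \<in> K" using two_sidedD(5)[OF K a] by simp
    qed (use two_sidedD[OF K] in auto)
  qed (use two_sidedD[OF K] in \<open>auto intro: ring_type_algebra\<close>)
qed

lemma coset_type: "K +>\<^bsub>ring_of_type_algebra\<^esub> p = {k + p |k. k \<in> K}"
  by (auto simp: a_r_coset_def')

text \<open>A basis of \<open>K\<close> stays independent when \<open>p\<close> is added, so a
  linear functional with value 0 on \<open>K\<close> and 1 at \<open>p\<close> exists; its values on
  words define \<open>w\<close>.\<close>

lemma functional_separates:
  fixes K :: "'v free_alg set"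
  assumes K: "two_sided K" and p: "p \<notin> K"
  shows "\<exists>w. lin w p \<noteq> 0 \<and> (\<forall>q\<in>K. lin w q = 0)"
proof -
  let ?s = "\<lambda>c (q :: 'v free_alg). const c * q"
  interpret V: vector_space ?s
    by unfold_locales (simp_all add: distrib_left distrib_right const_lin mult.assoc)
  interpret C: vector_space "(*) :: complex \<Rightarrow> complex \<Rightarrow> complex"
    by unfold_locales (simp_all add: algebra_simps)
  interpret VC: vector_space_pair ?s "(*) :: complex \<Rightarrow> complex \<Rightarrow> complex" ..
  have sub: "V.subspace K" unfolding V.subspace_def using two_sidedD[OF K] by auto
  obtain Bs where Bs: "Bs \<subseteq> K" "V.independent Bs" "K \<subseteq> V.span Bs"
    using V.maximal_independent_subset[of K] by blast
  then have sp: "V.span Bs = K" using sub V.span_subspace by blast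
  have ind: "V.independent (insert p Bs)" using Bs(2) p sp by (simp add: V.independent_insert)
  obtain g where g: "Vector_Spaces.linear ?s (*) g" "\<forall>b\<in>insert p Bs. g b = (if b = p then 1 else 0)"
    using VC.linear_independent_extend[OF ind, of "\<lambda>b. if b = p then 1 else 0"] by blast
  have gK: "g q = 0" if "q \<in> K" for q
  proof (rule VC.linear_eq_0_on_span[OF g(1)])
    show "q \<in> V.span Bs" using that sp by simp
    show "g b = 0" if "b \<in> Bs" for b using g(2) that p Bs(1) by auto
  qed
  have add: "g (a + b) = g a + g b" and sc: "g (const c * a) = c * g a" for a b c
    using g(1) by (simp_all add: Vector_Spaces.linear_iff)
  define w where "w us = g (Poly_Mapping.single (Word us) 1)" for us
  have "lin w q = g q" for q
  proof (induction q rule: free_alg_induct)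
    case (single us c)
    have "Poly_Mapping.single (Word us) c = const c * Poly_Mapping.single (Word us) 1"
      by (simp add: const_def mult_single)
    then show ?case by (simp add: sc w_def)
  qed (simp add: lin_add add)
  then show ?thesis using gK g(2) by (intro exI[of _ w]) auto
qed

section \<open>The algebra and its dual\<close>

text \<open>A quotient of a quotient is a single quotient by the preimage \<open>K\<close> of the
  second ideal. It is the least ideal containing \<open>J\<close> and \<open>G\<close>, because any
  other one has as image in \<open>E\<close> an ideal that contains the generators of
  \<open>I\<close>.\<close>

lemma quotient_quotient:
  fixes J :: "'r::ring_1 set" and G :: "'r set"
  defines "R \<equiv> (ring_of_type_algebra :: 'r ring)"
  assumes J: "two_sided J"
  defines "E \<equiv> R Quot J"
  defines "I \<equiv> Idl\<^bsub>E\<^esub> ((\<lambda>p. J +>\<^bsub>R\<^esub> p) ` G)"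
  defines "cls \<equiv> \<lambda>p. I +>\<^bsub>E\<^esub> (J +>\<^bsub>R\<^esub> p)"
  defines "K \<equiv> {p. J +>\<^bsub>R\<^esub> p \<in> I}"
  shows "ring_hom_ring R (E Quot I) cls" "carrier (E Quot I) = range cls"
    "cls p = cls q \<longleftrightarrow> p - q \<in> K" "two_sided K" "J \<subseteq> K" "G \<subseteq> K"
    "two_sided K' \<Longrightarrow> J \<subseteq> K' \<Longrightarrow> G \<subseteq> K' \<Longrightarrow> K \<subseteq> K'" "ideal I E" "ideal J R"
proof -
  interpret R: ring R unfolding R_def by (rule ring_type_algebra)
  show iJ: "ideal J R" using J ideal_iff_two_sided unfolding R_def by blast
  interpret J: ideal J R by (rule iJ)
  interpret E: ring E unfolding E_def by (rule J.quotient_is_ring)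
  have cE: "carrier E = range (\<lambda>p. J +>\<^bsub>R\<^esub> p)"
    unfolding E_def FactRing_def A_RCOSETS_def' by (auto simp: R_def)
  have sub: "(\<lambda>p. J +>\<^bsub>R\<^esub> p) ` G \<subseteq> carrier E" unfolding cE by auto
  show iI: "ideal I E" unfolding I_def by (rule E.genideal_ideal[OF sub])
  interpret I: ideal I E by (rule iI)
  interpret h1: ring_hom_ring R E "(+>\<^bsub>R\<^esub>) J" unfolding E_def by (rule J.rcos_ring_hom_ring)
  have h2: "(+>\<^bsub>E\<^esub>) I \<in> ring_hom E (E Quot I)" by (rule I.rcos_ring_hom)
  have "cls \<in> ring_hom R (E Quot I)"
    using ring_hom_trans[OF h1.homh h2] by (simp add: cls_def o_def)
  then show "ring_hom_ring R (E Quot I) cls"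
    using R.ring_axioms I.quotient_is_ring by (simp add: ring_hom_ring_def ring_hom_ring_axioms_def)
  show "carrier (E Quot I) = range cls"
    unfolding FactRing_def A_RCOSETS_def' cls_def by (auto simp: cE)
  have minus: "(J +>\<^bsub>R\<^esub> p) \<ominus>\<^bsub>E\<^esub> (J +>\<^bsub>R\<^esub> q) = J +>\<^bsub>R\<^esub> (p - q)" for p q
  proof -
    have "(J +>\<^bsub>R\<^esub> p) \<ominus>\<^bsub>E\<^esub> (J +>\<^bsub>R\<^esub> q) = J +>\<^bsub>R\<^esub> (p \<ominus>\<^bsub>R\<^esub> q)"
    proof -
      have c: "p \<in> carrier R" "q \<in> carrier R" by (simp_all add: R_def)
      show ?thesis using h1.hom_add[OF c(1) R.a_inv_closed[OF c(2)]] h1.hom_a_inv[OF c(2)]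
        by (simp only: a_minus_def)
    qed
    then show ?thesis by (simp add: R_def a_minus_type)
  qed
  have inE: "J +>\<^bsub>R\<^esub> p \<in> carrier E" for p unfolding cE by simp
  show "cls p = cls q \<longleftrightarrow> p - q \<in> K" for p q
    using E.quotient_eq_iff_same_a_r_cos[OF iI inE inE, of p q] unfolding cls_def K_def minus by simp
  have "K = {r \<in> carrier R. J +>\<^bsub>R\<^esub> r \<in> I}" unfolding K_def by (simp add: R_def)
  then have "ideal K R" using h1.ideal_vimage[OF iI] by simp
  then show "two_sided K" using ideal_iff_two_sided unfolding R_def by blast
  have "J +>\<^bsub>R\<^esub> p \<in> I" if "p \<in> J" for p
    using R.a_rcos_zero[OF iJ that] R.a_rcos_zero[OF iJ J.zero_closed] I.zero_closed h1.hom_zero by metis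
  then show "J \<subseteq> K" unfolding K_def by auto
  show "G \<subseteq> K" unfolding K_def I_def using E.genideal_self[OF sub] by auto
  assume K': "two_sided K'" "J \<subseteq> K'" "G \<subseteq> K'"
  have iK': "ideal K' R" using K'(1) ideal_iff_two_sided unfolding R_def by blast
  have "ideal ((+>\<^bsub>R\<^esub>) J ` K') E" unfolding E_def by (rule R.ring_ideal_imp_quot_ideal[OF iJ iK'])
  then have "I \<subseteq> (+>\<^bsub>R\<^esub>) J ` K'" unfolding I_def using K'(3) by (intro E.genideal_minimal) auto
  show "K \<subseteq> K'"
  proof
    fix p assume "p \<in> K"
    then obtain k where k: "k \<in> K'" "J +>\<^bsub>R\<^esub> p = J +>\<^bsub>R\<^esub> k" using \<open>I \<subseteq> _\<close> unfolding K_def by auto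
    then have "p - k \<in> J"
      using R.quotient_eq_iff_same_a_r_cos[OF iJ, of p k] by (simp add: R_def a_minus_type)
    then show "p \<in> K'" using two_sidedD(2)[OF K'(1), of "p - k" k] K'(2) k(1) by auto
  qed
qed

lemma bilin_compose:
  assumes "bilin s \<beta>" "\<And>u v. i (u + v) = i u + i v" "\<And>c u. i (t c u) = s c (i u)"
    "\<And>u v. j (u + v) = j u + j v" "\<And>c u. j (t c u) = s c (j u)"
  shows "bilin t (\<lambda>a b. \<beta> (i a) (j b))"
  unfolding bilin_def by (simp add: assms(2-5) bilinD[OF assms(1)])

context simple_lie_algebra_with_basis
begin

abbreviation s2 :: "complex \<Rightarrow> 'g \<times> 'g \<Rightarrow> 'g \<times> 'g" where "s2 \<equiv> scale2 scale"
abbreviation dd :: "'g \<Rightarrow> 'g \<times> 'g \<Rightarrow> 'g \<times> 'g" where "dd z \<equiv> map_prod (brk z) (brk z)"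
abbreviation iX :: "'g \<Rightarrow> 'g \<times> 'g" where "iX u \<equiv> (u, 0)"
abbreviation iY :: "'g \<Rightarrow> 'g \<times> 'g" where "iY u \<equiv> (0, u)"

lemma s2_simps [simp]: "s2 c (u, v) = (scale c u, scale c v)"
  by (simp add: scale2_def)

lemma dd_lin: "dd z (p + q) = dd z p + dd z q" "dd z (s2 c p) = s2 c (dd z p)"
  by (cases p; cases q; simp add: brk_lin) (cases p; simp add: brk_lin)

definition contraction :: "('g \<Rightarrow> 'g \<times> 'g) \<Rightarrow> ('g \<Rightarrow> 'g \<times> 'g) \<Rightarrow> 'g \<Rightarrow> ('g \<times> 'g \<Rightarrow> 'g \<times> 'g \<Rightarrow> complex) \<Rightarrow> complex" where
  "contraction i j u \<beta> = casimir (\<lambda>a b. \<beta> (i a) (j (brk u b)))"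

text \<open>The three index pairs correspond to the three generating copies of the Lie algebra. The
  mixed relation with the copies exchanged follows by alternation and invariance.\<close>

definition LRel :: "(('g \<times> 'g \<Rightarrow> 'g \<times> 'g \<Rightarrow> complex) \<Rightarrow> complex) set" where
  "LRel = range (\<lambda>a \<beta>. \<beta> a a) \<union> (\<Union>(i, j)\<in>{(iX, iX), (iX, iY), (iY, iY)}. range (contraction i j))"

abbreviation LL :: "(('g \<times> 'g) list \<Rightarrow> complex) \<Rightarrow> bool" where "LL \<equiv> qform s2 LRel"

lemma LRel_cases:
  assumes "\<rho> \<in> LRel"
  obtains a where "\<rho> = (\<lambda>\<beta>. \<beta> a a)" | i j u where "(i, j) \<in> {(iX, iX), (iX, iY), (iY, iY)}" "\<rho> = contraction i j u"
  using assms unfolding LRel_def by blast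

lemma rel_fun_LRel: "\<rho> \<in> LRel \<Longrightarrow> rel_fun \<rho>"
  by (erule LRel_cases) (auto simp: rel_fun_def contraction_def cas_def sum.distrib sum_distrib_left)

lemma embedding_simps:
  assumes "(i, j) \<in> {(iX, iX), (iX, iY), (iY, iY)}"
  shows "i (u + v) = i u + i v" "j (u + v) = j u + j v" "i (scale c u) = s2 c (i u)" "j (scale c u) = s2 c (j u)"
    "dd z (i u) = i (brk z u)" "dd z (j u) = j (brk z u)"
  using assms by auto

lemma LL_mlin: "LL w \<Longrightarrow> mlin s2 w" by (rule qform_mlin)

lemma LL_same: "LL w \<Longrightarrow> w (l @ a # a # r) = 0"
  using qform_rel[of s2 LRel w "\<lambda>\<beta>. \<beta> a a" l r] by (simp add: LRel_def)

lemma contraction_LRel: "(i, j) \<in> {(iX, iX), (iX, iY), (iY, iY)} \<Longrightarrow> contraction i j u \<in> LRel"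
  unfolding LRel_def by blast

lemma LL_contract:
  "LL w \<Longrightarrow> (i, j) \<in> {(iX, iX), (iX, iY), (iY, iY)} \<Longrightarrow> casimir (\<lambda>a b. w (l @ i a # j (brk u b) # r)) = 0"
  using qform_rel[of s2 LRel w "contraction i j u" l r] contraction_LRel[of i j u]
  by (simp add: contraction_def)

lemma LLI:
  assumes "mlin s2 w" "\<And>l a r. w (l @ a # a # r) = 0"
    "\<And>i j l u r. (i, j) \<in> {(iX, iX), (iX, iY), (iY, iY)} \<Longrightarrow> casimir (\<lambda>a b. w (l @ i a # j (brk u b) # r)) = 0"
  shows "LL w"
  unfolding qform_def
proof (intro conjI ballI allI assms(1))
  fix \<rho> l r assume "\<rho> \<in> LRel"
  then show "\<rho> (\<lambda>a b. w (l @ a # b # r)) = 0"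
    by (rule LRel_cases) (simp_all add: assms(2,3) contraction_def)
qed

lemma LL_der: assumes w: "LL w" shows "LL (der (dd z) w)"
proof (rule qform_der[OF w])
  fix \<rho> and \<beta> :: "'g \<times> 'g \<Rightarrow> 'g \<times> 'g \<Rightarrow> complex"
  assume \<rho>: "\<rho> \<in> LRel" and \<beta>: "bilin s2 \<beta>" and all: "\<And>\<rho>. \<rho> \<in> LRel \<Longrightarrow> \<rho> \<beta> = 0"
  have alt: "\<beta> u u = 0" for u using all[of "\<lambda>\<beta>. \<beta> u u"] by (simp add: LRel_def)
  from \<rho> show "\<rho> (\<lambda>a b. \<beta> (dd z a) b + \<beta> a (dd z b)) = 0"
  proof (rule LRel_cases)
    fix a assume 1: "\<rho> = (\<lambda>\<beta>. \<beta> a a)"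
    have "\<beta> (dd z a + a) (dd z a + a) = \<beta> (dd z a) a + \<beta> a (dd z a)"
      unfolding bilinD(1)[OF \<beta>] bilinD(2)[OF \<beta>] by (simp add: alt)
    then show ?thesis by (simp add: 1 alt)
  next
    fix i j u assume ij: "(i, j) \<in> {(iX, iX), (iX, iY), (iY, iY)}" and 2: "\<rho> = contraction i j u"
    note e = embedding_simps[OF ij]
    have con: "casimir (\<lambda>a b. \<beta> (i a) (j (brk u b))) = 0" for u
      using all[OF contraction_LRel[OF ij], of u] by (simp add: contraction_def)
    have b2: "bilin scale (\<lambda>a b. \<beta> (i a) (j (brk u b)))"
      by (rule bilin_compose[OF \<beta>]) (simp_all add: e brk_lin)
    have "\<beta> (i (brk z a)) (j (brk u b)) + \<beta> (i a) (j (brk z (brk u b)))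
       = (\<beta> (i (brk z a)) (j (brk u b)) + \<beta> (i a) (j (brk u (brk z b)))) + \<beta> (i a) (j (brk (brk z u) b))" for a b
      by (simp add: brk_jac[of z u] e bilinD[OF \<beta>])
    then show ?thesis unfolding 2 contraction_def e
      using casimir_inv[OF b2, of z] con[of "brk z u"] by (simp add: cas_def sum.distrib)
  qed
qed (simp_all add: dd_lin rel_fun_LRel)

text \<open>By orthonormality and invariance \<open>f i j k\<close> is the coordinate of
  \<open>brk (x k) (x i)\<close> along \<open>x j\<close>. The generators of the ideal are therefore
  contractions with \<open>ad (x k)\<close>.\<close>

lemma structure_sum:
  assumes k: "k < n" and \<beta>: "bilin scale \<beta>"
  shows "(\<Sum>i<n. \<Sum>j<n. f i j k * \<beta> (x i) (x j)) = casimir (\<lambda>a b. \<beta> a (brk (x k) b))"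
proof -
  have "(\<Sum>j<n. f i j k * \<beta> (x i) (x j)) = \<beta> (x i) (brk (x k) (x i))" if i: "i < n" for i
  proof -
    have "f i j k = B (x j) (brk (x k) (x i))" if j: "j < n" for j
    proof -
      have "B (x k) (brk (x i) (x j)) = (\<Sum>m<n. f i j m * B (x k) (x m))"
        by (simp add: structure_constants[OF i j] bilin_sum_right[OF B_bilin] B_lin)
      also have "\<dots> = (\<Sum>m<n. if m = k then f i j m else 0)"
        using k by (intro sum.cong refl) (simp add: basis_orthonormal)
      also have "\<dots> = f i j k" using k by simp
      finally show ?thesis using form_invariant[of "x k" "x i" "x j"] form_symmetric[of "x j"] by simp
    qed
    then have "(\<Sum>j<n. f i j k * \<beta> (x i) (x j)) = \<beta> (x i) (\<Sum>j<n. scale (B (x j) (brk (x k) (x i))) (x j))"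
      by (simp add: bilin_sum_right[OF \<beta>] bilinD[OF \<beta>])
    then show ?thesis by (simp flip: x_expand)
  qed
  then show ?thesis by (simp add: cas_def)
qed

lemma bracket_elements_cases:
  assumes "q \<in> bracket_elements n x f"
  obtains k i j where "k < n" "(i, j) \<in> {(iX, iX), (iX, iY), (iY, iY)}"
    "q = (\<Sum>a<n. \<Sum>b<n. const (f a b k) * letter (i (x a)) * letter (j (x b)))"
  using assms unfolding bracket_elements_def by blast

lemma bracket_elements_mem:
  "k < n \<Longrightarrow> (i, j) \<in> {(iX, iX), (iX, iY), (iY, iY)} \<Longrightarrow>
    (\<Sum>a<n. \<Sum>b<n. const (f a b k) * letter (i (x a)) * letter (j (x b))) \<in> bracket_elements n x f"
  unfolding bracket_elements_def by blast

lemma lin_bracket: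
  assumes k: "k < n" and ij: "(i, j) \<in> {(iX, iX), (iX, iY), (iY, iY)}" and "bilin s2 (\<lambda>a b. w [a, b])"
  shows "lin w (\<Sum>a<n. \<Sum>b<n. const (f a b k) * letter (i (x a)) * letter (j (x b)))
     = casimir (\<lambda>a b. w [i a, j (brk (x k) b)])"
proof -
  have "bilin scale (\<lambda>a b. w [i a, j b])"
    using embedding_simps[OF ij] by (intro bilin_compose[OF assms(3)]) auto
  from structure_sum[OF k this] show ?thesis
    by (simp add: lin_sum mult.assoc)
qed

section \<open>The kernel of the map from the free algebra onto A, by duality\<close>

definition Jx :: "('g \<times> 'g) free_alg set" where "Jx = exterior_ideal s2"

text \<open>The kernel of the composite map from the free algebra to \<open>A\<close>.\<close>

definition K :: "('g \<times> 'g) free_alg set" where "K = {p. exterior_class s2 p \<in> ideal_I scale n x f}"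

lemma two_sided_Jx: "two_sided Jx"
  unfolding Jx_def exterior_ideal_def ideal_iff_two_sided[symmetric]
  by (rule ring.genideal_ideal[OF ring_type_algebra]) simp

lemma Jx_minimal: "two_sided K' \<Longrightarrow> exterior_relations s2 \<subseteq> K' \<Longrightarrow> Jx \<subseteq> K'"
  unfolding Jx_def exterior_ideal_def ideal_iff_two_sided[symmetric]
  by (rule ring.genideal_minimal[OF ring_type_algebra])

lemma Jx_relations: "exterior_relations s2 \<subseteq> Jx"
  unfolding Jx_def exterior_ideal_def by (rule ring.genideal_self[OF ring_type_algebra]) simp

abbreviation cls :: "('g \<times> 'g) free_alg \<Rightarrow> ('g \<times> 'g) free_alg set set" where "cls \<equiv> A_class scale n x f"

lemmas algebra_defs = algebra_A_def ideal_I_def exterior_algebra_def exterior_class_def A_class_def Jx_def[symmetric]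

lemma quotient_facts:
  "ring_hom_ring free_ring (algebra_A scale n x f) cls" "carrier (algebra_A scale n x f) = range cls"
  "cls p = cls q \<longleftrightarrow> p - q \<in> K" "two_sided K" "Jx \<subseteq> K" "bracket_elements n x f \<subseteq> K"
  "two_sided K' \<Longrightarrow> Jx \<subseteq> K' \<Longrightarrow> bracket_elements n x f \<subseteq> K' \<Longrightarrow> K \<subseteq> K'"
  "ideal (ideal_I scale n x f) (exterior_algebra s2)" "ideal Jx free_ring"
proof -
  note q = quotient_quotient(1-8)[OF two_sided_Jx, where G = "bracket_elements n x f"]
     quotient_quotient(9)[OF two_sided_Jx]
  have c: "cls = (\<lambda>p. Idl\<^bsub>free_ring Quot Jx\<^esub> ((+>\<^bsub>free_ring\<^esub>) Jx ` bracket_elements n x f)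
     +>\<^bsub>free_ring Quot Jx\<^esub> (Jx +>\<^bsub>free_ring\<^esub> p))"
    by (simp add: fun_eq_iff algebra_defs exterior_class_def[abs_def])
  have k: "K = {p. Jx +>\<^bsub>free_ring\<^esub> p \<in> Idl\<^bsub>free_ring Quot Jx\<^esub> ((+>\<^bsub>free_ring\<^esub>) Jx ` bracket_elements n x f)}"
    by (simp add: K_def algebra_defs exterior_class_def[abs_def])
  have a: "algebra_A scale n x f = free_ring Quot Jx Quot
      Idl\<^bsub>free_ring Quot Jx\<^esub> ((+>\<^bsub>free_ring\<^esub>) Jx ` bracket_elements n x f)"
    by (simp add: algebra_defs exterior_class_def[abs_def])
  have i: "ideal_I scale n x f = Idl\<^bsub>free_ring Quot Jx\<^esub> ((+>\<^bsub>free_ring\<^esub>) Jx ` bracket_elements n x f)"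
    by (simp add: algebra_defs exterior_class_def[abs_def])
  show "ring_hom_ring free_ring (algebra_A scale n x f) cls" "carrier (algebra_A scale n x f) = range cls"
    "cls p = cls q \<longleftrightarrow> p - q \<in> K" "two_sided K" "Jx \<subseteq> K" "bracket_elements n x f \<subseteq> K"
    "two_sided K' \<Longrightarrow> Jx \<subseteq> K' \<Longrightarrow> bracket_elements n x f \<subseteq> K' \<Longrightarrow> K \<subseteq> K'"
    "ideal (ideal_I scale n x f) (exterior_algebra s2)" "ideal Jx free_ring"
    unfolding a k i using q c by (simp_all add: exterior_algebra_def Jx_def[symmetric])
qed

text \<open>The elements that \<open>w\<close> kills in every context form a two-sided ideal, and it
  contains the defining relations since \<open>LL\<close> tests them between arbitrary
  lists.\<close>

lemma lin_kill:
  assumes w: "LL w" and q: "q \<in> K" shows "lin w q = 0"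
proof -
  let ?K' = "{q. \<forall>a b. lin w (a * q * b) = 0}"
  note ml = LL_mlin[OF w]
  have ctx: "lin w (a * q * b) = lin (\<lambda>us. lin (\<lambda>vs. lin (\<lambda>ts. w (us @ vs @ ts)) b) q) a" for a q b
    by (simp add: lin_mult mult.assoc)
  have ts: "two_sided ?K'"
    unfolding two_sided_def by (auto simp: distrib_left distrib_right lin_add) (metis mult.assoc)+
  have "exterior_relations s2 \<subseteq> ?K'"
    unfolding exterior_relations_def
  proof (intro Un_least subsetI)
    fix q assume "q \<in> {letter (u + v) - letter u - letter v |u v :: 'g \<times> 'g. True}"
    then obtain u v :: "'g \<times> 'g" where "q = letter (u + v) - letter u - letter v" by blast
    then show "q \<in> ?K'" by (simp add: ctx lin_diff mlin_plus[OF ml] lin_fun_add)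
  next
    fix q assume "q \<in> {letter (s2 c v) - const c * letter v |c v. True}"
    then obtain c v where "q = letter (s2 c v) - const c * letter v" by blast
    then show "q \<in> ?K'" by (simp add: ctx lin_diff mlin_scale[OF ml] lin_fun_scale del: s2_simps)
  next
    fix q assume "q \<in> {letter v * letter v |v :: 'g \<times> 'g. True}"
    then obtain v :: "'g \<times> 'g" where "q = letter v * letter v" by blast
    moreover have "lin (\<lambda>ts. w (us @ v # v # ts)) b = 0" for us b using LL_same[OF w] by (simp add: lin_def)
    ultimately show "q \<in> ?K'" by (simp add: ctx)
  qed
  then have 1: "Jx \<subseteq> ?K'" by (rule Jx_minimal[OF ts])
  have "bracket_elements n x f \<subseteq> ?K'"
  proof
    fix q assume "q \<in> bracket_elements n x f"
    then show "q \<in> ?K'"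
    proof (rule bracket_elements_cases)
      fix k i j assume k: "k < n" and ij: "(i, j) \<in> {(iX, iX), (iX, iY), (iY, iY)}"
        and q: "q = (\<Sum>a<n. \<Sum>b<n. const (f a b k) * letter (i (x a)) * letter (j (x b)))"
      have "lin (\<lambda>vs. lin (\<lambda>ts. w (us @ vs @ ts)) b) q = 0" for us b
      proof -
        have "mlin s2 (\<lambda>vs. lin (\<lambda>ts. w (us @ vs @ ts)) b)"
          by (rule mlinI) (simp_all add: mlin_plus[OF ml, of "us @ _", simplified] mlin_scale[OF ml, of "us @ _", simplified]
            lin_fun_add lin_fun_scale del: s2_simps)
        then have "lin (\<lambda>vs. lin (\<lambda>ts. w (us @ vs @ ts)) b) q
           = casimir (\<lambda>c d. lin (\<lambda>ts. w (us @ [i c, j (brk (x k) d)] @ ts)) b)"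
          unfolding q using mlin_bilin[of s2 "\<lambda>vs. lin (\<lambda>ts. w (us @ vs @ ts)) b" "[]" "[]"]
          by (subst lin_bracket[OF k ij]) simp_all
        also have "\<dots> = lin (\<lambda>ts. casimir (\<lambda>c d. w (us @ i c # j (brk (x k) d) # ts))) b"
          by (simp add: cas_def lin_fun_sum)
        also have "\<dots> = 0" by (simp add: LL_contract[OF w ij])
        finally show ?thesis .
      qed
      then show "q \<in> ?K'" by (simp add: ctx)
    qed
  qed
  from quotient_facts(7)[OF ts 1 this] q have "\<forall>a b. lin w (a * q * b) = 0" by blast
  from this[rule_format, of 1 1] show ?thesis by simp
qed

lemma LL_if_kills:
  assumes z: "\<And>q. q \<in> K \<Longrightarrow> lin w q = 0" shows "LL w"
proof -
  define L where "L us = Poly_Mapping.single (Word us) (1::complex)" for us :: "('g \<times> 'g) list"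
  have ctx: "lin w (L l * q * L r) = lin (\<lambda>us. w (l @ us @ r)) q" for l q r
    by (simp add: lin_mult L_def)
  have K: "lin (\<lambda>us. w (l @ us @ r)) q = 0" if "q \<in> K" for l q r
    unfolding ctx[symmetric] by (intro z two_sidedD[OF quotient_facts(4)] that)
  have J: "lin (\<lambda>us. w (l @ us @ r)) q = 0" if "q \<in> exterior_relations s2" for l q r
    using K that Jx_relations quotient_facts(5) by blast
  have ml: "mlin s2 w"
  proof (rule mlinI)
    fix l r u v
    have "letter (u + v) - letter u - letter v \<in> exterior_relations s2"
      unfolding exterior_relations_def by blast
    from J[OF this, of l r] have "w (l @ (u + v) # r) - w (l @ u # r) - w (l @ v # r) = 0"
      by (simp only: lin_diff lin_letter append_Cons append_Nil)
    then show "w (l @ (u + v) # r) = w (l @ u # r) + w (l @ v # r)" by (simp add: algebra_simps)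
  next
    fix l r c u
    have "letter (s2 c u) - const c * letter u \<in> exterior_relations s2"
      unfolding exterior_relations_def by blast
    from J[OF this, of l r] show "w (l @ s2 c u # r) = c * w (l @ u # r)" by (simp add: lin_diff)
  qed
  show "LL w"
  proof (rule LLI[OF ml])
    fix l r and a :: "'g \<times> 'g"
    have "letter a * letter a \<in> exterior_relations s2" unfolding exterior_relations_def by blast
    from J[OF this, of l r] show "w (l @ a # a # r) = 0" by simp
  next
    fix i j l u r assume ij: "(i, j) \<in> {(iX, iX), (iX, iY), (iY, iY)}"
    note e = embedding_simps[OF ij]
    let ?c = "\<lambda>u. casimir (\<lambda>a b. w (l @ i a # j (brk u b) # r))"
    have b: "bilin scale (\<lambda>a b. w (l @ i a # j b # r))"
      by (rule bilin_compose[OF mlin_bilin[OF ml]]) (simp_all add: e)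
    have k: "?c (x k) = 0" if "k < n" for k
    proof -
      have "bilin s2 (\<lambda>a b. w (l @ [a, b] @ r))" using mlin_bilin[OF ml, of l r] by simp
      from lin_bracket[OF that ij, of "\<lambda>t. w (l @ t @ r)", OF this]
      show ?thesis using K[of _ l r] bracket_elements_mem[OF that ij] quotient_facts(6) by auto
    qed
    \<comment> \<open>The generators provide only the relations of the basis vectors
      \<open>x k\<close>; linearity in \<open>u\<close> supplies the rest.\<close>
    have "?c (\<Sum>k<n. scale (B (x k) u) (x k)) = (\<Sum>k<n. B (x k) u * ?c (x k))"
    proof -
      have "?c (\<Sum>k\<in>I. scale (B (x k) u) (x k)) = (\<Sum>k\<in>I. B (x k) u * ?c (x k))" for I
        by (induction I rule: infinite_finite_induct)
           (simp_all add: cas_def brk_lin bilinD[OF b] sum.distrib sum_distrib_left)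
      then show ?thesis .
    qed
    then show "?c u = 0" using k by (simp flip: x_expand)
  qed
qed

text \<open>The double annihilator of the ideal is the ideal itself. Membership in \<open>K\<close>
  becomes a question about functionals.\<close>

lemma K_iff: "q \<in> K \<longleftrightarrow> (\<forall>w. LL w \<longrightarrow> lin w q = 0)"
proof
  assume *: "\<forall>w. LL w \<longrightarrow> lin w q = 0"
  show "q \<in> K"
  proof (rule ccontr)
    assume "q \<notin> K"
    then obtain w where "lin w q \<noteq> 0" "\<forall>q\<in>K. lin w q = 0" using functional_separates[OF quotient_facts(4)] by blast
    then show False using * LL_if_kills by blast
  qed
qed (use lin_kill in blast)

abbreviation D :: "'g \<Rightarrow> ('g \<times> 'g) free_alg \<Rightarrow> ('g \<times> 'g) free_alg" where "D z \<equiv> free_derivation (dd z)"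

lemma D_K: "q \<in> K \<Longrightarrow> D z q \<in> K"
  unfolding K_iff by (simp add: lin_free_derivation LL_der)

text \<open>The action on A is defined by passing to two quotients in succession, so the exterior
  ideal must be stable on its own.\<close>

lemma D_Jx: assumes "q \<in> Jx" shows "D z q \<in> Jx"
proof -
  let ?K' = "{q \<in> Jx. D z q \<in> Jx}"
  note J = two_sidedD[OF two_sided_Jx]
  have ts: "two_sided ?K'"
    unfolding two_sided_def using J by (auto simp: free_derivation_add free_derivation_mult)
  have "exterior_relations s2 \<subseteq> ?K'"
  proof
    fix q assume q: "q \<in> exterior_relations s2"
    have "D z q \<in> Jx"
      using q unfolding exterior_relations_def
    proof (elim UnE CollectE exE conjE)
      fix u v :: "'g \<times> 'g" assume "q = letter (u + v) - letter u - letter v"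
      then have "D z q = letter (dd z u + dd z v) - letter (dd z u) - letter (dd z v)"
        by (simp add: free_derivation_minus dd_lin)
      then show ?thesis using Jx_relations unfolding exterior_relations_def by blast
    next
      fix c v assume "q = letter (s2 c v) - const c * letter v"
      then have "D z q = letter (s2 c (dd z v)) - const c * letter (dd z v)"
        by (simp add: free_derivation_minus free_derivation_mult dd_lin del: s2_simps)
      then show ?thesis using Jx_relations unfolding exterior_relations_def by blast
    next
      fix v :: "'g \<times> 'g" assume q: "q = letter v * letter v"
      let ?l = letter
      have sq: "?l u * ?l u \<in> Jx" for u :: "'g \<times> 'g" using Jx_relations unfolding exterior_relations_def by blast
      have ad: "?l (u + v) - ?l u - ?l v \<in> Jx" for u v :: "'g \<times> 'g"
        using Jx_relations unfolding exterior_relations_def by blast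
      let ?u = "dd z v"
      \<comment> \<open>Polarisation: the anticommutator of two letters written with squares of
        letters and multiples of the additivity relation \<open>ad\<close>.\<close>
      have "D z q = ?l (?u + v) * ?l (?u + v) - ?l (?u + v) * (?l (?u + v) - ?l ?u - ?l v)
         - (?l (?u + v) - ?l ?u - ?l v) * (?l ?u + ?l v) - ?l ?u * ?l ?u - ?l v * ?l v"
        by (simp add: q free_derivation_mult algebra_simps)
      moreover have "?l (?u + v) * (?l (?u + v) - ?l ?u - ?l v) \<in> Jx" by (rule J(3)[OF ad])
      moreover have "(?l (?u + v) - ?l ?u - ?l v) * (?l ?u + ?l v) \<in> Jx" by (rule J(4)[OF ad])
      ultimately show ?thesis using J(6)[OF J(6)[OF J(6)[OF J(6)[OF sq]] sq] sq] by (simp only:)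
    qed
    then show "q \<in> ?K'" using q Jx_relations by blast
  qed
  then show ?thesis using Jx_minimal[OF ts] assms by blast
qed

lemma exterior_class_eq: "exterior_class s2 p = exterior_class s2 q \<longleftrightarrow> p - q \<in> Jx"
  using ring.quotient_eq_iff_same_a_r_cos[OF ring_type_algebra quotient_facts(9), of p q]
  by (simp add: exterior_class_def a_minus_type Jx_def)

lemma quot_map_exterior:
  "quot_map free_ring (exterior_ideal s2) (D z) (exterior_class s2 p) = exterior_class s2 (D z p)"
proof -
  have e: "exterior_class s2 p = {k + p |k. k \<in> Jx}" by (simp add: exterior_class_def coset_type Jx_def)
  have "exterior_class s2 (D z (k + p)) = exterior_class s2 (D z p)" if "k \<in> Jx" for k
    using D_Jx[OF that] by (simp add: exterior_class_eq free_derivation_add)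
  moreover have "0 \<in> Jx" using two_sidedD(1)[OF two_sided_Jx] .
  ultimately show ?thesis unfolding quot_map_def e by (auto simp: exterior_class_def[symmetric])
qed

text \<open>\<open>quot_map\<close> takes a union over all representatives. Since \<open>D z\<close>
  preserves \<open>Jx\<close> and \<open>K\<close>, they all give the same coset.\<close>

lemma A_action_class: "A_action scale brk n x f z (cls p) = cls (D z p)"
proof -
  let ?E = "exterior_algebra s2" and ?I = "ideal_I scale n x f"
  have add: "exterior_class s2 p \<oplus>\<^bsub>?E\<^esub> exterior_class s2 q = exterior_class s2 (p + q)" for p q
    using ideal.a_rcos_sum[OF quotient_facts(9), of p q]
    by (simp add: exterior_algebra_def exterior_class_def Jx_def FactRing_def)
  have "carrier ?E = range (exterior_class s2)"
    unfolding exterior_algebra_def FactRing_def A_RCOSETS_def' by (auto simp: exterior_class_def)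
  moreover have "?I \<subseteq> carrier ?E"
    using quotient_facts(8) by (meson additive_subgroup.a_subset ideal.axioms(1))
  ultimately have I: "?I = exterior_class s2 ` K" unfolding K_def by auto
  have c: "cls p = {exterior_class s2 (k + p) |k. k \<in> K}"
    unfolding A_class_def a_r_coset_def' I by (auto simp: add)
  have "?I +>\<^bsub>?E\<^esub> quot_map free_ring (exterior_ideal s2) (D z) (exterior_class s2 (k + p)) = cls (D z p)"
    if "k \<in> K" for k
  proof -
    have "cls (D z (k + p)) = cls (D z p)"
      unfolding quotient_facts(3) using D_K[OF that] by (simp add: free_derivation_add)
    then show ?thesis by (simp add: quot_map_exterior A_class_def)
  qed
  moreover have "0 \<in> K" using two_sidedD(1)[OF quotient_facts(4)] .
  ultimately show ?thesis unfolding A_action_def quot_map_def[of ?E] by (subst c) auto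
qed

lemma cls_ring:
  "cls p \<oplus>\<^bsub>algebra_A scale n x f\<^esub> cls q = cls (p + q)" "cls p \<otimes>\<^bsub>algebra_A scale n x f\<^esub> cls q = cls (p * q)"
  "\<zero>\<^bsub>algebra_A scale n x f\<^esub> = cls 0" "\<one>\<^bsub>algebra_A scale n x f\<^esub> = cls 1"
  "cls p [^]\<^bsub>algebra_A scale n x f\<^esub> (k::nat) = cls (p ^ k)"
proof -
  interpret h: ring_hom_ring free_ring "algebra_A scale n x f" cls by (rule quotient_facts(1))
  show a: "cls p \<oplus>\<^bsub>algebra_A scale n x f\<^esub> cls q = cls (p + q)" "cls p \<otimes>\<^bsub>algebra_A scale n x f\<^esub> cls q = cls (p * q)"
    for p q using h.hom_add[of p q] h.hom_mult[of p q] by simp_all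
  show "\<zero>\<^bsub>algebra_A scale n x f\<^esub> = cls 0" using h.hom_zero by simp
  show o: "\<one>\<^bsub>algebra_A scale n x f\<^esub> = cls 1" using h.hom_one by simp
  show "cls p [^]\<^bsub>algebra_A scale n x f\<^esub> (k::nat) = cls (p ^ k)"
    by (induction k) (simp_all add: o a power_commutes)
qed

lemma A_invariants_class: "A_invariants scale brk n x f = cls ` {p. \<forall>z. D z p \<in> K}"
proof -
  have k: "cls p = cls 0 \<longleftrightarrow> p \<in> K" for p by (simp add: quotient_facts(3))
  show ?thesis
  proof (intro equalityI subsetI)
    fix a assume "a \<in> A_invariants scale brk n x f"
    then obtain p where p: "a = cls p" "\<And>z. A_action scale brk n x f z (cls p) = cls 0"
      unfolding A_invariants_def quotient_facts(2) cls_ring(3) by blast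
    then have "\<forall>z. D z p \<in> K" unfolding A_action_class k by blast
    then show "a \<in> cls ` {p. \<forall>z. D z p \<in> K}" using p(1) by blast
  next
    fix a assume "a \<in> cls ` {p. \<forall>z. D z p \<in> K}"
    then obtain p where p: "a = cls p" "\<And>z. D z p \<in> K" by blast
    then have "\<forall>z. A_action scale brk n x f z (cls p) = cls 0" unfolding A_action_class k by blast
    then show "a \<in> A_invariants scale brk n x f"
      unfolding A_invariants_def quotient_facts(2) cls_ring(3) using p(1) by blast
  qed
qed

definition ss :: "('g \<times> 'g) free_alg" where "ss = (\<Sum>i<n. letter (iX (x i)) * letter (iY (x i)))"

lemma lin_ss_mult: "lin w (ss * q) = casimir (\<lambda>a b. lin (\<lambda>t. w (iX a # iY b # t)) q)"
  by (simp add: ss_def sum_distrib_right lin_sum cas_def mult.assoc)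

lemma D_ss: "D z ss \<in> K"
  unfolding K_iff
proof (intro allI impI)
  fix w assume w: "LL w"
  have "bilin scale (\<lambda>a b. w [iX a, iY b])"
    using mlin_bilin[OF LL_mlin[OF w], of "[]" "[]"] 
    by (intro bilin_compose[where s = s2 and t = scale and i = iX and j = iY and \<beta> = "\<lambda>a b. w [a, b]"]) simp_all
  from casimir_inv[OF this, of z] show "lin w (D z ss) = 0"
    unfolding lin_free_derivation using lin_ss_mult[of "der (dd z) w" 1] by simp
qed

lemma D_ss_power: "D z (ss ^ m) \<in> K"
proof (induction m)
  case (Suc m)
  then show ?case using D_ss[of z] two_sidedD[OF quotient_facts(4)]
    by (simp add: free_derivation_mult)
qed (simp add: two_sidedD(1)[OF quotient_facts(4)])

end

lemma cas_lin:
  "cas n x (\<lambda>a b. \<beta> a b + \<gamma> a b) = cas n x \<beta> + cas n x \<gamma>" "cas n x (\<lambda>a b. \<beta> a b - \<gamma> a b) = cas n x \<beta> - cas n x \<gamma>"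
  "cas n x (\<lambda>a b. - \<beta> a b) = - cas n x \<beta>" "cas n x (\<lambda>a b. c * \<beta> a b) = c * cas n x \<beta>" "cas n x (\<lambda>a b. 0) = 0"
  by (simp_all add: cas_def sum.distrib sum_subtractf sum_negf sum_distrib_left)

lemma cas_sum: "cas n x (\<lambda>a b. \<Sum>k\<in>I. \<beta> k a b) = (\<Sum>k\<in>I. cas n x (\<beta> k))"
  unfolding cas_def by (rule sum.swap)

section \<open>Functionals on A as pairs of forms\<close>

context simple_lie_algebra_with_basis
begin

lemma brk_sum_left: "brk (\<Sum>i\<in>I. z i) w = (\<Sum>i\<in>I. brk (z i) w)"
  by (induction I rule: infinite_finite_induct) (simp_all add: brk_add_left)

text \<open>Extends a pair of forms to lists over \<open>g \<times> g\<close> by moving the first-copy components to the left; the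
  sign comes from passing such a component across those already collected in \<open>vs\<close>.\<close>

fun shuffle :: "('g list \<Rightarrow> 'g list \<Rightarrow> complex) \<Rightarrow> 'g list \<Rightarrow> 'g list \<Rightarrow> ('g \<times> 'g) list \<Rightarrow> complex" where
  "shuffle P us vs [] = P us vs"
| "shuffle P us vs (a # ws) = (-1) ^ length vs * shuffle P (us @ [fst a]) vs ws + shuffle P us (vs @ [snd a]) ws"

lemma form_sign: assumes "form w" shows "form (\<lambda>t. (-1) ^ length t * w t)"
proof (rule formI)
  note ml = form_mlin[OF assms]
  show "mlin scale (\<lambda>t. (-1) ^ length t * w t)"
    by (rule mlinI) (simp_all add: mlin_plus[OF ml] mlin_scale[OF ml] algebra_simps)
  show "(-1) ^ length (l @ u # u # r) * w (l @ u # u # r) = 0" for l u r by (simp add: form_same[OF assms])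
  show "casimir (\<lambda>a b. (-1) ^ length (l @ a # brk u b # r) * w (l @ a # brk u b # r)) = 0" for l u r
    using form_contract[OF assms, of l u r] by (simp add: cas_lin)
qed

lemma form_append_right: "form w \<Longrightarrow> form (\<lambda>t. w (t @ r))"
  using form_ctx[of w "[]" r] by simp

lemma form_shuffle:
  assumes "pairform P"
  shows "form (\<lambda>t. shuffle P t vs ws)" "form (\<lambda>t. shuffle P us t ws)"
proof -
  have "form (\<lambda>t. shuffle P t vs ws) \<and> form (\<lambda>t. shuffle P us t ws)" for us vs
  proof (induction ws arbitrary: us vs)
    case Nil then show ?case using pairformD[OF assms] by simp
  next
    case (Cons a ws)
    then show ?case
      using form_append_right[of "\<lambda>t. shuffle P t vs ws" "[fst a]"] form_append_right[of "\<lambda>t. shuffle P us t ws" "[snd a]"]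
      by (auto intro!: form_add form_scale form_sign)
  qed
  then show "form (\<lambda>t. shuffle P t vs ws)" "form (\<lambda>t. shuffle P us t ws)" by blast+
qed

lemma shuffle_mixed:
  assumes "\<And>l r l' r' z. casimir (\<lambda>u v. P (l @ u # r) (l' @ brk z v # r')) = 0"
  shows "casimir (\<lambda>u v. shuffle P (l @ u # r) (l' @ brk z v # r') ws) = 0"
proof (induction ws arbitrary: r r')
  case Nil show ?case using assms by simp
next
  case (Cons a ws)
  then show ?case using Cons.IH[of "r @ [fst a]" r'] Cons.IH[of r "r' @ [snd a]"]
    by (simp add: cas_lin)
qed

lemma shuffle_X: assumes "pairform P" shows "shuffle P us vs (iX u # ws) = (-1) ^ length vs * shuffle P (us @ [u]) vs ws"
  using mlin_zero[OF form_mlin[OF form_shuffle(2)[OF assms, of us ws]], of vs "[]"] by simp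

lemma shuffle_Y: assumes "pairform P" shows "shuffle P us vs (iY v # ws) = shuffle P us (vs @ [v]) ws"
  using mlin_zero[OF form_mlin[OF form_shuffle(1)[OF assms, of vs ws]], of us "[]"] by simp

text \<open>The relations inside one copy hold because the pair is a form in each variable; the
  mixed one is the hypothesis \<open>mix\<close>, inserted into the middle of the collected lists by
  \<open>shuffle_mixed\<close>.\<close>

lemma LL_shuffle:
  assumes P: "pairform P" and mix: "\<And>l r l' r' z. casimir (\<lambda>u v. P (l @ u # r) (l' @ brk z v # r')) = 0"
  shows "LL (shuffle P us vs)"
proof (rule LLI)
  note f1 = form_shuffle(1)[OF P] and f2 = form_shuffle(2)[OF P]
  note ml = form_mlin[OF f1] form_mlin[OF f2]
  show "mlin s2 (shuffle P us vs)"
  proof (rule mlinI)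
    fix l r a b
    show "shuffle P us vs (l @ (a + b) # r) = shuffle P us vs (l @ a # r) + shuffle P us vs (l @ b # r)"
    proof (induction l arbitrary: us vs)
      case Nil
      show ?case using mlin_plus[OF ml(1), where l = us and r = "[]"] mlin_plus[OF ml(2), where l = vs and r = "[]"]
        by (simp add: algebra_simps)
    qed (simp add: algebra_simps)
  next
    fix l r c a
    show "shuffle P us vs (l @ s2 c a # r) = c * shuffle P us vs (l @ a # r)"
    proof (induction l arbitrary: us vs)
      case Nil
      show ?case using mlin_scale[OF ml(1), where l = us and r = "[]"] mlin_scale[OF ml(2), where l = vs and r = "[]"]
        by (cases a) (simp add: algebra_simps)
    qed (simp add: algebra_simps)
  qed
  fix l r
  show "shuffle P us vs (l @ a # a # r) = 0" for a
  proof (induction l arbitrary: us vs)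
    case Nil
    \<comment> \<open>The two terms that send one component to each copy cancel by the sign; the
      other two repeat an argument.\<close>
    show ?case using form_same[OF f1, where l = us and r = "[]"] form_same[OF f2, where l = vs and r = "[]"] by simp
  qed simp
  fix i j u assume ij: "(i, j) \<in> {(iX, iX), (iX, iY), (iY, iY)}"
  show "casimir (\<lambda>a b. shuffle P us vs (l @ i a # j (brk u b) # r)) = 0"
  proof (induction l arbitrary: us vs)
    case Nil
    consider "i = iX" "j = iX" | "i = iX" "j = iY" | "i = iY" "j = iY" using ij by auto
    then show ?case
    proof cases
      case 1
      have "casimir (\<lambda>a b. shuffle P (us @ [a, brk u b]) vs r) = 0" using form_contract[OF f1, where l = us and u = u and r = "[]"] by simp
      then show ?thesis by (simp only: 1 append_Nil shuffle_X[OF P]) (simp add: cas_lin)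
    next
      case 2
      have "casimir (\<lambda>a b. shuffle P (us @ [a]) (vs @ [brk u b]) r) = 0"
        using shuffle_mixed[OF mix, of us "[]" vs u "[]"] by simp
      then show ?thesis
        by (simp only: 2 append_Nil shuffle_X[OF P] shuffle_Y[OF P]) (simp add: cas_lin)
    next
      case 3
      have "casimir (\<lambda>a b. shuffle P us (vs @ [a, brk u b]) r) = 0" using form_contract[OF f2, where l = vs and u = u and r = "[]"] by simp
      then show ?thesis by (simp only: 3 append_Nil shuffle_Y[OF P]) simp
    qed
  next
    case (Cons a l)
    then show ?case by (simp add: cas_lin)
  qed
qed

definition pair_of :: "(('g \<times> 'g) list \<Rightarrow> complex) \<Rightarrow> 'g list \<Rightarrow> 'g list \<Rightarrow> complex" where
  "pair_of w us vs = w (map iX us @ map iY vs)"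

lemma form_embed:
  assumes w: "LL w" and i: "(i, i) \<in> {(iX, iX), (iX, iY), (iY, iY)}"
  shows "form (\<lambda>t. w (p @ map i t @ q))"
proof (rule formI)
  note e = embedding_simps[OF i]
  show "mlin scale (\<lambda>t. w (p @ map i t @ q))"
    using mlin_plus[OF LL_mlin[OF w], of "p @ map i _"] mlin_scale[OF LL_mlin[OF w], of "p @ map i _"]
    by (intro mlinI) (simp_all add: e)
  show "w (p @ map i (l @ u # u # r) @ q) = 0" for l u r
    using LL_same[OF w, of "p @ map i l" "i u" "map i r @ q"] by simp
  show "casimir (\<lambda>a b. w (p @ map i (l @ a # brk u b # r) @ q)) = 0" for l u r
    using LL_contract[OF w i, of "p @ map i l" u "map i r @ q"] by simp
qed

lemma pairform_pair_of: assumes "LL w" shows "pairform (pair_of w)"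
  unfolding pairform_def pair_of_def[abs_def]
  using form_embed[OF assms, of iX "[]"] form_embed[OF assms, of iY _ "[]"] by simp

lemma LL_move: assumes "LL w" shows "w (l @ m @ a # r) = (-1) ^ length m * w (l @ a # m @ r)"
proof (induction m arbitrary: l)
  case (Cons b m)
  have "w (l @ (b # m) @ a # r) = w ((l @ [b]) @ m @ a # r)" by simp
  also have "\<dots> = (-1) ^ length m * w ((l @ [b]) @ a # m @ r)" by (rule Cons.IH)
  also have "w ((l @ [b]) @ a # m @ r) = - w (l @ a # b # m @ r)"
    using alternating_swap[OF LL_mlin[OF assms] LL_same[OF assms], of l b a "m @ r"] by simp
  finally show ?case by simp
qed simp

text \<open>Each argument splits as \<open>iX u + iY v\<close>, and alternation moves the first part
  across the collected \<open>vs\<close>. A functional on A is thereby recovered from its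
  pair.\<close>

lemma LL_eq_shuffle:
  assumes "LL w" shows "w (map iX us @ map iY vs @ ws) = shuffle (pair_of w) us vs ws"
proof (induction ws arbitrary: us vs)
  case Nil show ?case by (simp add: pair_of_def)
next
  case (Cons a ws)
  obtain u v where a: "a = iX u + iY v" "a = (u, v)" by (cases a) simp
  have "w (map iX us @ map iY vs @ a # ws) = w (map iX us @ map iY vs @ iX u # ws) + w (map iX us @ map iY vs @ iY v # ws)"
    using mlin_plus[OF LL_mlin[OF assms], of "map iX us @ map iY vs" "iX u" "iY v" ws] unfolding a(1) by simp
  also have "w (map iX us @ map iY vs @ iX u # ws) = (-1) ^ length vs * w (map iX (us @ [u]) @ map iY vs @ ws)"
    using LL_move[OF assms, of "map iX us" "map iY vs" "iX u" ws] by simp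
  also have "w (map iX us @ map iY vs @ iY v # ws) = w (map iX us @ map iY (vs @ [v]) @ ws)" by simp
  finally show ?case by (simp only: Cons.IH) (simp add: a(2))
qed

lemma LL_eq_shuffle0: "LL w \<Longrightarrow> w ws = shuffle (pair_of w) [] [] ws"
  using LL_eq_shuffle[of w "[]" "[]" ws] by simp

lemma shuffle_zero: "(\<And>us vs. P us vs = 0) \<Longrightarrow> shuffle P us vs ws = 0"
  by (induction ws arbitrary: us vs) simp_all

abbreviation pure :: "('g + 'g) list \<Rightarrow> ('g \<times> 'g) list" where
  "pure ts \<equiv> map (case_sum (\<lambda>u. (u, 0)) (\<lambda>u. (0, u))) ts"

abbreviation lefts :: "('g + 'g) list \<Rightarrow> nat" where "lefts ts \<equiv> length (filter isl ts)"
abbreviation rights :: "('g + 'g) list \<Rightarrow> nat" where "rights ts \<equiv> length (filter (\<lambda>s. \<not> isl s) ts)"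

lemma shuffle_support:
  assumes P: "pairform P" and supp: "\<And>us vs. P us vs \<noteq> 0 \<Longrightarrow> length us = a \<and> length vs = b"
  shows "shuffle P us vs (pure ts) \<noteq> 0 \<Longrightarrow> length us + lefts ts = a \<and> length vs + rights ts = b"
proof (induction ts arbitrary: us vs)
  case Nil then show ?case using supp by simp
next
  case (Cons t ts)
  show ?case
  proof (cases t)
    case (Inl u)
    then have "shuffle P (us @ [u]) vs (pure ts) \<noteq> 0" using Cons.prems shuffle_X[OF P, of us vs u "pure ts"] by auto
    from Cons.IH[OF this] show ?thesis by (simp add: Inl)
  next
    case (Inr u)
    then have "shuffle P us (vs @ [u]) (pure ts) \<noteq> 0" using Cons.prems shuffle_Y[OF P, of us vs u "pure ts"] by auto
    from Cons.IH[OF this] show ?thesis by (simp add: Inr)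
  qed
qed

definition pair_der :: "'g \<Rightarrow> ('g list \<Rightarrow> 'g list \<Rightarrow> complex) \<Rightarrow> 'g list \<Rightarrow> 'g list \<Rightarrow> complex" where
  "pair_der z P us vs = der (brk z) (\<lambda>t. P t vs) us + der (brk z) (P us) vs"

text \<open>Stated for arbitrary collected lists, since an argument absorbed from \<open>ws\<close>
  carries its derivative from the first term into the second or third.\<close>

lemma shuffle_der:
  "der (dd z) (shuffle P us vs) ws + der (brk z) (\<lambda>t. shuffle P t vs ws) us + der (brk z) (\<lambda>t. shuffle P us t ws) vs
    = shuffle (pair_der z P) us vs ws"
proof (induction ws arbitrary: us vs)
  case Nil show ?case by (simp add: pair_der_def)
next
  case (Cons a ws)
  let ?s = "(-1) ^ length vs :: complex"
  have 1: "der (dd z) (shuffle P us vs) (a # ws) =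
     ?s * shuffle P (us @ [brk z (fst a)]) vs ws + shuffle P us (vs @ [brk z (snd a)]) ws
     + ?s * der (dd z) (shuffle P (us @ [fst a]) vs) ws + der (dd z) (shuffle P us (vs @ [snd a])) ws"
    by (simp add: der_add der_scale)
  have 2: "der (brk z) (\<lambda>t. shuffle P t vs (a # ws)) us =
     ?s * der (brk z) (\<lambda>t. shuffle P (t @ [fst a]) vs ws) us + der (brk z) (\<lambda>t. shuffle P t (vs @ [snd a]) ws) us"
    by (simp add: der_add der_scale)
  have 3: "der (brk z) (\<lambda>t. shuffle P us t (a # ws)) vs =
     ?s * der (brk z) (\<lambda>t. shuffle P (us @ [fst a]) t ws) vs + der (brk z) (\<lambda>t. shuffle P us (t @ [snd a]) ws) vs"
  proof -
    have "der (brk z) (\<lambda>t. shuffle P us t (a # ws)) vs =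
       der (brk z) (\<lambda>t. ?s * shuffle P (us @ [fst a]) t ws + shuffle P us (t @ [snd a]) ws) vs"
      by (rule der_cong_length) simp
    then show ?thesis by (simp add: der_add der_scale)
  qed
  have 4: "der (brk z) (\<lambda>t. shuffle P t vs ws) (us @ [fst a]) =
    der (brk z) (\<lambda>t. shuffle P (t @ [fst a]) vs ws) us + shuffle P (us @ [brk z (fst a)]) vs ws"
   "der (brk z) (\<lambda>t. shuffle P us t ws) (vs @ [snd a]) =
    der (brk z) (\<lambda>t. shuffle P us (t @ [snd a]) ws) vs + shuffle P us (vs @ [brk z (snd a)]) ws"
    by (simp_all add: der_append)
  have "shuffle (pair_der z P) us vs (a # ws)
      = ?s * shuffle (pair_der z P) (us @ [fst a]) vs ws + shuffle (pair_der z P) us (vs @ [snd a]) ws" by simp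
  then show ?case unfolding Cons.IH[symmetric] 1 2 3 4 by (simp only:) (simp add: algebra_simps)
qed

lemma invariant_shuffle: "invariant P \<Longrightarrow> der (dd z) (shuffle P [] []) ws = 0"
  using shuffle_der[of z P "[]" "[]" ws] by (simp add: invariant_def pair_der_def shuffle_zero)

lemma der_embed:
  assumes "\<And>u. dd z (i u) = i (brk z u)"
  shows "der (dd z) w (map i us) = der (brk z) (\<lambda>t. w (map i t)) us"
  by (induction us arbitrary: w) (simp_all add: assms del: map_prod_simp)

lemma invariant_pair_of:
  assumes "\<And>z ws. der (dd z) w ws = 0" shows "invariant (pair_of w)"
  unfolding invariant_def pair_of_def
proof (intro allI)
  fix z us vs
  show "der (brk z) (\<lambda>t. w (map iX t @ map iY vs)) us + der (brk z) (\<lambda>t. w (map iX us @ map iY t)) vs = 0"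
    using assms[of z "map iX us @ map iY vs"] der_embed[of z iX "\<lambda>t. w (t @ map iY vs)" us]
      der_embed[of z iY "\<lambda>t. w (map iX us @ t)" vs] by (simp add: der_append)
qed

end

section \<open>The fourth power of S vanishes, and a functional dual to the cube\<close>

context G2
begin

text \<open>Of seven arguments at least four go into the same copy, where no forms of that degree
  exist.\<close>

lemma LL_long: assumes "LL w" "length ws \<ge> 7" shows "w ws = 0"
proof -
  have P: "pairform (pair_of w)" by (rule pairform_pair_of[OF assms(1)])
  have z: "pair_of w us vs = 0" if "length us \<ge> 4 \<or> length vs \<ge> 4" for us vs
    using that form_4[OF pairformD(1)[OF P], of us] form_4[OF pairformD(2)[OF P], of vs] by blast
  have "shuffle (pair_of w) us vs ws = 0" if "length us + length vs + length ws \<ge> 7" for us vs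
    using that
  proof (induction ws arbitrary: us vs)
    case Nil then show ?case by (simp, intro z) linarith
  next
    case (Cons a ws)
    then show ?case using Cons.IH[of "us @ [fst a]" vs] Cons.IH[of us "vs @ [snd a]"] by simp
  qed
  then show ?thesis using LL_eq_shuffle0[OF assms(1)] assms(2) by simp
qed

lemma lin_ss_power_zero:
  assumes "\<And>t. length t = length l + 2 * m \<Longrightarrow> w t = 0"
  shows "lin (\<lambda>t. w (l @ t)) (ss ^ m) = 0"
  using assms
proof (induction m arbitrary: l)
  case (Suc m)
  have "lin (\<lambda>t. w ((l @ [iX a, iY b]) @ t)) (ss ^ m) = 0" for a b
    using Suc.prems by (intro Suc.IH) simp
  then show ?case by (simp add: lin_ss_mult cas_def)
qed simp

lemma ss_4: "ss ^ 4 \<in> K"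
  unfolding K_iff using lin_ss_power_zero[of "[]" 4] LL_long by simp

text \<open>Each factor of S supplies one argument from either copy, so a functional of a fixed
  bidegree sees at most one power.\<close>

lemma lin_ss_power_support:
  assumes "\<And>ts. w (pure ts) \<noteq> 0 \<Longrightarrow> lefts ts = a \<and> rights ts = b"
    and "lin (\<lambda>t. w (pure ts @ t)) (ss ^ m) \<noteq> 0"
  shows "lefts ts + m = a \<and> rights ts + m = b"
  using assms(2)
proof (induction m arbitrary: ts)
  case 0 then show ?case using assms(1) by simp
next
  case (Suc m)
  show ?case
  proof (rule ccontr)
    assume *: "\<not> ?case"
    have "lin (\<lambda>t. w (pure (ts @ [Inl c, Inr d]) @ t)) (ss ^ m) = 0" for c d
      using Suc.IH[of "ts @ [Inl c, Inr d]"] * by fastforce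
    then have "lin (\<lambda>t. w (pure ts @ t)) (ss ^ Suc m) = 0" by (simp add: lin_ss_mult cas_def)
    then show False using Suc.prems by simp
  qed
qed

lemma sum_W3: "(\<Sum>w\<in>W3. g w) = (\<Sum>i<14. \<Sum>j<14. \<Sum>k<14. g [i, j, k])"
  unfolding numeral_3_eq_3 sum_words_Suc[OF finite_lessThan] by simp

lemma dual_of_cube:
  "\<exists>\<phi>. LL \<phi> \<and> (\<forall>z ws. der (dd z) \<phi> ws = 0) \<and> (\<forall>ts. \<phi> (pure ts) \<noteq> 0 \<longrightarrow> lefts ts = 3 \<and> rights ts = 3)
     \<and> lin \<phi> (ss ^ 3) \<noteq> 0"
proof -
  obtain P where P: "pairform P" "invariant P" "\<And>us vs. P us vs \<noteq> 0 \<Longrightarrow> length us = 3 \<and> length vs = 3"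
    and tr: "(\<Sum>w\<in>W3. P (map y w) (map y w)) \<noteq> 0" using invariant_3form_exists by blast
  define \<phi> where "\<phi> = shuffle P [] []"
  have LL: "LL \<phi>" unfolding \<phi>_def by (intro LL_shuffle P(1) contract_mixed P(2,3))
  moreover have "\<forall>z ws. der (dd z) \<phi> ws = 0" unfolding \<phi>_def using invariant_shuffle[OF P(2)] by blast
  moreover have "\<forall>ts. \<phi> (pure ts) \<noteq> 0 \<longrightarrow> lefts ts = 3 \<and> rights ts = 3"
    unfolding \<phi>_def using shuffle_support[OF P(1,3), of "[]" "[]"] by auto
  moreover have "lin \<phi> (ss ^ 3) \<noteq> 0"
  proof -
    \<comment> \<open>Collecting the first-copy arguments on the left takes 0 + 1 + 2
      transpositions, hence the sign.\<close>
    have "\<phi> [iX a, iY b, iX c, iY d, iX e, iY g] = - P [a, c, e] [b, d, g]" for a b c d e g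
      unfolding \<phi>_def by (simp add: shuffle_X[OF P(1)] shuffle_Y[OF P(1)] del: shuffle.simps(2))
    then have "lin \<phi> (ss ^ 3) = - casimir (\<lambda>a b. casimir (\<lambda>c d. casimir (\<lambda>e g. P [a, c, e] [b, d, g])))"
      unfolding numeral_3_eq_3 power_Suc power_0 lin_ss_mult by (simp add: cas_def sum_negf)
    \<comment> \<open>The three contractions are rewritten one after another in the family
      \<open>y\<close>, each at the cost of a factor -1 / \<kappa>, until the trace of
      \<open>P\<close> remains.\<close>
    also have "casimir (\<lambda>a b. casimir (\<lambda>c d. casimir (\<lambda>e g. P [a, c, e] [b, d, g])))
      = - (1 / \<kappa>) * (\<Sum>k<14. casimir (\<lambda>a b. casimir (\<lambda>c d. P [a, c, y k] [b, d, y k])))"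
    proof -
      have "casimir (\<lambda>e g. P [a, c, e] [b, d, g]) = - (1 / \<kappa>) * (\<Sum>k<14. P [a, c, y k] [b, d, y k])" for a b c d
        using casimir_y[OF bilin_pair[OF P(1), of "[a, c]" "[]" "[b, d]" "[]"]] by simp
      then show ?thesis by (simp only: cas_lin(4) cas_sum)
    qed
    also have "(\<Sum>k<14. casimir (\<lambda>a b. casimir (\<lambda>c d. P [a, c, y k] [b, d, y k])))
      = - (1 / \<kappa>) * (\<Sum>k<14. \<Sum>j<14. casimir (\<lambda>a b. P [a, y j, y k] [b, y j, y k]))"
    proof -
      have "casimir (\<lambda>c d. P [a, c, e] [b, d, e]) = - (1 / \<kappa>) * (\<Sum>k<14. P [a, y k, e] [b, y k, e])" for a b e
        using casimir_y[OF bilin_pair[OF P(1), of "[a]" "[e]" "[b]" "[e]"]] by simp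
      then show ?thesis by (simp only: cas_lin(4) cas_sum sum_distrib_left)
    qed
    also have "(\<Sum>k<14. \<Sum>j<14. casimir (\<lambda>a b. P [a, y j, y k] [b, y j, y k]))
      = - (1 / \<kappa>) * (\<Sum>k<14. \<Sum>j<14. \<Sum>i<14. P [y i, y j, y k] [y i, y j, y k])"
    proof -
      have "casimir (\<lambda>a b. P [a, c, e] [b, c, e]) = - (1 / \<kappa>) * (\<Sum>k<14. P [y k, c, e] [y k, c, e])" for c e
        using casimir_y[OF bilin_pair[OF P(1), of "[]" "[c, e]" "[]" "[c, e]"]] by simp
      then show ?thesis by (simp add: sum_distrib_left sum_negf)
    qed
    also have "(\<Sum>k<14. \<Sum>j<14. \<Sum>i<14. P [y i, y j, y k] [y i, y j, y k]) = (\<Sum>w\<in>W3. P (map y w) (map y w))"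
      unfolding sum_W3 by (subst sum.swap, subst (2) sum.swap, subst sum.swap) simp
    finally show ?thesis using tr kappa_nonzero by simp
  qed
  ultimately show ?thesis by blast
qed

subsection \<open>Complete reducibility\<close>

text \<open>The elements \<open>y i\<close> in either copy: on words in them the operators \<open>der (dd (y k))\<close> are given by
  real antisymmetric matrices.\<close>

definition zz :: "nat \<Rightarrow> 'g \<times> 'g" where "zz i = (if i < 14 then iX (y i) else iY (y (i - 14)))"

definition MM :: "nat \<Rightarrow> nat \<Rightarrow> nat \<Rightarrow> real" where
  "MM k i j = (if i < 14 \<and> j < 14 then M k i j else if i \<ge> 14 \<and> j \<ge> 14 then M k (i - 14) (j - 14) else 0)"

lemma MM_antisym: "MM k i j = - MM k j i"
  by (simp add: MM_def) (metis M_antisym)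

lemma sum28: "(\<Sum>i<28. g i) = (\<Sum>i<14. g i) + (\<Sum>i<14. g (i + 14))" for g :: "nat \<Rightarrow> 'z::comm_monoid_add"
proof -
  have "{..<28} = {..<14} \<union> {14..<28::nat}" "{..<14} \<inter> {14..<28::nat} = {}" by auto
  then have "(\<Sum>i<28. g i) = (\<Sum>i<14. g i) + (\<Sum>i\<in>{14..<28}. g i)" by (simp add: sum.union_disjoint)
  also have "(\<Sum>i\<in>{14..<28}. g i) = (\<Sum>i<14. g (i + 14))"
    using sum.shift_bounds_nat_ivl[of g 0 14 14] by (simp add: lessThan_atLeast0)
  finally show ?thesis .
qed

lemma sum_pair: "(\<Sum>i\<in>I. (p i, q i)) = (\<Sum>i\<in>I. p i, \<Sum>i\<in>I. q i)"
  by (induction I rule: infinite_finite_induct) (simp_all add: zero_prod_def)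

lemma zz_expand: "p = (\<Sum>i<28. s2 (if i < 14 then - (1 / \<kappa>) * B (y i) (fst p) else - (1 / \<kappa>) * B (y (i - 14)) (snd p)) (zz i))"
  unfolding sum28 using y_expand[of "fst p"] y_expand[of "snd p"]
  by (simp add: zz_def sum_pair del: minus_mult_left mult_minus_left times_divide_eq_left mult_1)

lemma dd_zz:
  assumes k: "k < 14" and i: "i \<in> {..<28}"
  shows "dd (y k) (zz i) = (\<Sum>j\<in>{..<28}. s2 (of_real (MM k i j)) (zz j))"
proof (cases "i < 14")
  case True
  then show ?thesis unfolding sum28 using brk_y[OF k True] by (simp add: zz_def MM_def sum_pair)
next
  case False
  then have "i - 14 < 14" using i by auto
  then show ?thesis unfolding sum28 using False brk_y[OF k, of "i - 14"] by (simp add: zz_def MM_def sum_pair)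
qed

lemma LL_sum: "(\<And>i. i \<in> I \<Longrightarrow> LL (w i)) \<Longrightarrow> LL (\<lambda>t. \<Sum>i\<in>I. w i t)"
  by (rule qform_sum[OF rel_fun_LRel])
lemma LL_add: "LL w \<Longrightarrow> LL w' \<Longrightarrow> LL (\<lambda>t. w t + w' t)"
  by (rule qform_add[OF rel_fun_LRel])
lemma LL_scale: "LL w \<Longrightarrow> LL (\<lambda>t. c * w t)"
  by (rule qform_scale[OF rel_fun_LRel])

lemma LL_words_eq_0:
  assumes "LL w" "\<And>d u. d < 7 \<Longrightarrow> u \<in> words {..<28} d \<Longrightarrow> w (map zz u) = 0"
  shows "w ws = 0"
proof (cases "length ws < 7")
  case True
  then have "\<And>u. u \<in> words {..<28} (length ws) \<Longrightarrow> w (map zz u) = 0" using assms(2) by blast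
  from mlin_eq_0[where z = zz and s = s2, OF finite_lessThan zz_expand LL_mlin[OF assms(1)] this] show ?thesis .
qed (use LL_long[OF assms(1)] in simp)

lemma dd_y_all:
  assumes w: "mlin s2 w" and k: "\<And>k ws. k < 14 \<Longrightarrow> der (dd (y k)) w ws = 0"
  shows "der (dd z) w ws = 0"
proof -
  have "dd (\<Sum>k\<in>I. scale (c k) (y k)) p = (\<Sum>k\<in>I. s2 (c k) (dd (y k) p))" for p I c
    by (cases p) (simp add: sum_pair brk_sum_left brk_scale_left)
  from this[of "\<lambda>k. - (1 / \<kappa>) * B (y k) z" "{..<14}"]
  have "dd z = (\<lambda>p. \<Sum>k<14. s2 (- (1 / \<kappa>) * B (y k) z) (dd (y k) p))"
    by (simp only: y_expand[symmetric] fun_eq_iff) simp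
  then have "der (dd z) w ws = (\<Sum>k<14. - (1 / \<kappa>) * B (y k) z * der (dd (y k)) w ws)"
    by (simp only: der_map_sum[OF w] der_map_scale[OF w])
  then show ?thesis using k by simp
qed

text \<open>\<open>w\<close> is split into its projection \<open>u\<close> onto the span of all
  derivatives and a remainder \<open>w0\<close>. Derivatives kill \<open>q\<close> because
  \<open>D z q\<close> lies in \<open>K\<close>, and the remainder turns out to be
  invariant.\<close>

lemma invariant_functionals_suffice:
  assumes q: "\<And>z. D z q \<in> K"
    and inv: "\<And>w. LL w \<Longrightarrow> (\<And>z ws. der (dd z) w ws = 0) \<Longrightarrow> lin w q = 0"
  shows "q \<in> K"
  unfolding K_iff
proof (intro allI impI)
  fix w assume w: "LL w"
  let ?G = "{der (dd (y k)) v |k v. k < 14 \<and> LL v}"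
  let ?W = "\<Union>d<7. words {..<28::nat} d"
  have Gq: "LL v \<and> lin v q = 0" if "v \<in> lin_hull ?G" for v
    using that
  proof induction
    case (base v)
    then obtain k v' where v: "v = der (dd (y k)) v'" "LL v'" by blast
    then show ?case using lin_kill[OF v(2) q[of "y k"]] LL_der by (simp add: lin_free_derivation)
  qed (simp_all add: LL_add LL_scale lin_fun_add lin_fun_scale)
  have finW: "finite ?W" by (simp add: finite_words)
  have W: "(\<Sum>u\<in>?W. g u) = (\<Sum>d<7. \<Sum>u\<in>words {..<28} d. g u)" for g :: "nat list \<Rightarrow> complex"
  proof (rule sum.UNION_disjoint)
    show "\<forall>i\<in>{..<7}. \<forall>j\<in>{..<7}. i \<noteq> j \<longrightarrow> words {..<28::nat} i \<inter> words {..<28} j = {}"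
      by (auto dest!: length_words)
  qed (simp_all add: finite_words)
  \<comment> \<open>This member provides the zero function, which \<open>lin_hull\<close> contains
    only for a nonempty set.\<close>
  have "der (dd (y 0)) w \<in> ?G" using w by force
  from lin_hull.scale[OF lin_hull.base[OF this], of 0] have "(\<lambda>_. 0) \<in> lin_hull ?G" by simp
  from projection_exists_on[OF finW this lin_hull.add lin_hull.scale, of "\<lambda>t. w (map zz t)" "map zz"]
  obtain u where u: "u \<in> lin_hull ?G"
    and orth: "\<And>v. v \<in> lin_hull ?G \<Longrightarrow> (\<Sum>t\<in>?W. (w (map zz t) - u (map zz t)) * cnj (v (map zz t))) = 0" by blast
  define w0 where "w0 ws = w ws + (-1) * u ws" for ws
  have w0: "LL w0" unfolding w0_def using w Gq[OF u] by (intro LL_add LL_scale) auto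
  have "der (dd (y k)) w0 ws = 0" if k: "k < 14" for k ws
  proof -
    let ?d = "der (dd (y k)) w0"
    have d: "LL ?d" by (rule LL_der[OF w0])
    have "der (dd (y k)) ?d \<in> lin_hull ?G" using k d by (intro lin_hull.base) blast
    from orth[OF this] have "(\<Sum>t\<in>?W. w0 (map zz t) * cnj (der (dd (y k)) ?d (map zz t))) = 0" by (simp add: w0_def)
    \<comment> \<open>By the skew-Hermitian action, the squared norm of \<open>?d\<close> is minus
      the product of \<open>w0\<close> with a second derivative, and \<open>w0\<close> is orthogonal
      to derivatives.\<close>
    moreover have "(\<Sum>t\<in>words {..<28} e. ?d (map zz t) * cnj (?d (map zz t))) =
       - (\<Sum>t\<in>words {..<28} e. w0 (map zz t) * cnj (der (dd (y k)) ?d (map zz t)))" for e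
      by (rule der_skew[where z = zz and d = "dd (y k)" and s = s2 and M = "MM k",
        OF finite_lessThan dd_zz[OF k] MM_antisym LL_mlin[OF w0] LL_mlin[OF d]])
    ultimately have "(\<Sum>t\<in>?W. ?d (map zz t) * cnj (?d (map zz t))) = 0"
      unfolding W by (simp only: sum_negf) simp
    from sum_mult_cnj_eq_0[OF finW this] have "?d (map zz t) = 0" if "e < 7" "t \<in> words {..<28} e" for e t
      using that by blast
    then show "?d ws = 0" by (rule LL_words_eq_0[OF d])
  qed
  then have "lin w0 q = 0" using dd_y_all[OF LL_mlin[OF w0]] by (intro inv w0) blast
  moreover have "w0 = (\<lambda>ws. w ws + (-1) * u ws)" by (simp add: fun_eq_iff w0_def)
  then have "lin w0 q = lin w q + (-1) * lin u q" by (simp only: lin_fun_add lin_fun_scale)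
  ultimately show "lin w q = 0" using Gq[OF u] by simp
qed

end

context G2
begin

subsection \<open>Invariant functionals\<close>

lemma top_bottom_min: "top l = top (min l 3)" "bottom l = bottom (min l 3)"
  "length (top l) = min l 3" "length (bottom l) = min l 3"
  by (induction l rule: top.induct; simp add: numeral_3_eq_3)+

lemma der_eq_lin: "der d w ws = lin w (free_derivation d (Poly_Mapping.single (Word ws) 1))"
  by (simp add: lin_free_derivation)

text \<open>The functional dual to the cube, multiplied by \<open>ss ^ (3 - k)\<close>, is dual to
  \<open>ss ^ k\<close>. It remains in \<open>LL\<close> because \<open>K\<close> is an ideal, and
  invariant because \<open>D z\<close> sends powers of \<open>ss\<close> into
  \<open>K\<close>.\<close>

lemma dual_of_powers:
  obtains \<psi> where "\<And>k. k < 4 \<Longrightarrow> LL (\<psi> k)" "\<And>k z ws. k < 4 \<Longrightarrow> der (dd z) (\<psi> k) ws = 0"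
     "\<And>k ts. k < 4 \<Longrightarrow> \<psi> k (pure ts) \<noteq> 0 \<Longrightarrow> lefts ts = k \<and> rights ts = k"
     "\<And>k j. k < 4 \<Longrightarrow> lin (\<psi> k) (ss ^ j) \<noteq> 0 \<longleftrightarrow> j = k"
proof -
  obtain \<phi> where \<phi>: "LL \<phi>" "\<And>z ws. der (dd z) \<phi> ws = 0"
    "\<And>ts. \<phi> (pure ts) \<noteq> 0 \<Longrightarrow> lefts ts = 3 \<and> rights ts = 3" "lin \<phi> (ss ^ 3) \<noteq> 0"
    using dual_of_cube by blast
  define \<psi> where "\<psi> k ws = lin (\<lambda>t. \<phi> (ws @ t)) (ss ^ (3 - k))" for k ws
  have l: "lin (\<psi> k) p = lin \<phi> (p * ss ^ (3 - k))" for k p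
    by (simp add: lin_mult \<psi>_def[abs_def])
  have 1: "LL (\<psi> k)" for k
    by (rule LL_if_kills) (simp add: l lin_kill[OF \<phi>(1)] two_sidedD[OF quotient_facts(4)])
  have 2: "der (dd z) (\<psi> k) ws = 0" for k z ws
  proof -
    let ?p = "Poly_Mapping.single (Word ws) 1"
    have "der (dd z) (\<psi> k) ws = lin \<phi> (D z (?p * ss ^ (3 - k))) - lin \<phi> (?p * D z (ss ^ (3 - k)))"
      unfolding der_eq_lin[of _ "\<psi> k"] l by (simp add: free_derivation_mult lin_add)
    also have "der (dd z) \<phi> = (\<lambda>t. 0)" by (simp add: fun_eq_iff \<phi>(2))
    then have "lin \<phi> (D z (?p * ss ^ (3 - k))) = 0" by (simp add: lin_free_derivation)
    also have "lin \<phi> (?p * D z (ss ^ (3 - k))) = 0"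
      by (intro lin_kill[OF \<phi>(1)] two_sidedD[OF quotient_facts(4)] D_ss_power)
    finally show ?thesis by simp
  qed
  have 3: "lefts ts = k \<and> rights ts = k" if "k < 4" "\<psi> k (pure ts) \<noteq> 0" for k ts
    using lin_ss_power_support[of \<phi> 3 3 ts "3 - k", OF \<phi>(3)] that by (auto simp: \<psi>_def)
  have 4: "lin (\<psi> k) (ss ^ j) \<noteq> 0 \<longleftrightarrow> j = k" if "k < 4" for k j
  proof -
    have e: "lin (\<psi> k) (ss ^ j) = lin \<phi> (ss ^ (j + (3 - k)))" by (simp add: l power_add)
    have "j + (3 - k) = 3" if "lin \<phi> (ss ^ (j + (3 - k))) \<noteq> 0"
      using lin_ss_power_support[of \<phi> 3 3 "[]" "j + (3 - k)", OF \<phi>(3)] that by simp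
    moreover have "j + (3 - k) = 3 \<longleftrightarrow> j = k" using \<open>k < 4\<close> by linarith
    ultimately show ?thesis unfolding e using \<phi>(4) by auto
  qed
  show ?thesis by (rule that[OF 1 2 3 4])
qed

lemma pair_of_pure: "pair_of w us vs = w (pure (map Inl us @ map Inr vs))"
  by (simp add: pair_of_def o_def)

lemma lefts_rights_map: "lefts (map Inl us @ map Inr vs) = length us" "rights (map Inl us @ map Inr vs) = length vs"
proof -
  have "lefts (map Inl us) = length us" "rights (map Inl us) = 0" by (induction us) simp_all
  moreover have "lefts (map Inr vs) = 0" "rights (map Inr vs) = length vs" by (induction vs) simp_all
  ultimately show "lefts (map Inl us @ map Inr vs) = length us" "rights (map Inl us @ map Inr vs) = length vs"
    by simp_all
qed

lemma invariant_functional_zero: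
  assumes w: "LL w" and inv: "\<And>z ws. der (dd z) w ws = 0"
    and z: "\<And>k. k < 4 \<Longrightarrow> pair_of w (top k) (bottom k) = 0"
  shows "w ws = 0"
proof -
  have z0: "pair_of w us vs = 0" for us vs
  proof (rule invariant_vanish[OF pairform_pair_of[OF w] invariant_pair_of[OF inv]])
    show "pair_of w (top (length us)) (bottom (length us)) = 0"
      using z[of "min (length us) 3"] by (simp flip: top_bottom_min(1,2))
  qed
  show ?thesis by (rule trans[OF LL_eq_shuffle0[OF w] shuffle_zero[OF z0]])
qed

text \<open>Subtracting the predicted combination of powers makes every \<open>\<psi> k\<close>
  vanish on the remainder. Any invariant functional is a combination of these, being determined by
  its values at the extremal pairs, and so it vanishes there too.\<close>

lemma invariant_mod_K:
  assumes \<psi>: "\<And>k. k < 4 \<Longrightarrow> LL (\<psi> k)" "\<And>k z ws. k < 4 \<Longrightarrow> der (dd z) (\<psi> k) ws = 0"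
     "\<And>k ts. k < 4 \<Longrightarrow> \<psi> k (pure ts) \<noteq> 0 \<Longrightarrow> lefts ts = k \<and> rights ts = k"
     "\<And>k j. k < 4 \<Longrightarrow> lin (\<psi> k) (ss ^ j) \<noteq> 0 \<longleftrightarrow> j = k"
    and q: "\<And>z. D z q \<in> K"
  shows "q - (\<Sum>k<4. const (lin (\<psi> k) q / lin (\<psi> k) (ss ^ k)) * ss ^ k) \<in> K"
proof (rule invariant_functionals_suffice)
  let ?c = "\<lambda>k. lin (\<psi> k) q / lin (\<psi> k) (ss ^ k)"
  let ?q = "q - (\<Sum>k<4. const (?c k) * ss ^ k)"
  note K = two_sidedD[OF quotient_facts(4)]
  have Ksum: "(\<Sum>k\<in>I. p k) \<in> K" if "\<And>k. k \<in> I \<Longrightarrow> p k \<in> K" for I and p :: "nat \<Rightarrow> _"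
    using that by (induction I rule: infinite_finite_induct) (auto intro: K)
  have Dsum: "D z (\<Sum>k\<in>I. p k) = (\<Sum>k\<in>I. D z (p k))" for z I and p :: "nat \<Rightarrow> _"
    by (induction I rule: infinite_finite_induct) (simp_all add: free_derivation_add)
  show "D z ?q \<in> K" for z
    unfolding free_derivation_minus Dsum
    by (intro K(6) q Ksum) (simp add: free_derivation_mult K D_ss_power)
  have kq: "lin (\<psi> k) ?q = 0" if k: "k < 4" for k
  proof -
    have "lin (\<psi> k) (\<Sum>j<4. const (?c j) * ss ^ j) = (\<Sum>j<4. if j = k then ?c k * lin (\<psi> k) (ss ^ k) else 0)"
      unfolding lin_sum using \<psi>(4)[OF k] by (intro sum.cong refl) auto
    also have "\<dots> = lin (\<psi> k) q" using k \<psi>(4)[OF k, of k] by simp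
    finally show ?thesis by (simp add: lin_diff)
  qed
  fix w assume w: "LL w" and inv: "\<And>z ws. der (dd z) w ws = 0"
  have off: "pair_of (\<psi> k) (top j) (bottom j) = 0" if "k < 4" "j < 4" "j \<noteq> k" for j k
    using \<psi>(3)[OF that(1), of "map Inl (top j) @ map Inr (bottom j)"] that
    unfolding pair_of_pure lefts_rights_map by (auto simp: top_bottom_min(3))
  \<comment> \<open>Otherwise \<open>\<psi> k\<close> would vanish at all extremal pairs and hence
    identically, against its nonzero value at \<open>ss ^ k\<close>.\<close>
  have diag: "pair_of (\<psi> k) (top k) (bottom k) \<noteq> 0" if k: "k < 4" for k
  proof
    assume "pair_of (\<psi> k) (top k) (bottom k) = 0"
    then have "pair_of (\<psi> k) (top j) (bottom j) = 0" if "j < 4" for j using off[OF k that] by (cases "j = k") auto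
    from invariant_functional_zero[OF \<psi>(1)[OF k] \<psi>(2)[OF k] this]
    have "lin (\<psi> k) (ss ^ k) = 0" by (simp add: lin_def)
    then show False using \<psi>(4)[OF k, of k] by simp
  qed
  define b where "b k = pair_of w (top k) (bottom k) / pair_of (\<psi> k) (top k) (bottom k)" for k
  define v where "v ws = w ws + (-1) * (\<Sum>k<4. b k * \<psi> k ws)" for ws
  have v: "LL v" unfolding v_def by (intro LL_add LL_scale LL_sum w \<psi>(1)) simp
  have vi: "der (dd z) v ws = 0" for z ws
    unfolding v_def[abs_def] der_add der_scale der_sum by (simp add: inv \<psi>(2))
  have "pair_of v (top k) (bottom k) = 0" if k: "k < 4" for k
  proof -
    have "(\<Sum>j<4. b j * pair_of (\<psi> j) (top k) (bottom k)) = (\<Sum>j<4. if j = k then pair_of w (top k) (bottom k) else 0)"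
      using off[OF _ k] diag[OF k] by (intro sum.cong refl) (auto simp: b_def)
    also have "\<dots> = pair_of w (top k) (bottom k)" using k by simp
    finally show ?thesis by (simp add: pair_of_def v_def)
  qed
  from invariant_functional_zero[OF v vi this] have "lin v ?q = 0" by (simp add: lin_def)
  moreover have "v = (\<lambda>ws. w ws + (-1) * (\<Sum>k<4. b k * \<psi> k ws))" by (simp add: fun_eq_iff v_def)
  then have "lin v ?q = lin w ?q + (-1) * (\<Sum>k<4. b k * lin (\<psi> k) ?q)"
    by (simp only: lin_fun_add lin_fun_scale lin_fun_sum)
  ultimately show "lin w ?q = 0" using kq by simp
qed

subsection \<open>The invariant subalgebra\<close>

lemma const_power: "(const c * ss) ^ k = const (c ^ k) * ss ^ k"
proof (induction k)
  case (Suc k)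
  have "(const c * ss) ^ Suc k = const c * (ss * const (c ^ k)) * ss ^ k" by (simp add: Suc mult.assoc)
  also have "\<dots> = const (c ^ Suc k) * ss ^ Suc k"
    by (simp only: const_commute[of ss] const_lin power_Suc mult.assoc)
  finally show ?case .
qed (simp add: const_lin)

lemma keys_const_ss: "w \<in> Poly_Mapping.keys (const c * ss) \<Longrightarrow> \<exists>u. w = Word (pure [Inl u, Inr u])"
proof -
  assume w: "w \<in> Poly_Mapping.keys (const c * ss)"
  have "const c * ss = (\<Sum>i<n. Poly_Mapping.single (Word (pure [Inl (x i), Inr (x i)])) c)"
    by (simp add: ss_def sum_distrib_left const_def letter_def mult_single plus_word_def zero_word_def)
  then show ?thesis using w keys_sum[of "\<lambda>i. Poly_Mapping.single (Word (pure [Inl (x i), Inr (x i)])) c" "{..<n}"]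
    by (auto split: if_splits)
qed

theorem invariant_subalgebra:
  fixes c :: complex
  defines "A \<equiv> algebra_A scale n x f"
  assumes c: "c \<noteq> 0" and S: "S = A_scalar scale n x f c \<otimes>\<^bsub>A\<^esub> S_element scale n x f"
  shows "S \<in> A_invariants scale brk n x f \<inter> A_bidegree scale n x f 1 1
    \<and> (\<forall>T \<in> A_invariants scale brk n x f \<inter> A_bidegree scale n x f 1 1.
          \<exists>a. T = A_scalar scale n x f a \<otimes>\<^bsub>A\<^esub> S)
    \<and> A_invariants scale brk n x f = subalgebra_generated A (A_scalar scale n x f) {S}
    \<and> S [^]\<^bsub>A\<^esub> (4::nat) = \<zero>\<^bsub>A\<^esub>
    \<and> S [^]\<^bsub>A\<^esub> (3::nat) \<noteq> \<zero>\<^bsub>A\<^esub>"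
proof (intro conjI ballI IntI)
  note K = two_sidedD[OF quotient_facts(4)]
  note ring = cls_ring[folded A_def]
  have sc: "A_scalar scale n x f a = cls (const a)" for a by (simp add: A_scalar_def)
  have S: "S = cls (const c * ss)" unfolding S sc S_element_def ss_def[symmetric] ring ..
  obtain \<psi> where \<psi>: "\<And>k. k < 4 \<Longrightarrow> LL (\<psi> k)" "\<And>k z ws. k < 4 \<Longrightarrow> der (dd z) (\<psi> k) ws = 0"
     "\<And>k ts. k < 4 \<Longrightarrow> \<psi> k (pure ts) \<noteq> 0 \<Longrightarrow> lefts ts = k \<and> rights ts = k"
     "\<And>k j. k < 4 \<Longrightarrow> lin (\<psi> k) (ss ^ j) \<noteq> 0 \<longleftrightarrow> j = k"
  proof (rule dual_of_powers)
    fix \<psi> assume "\<And>k. k < 4 \<Longrightarrow> LL (\<psi> k)" "\<And>k z ws. k < 4 \<Longrightarrow> der (dd z) (\<psi> k) ws = 0"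
     "\<And>k ts. k < 4 \<Longrightarrow> \<psi> k (pure ts) \<noteq> 0 \<Longrightarrow> lefts ts = k \<and> rights ts = k"
     "\<And>k j. k < 4 \<Longrightarrow> lin (\<psi> k) (ss ^ j) \<noteq> 0 \<longleftrightarrow> j = k"
    then show thesis by (rule that)
  qed
  define d where "d q k = lin (\<psi> k) q / lin (\<psi> k) (ss ^ k)" for q k
  have dec: "cls q = cls (\<Sum>k<4. const (d q k) * ss ^ k)" if "\<And>z. D z q \<in> K" for q
    unfolding quotient_facts(3) d_def by (rule invariant_mod_K[OF \<psi> that])
  have inv: "S \<in> A_invariants scale brk n x f"
    unfolding S A_invariants_class by (intro imageI) (simp add: free_derivation_mult K D_ss)
  then show "S \<in> A_invariants scale brk n x f" .
  show "S \<in> A_bidegree scale n x f 1 1"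
    unfolding S A_bidegree_def
  proof (intro imageI CollectI ballI)
    fix w assume "w \<in> Poly_Mapping.keys (const c * ss)"
    from keys_const_ss[OF this] obtain u where u: "w = Word (pure [Inl u, Inr u])" by blast
    show "\<exists>us. w = Word (pure us) \<and> lefts us = 1 \<and> rights us = 1"
      by (intro exI[of _ "[Inl u, Inr u]"]) (simp add: u)
  qed
  show "\<exists>a. T = A_scalar scale n x f a \<otimes>\<^bsub>A\<^esub> S"
    if T: "T \<in> A_invariants scale brk n x f \<inter> A_bidegree scale n x f 1 1" for T
  proof -
    obtain p where p: "T = cls p" "\<And>z. D z p \<in> K" using T unfolding A_invariants_class by blast
    obtain t where t: "T = cls t" "\<And>w. w \<in> Poly_Mapping.keys t \<Longrightarrow> \<exists>us. w = Word (pure us) \<and> lefts us = 1 \<and> rights us = 1"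
      using T unfolding A_bidegree_def by blast
    \<comment> \<open>\<open>p\<close> is an invariant representative and \<open>t\<close> a
      homogeneous one; as they differ by an element of \<open>K\<close>, \<open>t\<close> is
      invariant modulo \<open>K\<close> as well.\<close>
    have "t - p \<in> K" using p(1) t(1) by (simp add: quotient_facts(3)[symmetric])
    then have Dt: "D z t \<in> K" for z using K(2)[OF D_K[of "t - p" z] p(2)[of z]] by (simp add: free_derivation_minus)
    \<comment> \<open>\<open>\<psi> k\<close> sees only words of bidegree (k, k), while all words of
      \<open>t\<close> have bidegree (1, 1).\<close>
    have "d t k = 0" if "k < 4" "k \<noteq> 1" for k
    proof -
      have "\<psi> k (letters w) = 0" if "w \<in> Poly_Mapping.keys t" for w
        using t(2)[OF that] \<psi>(3)[OF \<open>k < 4\<close>] \<open>k \<noteq> 1\<close> by fastforce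
      then show ?thesis by (simp add: d_def lin_def)
    qed
    then have "(\<Sum>k<4. const (d t k) * ss ^ k) = (\<Sum>k<(4::nat). if k = 1 then const (d t 1) * ss else 0)"
      by (intro sum.cong refl) (auto simp: const_lin)
    then have "T = cls (const (d t 1) * ss)" using dec[OF Dt] t(1) by simp
    also have "const (d t 1) * ss = const (d t 1 / c) * (const c * ss)"
      using c by (simp add: mult.assoc[symmetric] flip: const_lin(2))
    finally show ?thesis unfolding S sc ring by blast
  qed
  show "A_invariants scale brk n x f = subalgebra_generated A (A_scalar scale n x f) {S}" (is "?I = ?G")
  proof (intro equalityI subsetI)
    fix T assume "T \<in> ?I"
    then obtain q where q: "T = cls q" "\<And>z. D z q \<in> K" unfolding A_invariants_class by blast
    have const: "cls (const a) \<in> ?G" for a using subalgebra_generated.scalar[of "A_scalar scale n x f" a A] by (simp add: sc)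
    have mult: "cls (p * p') \<in> ?G" if "cls p \<in> ?G" "cls p' \<in> ?G" for p p'
      using subalgebra_generated.mult[OF that] by (simp add: ring)
    have add: "cls (p + p') \<in> ?G" if "cls p \<in> ?G" "cls p' \<in> ?G" for p p'
      using subalgebra_generated.add[OF that] by (simp add: ring)
    have gen: "cls (const c * ss) \<in> ?G" using subalgebra_generated.gen[of S "{S}" A "A_scalar scale n x f"] by (simp add: S)
    have "const (1 / c) * (const c * ss) = ss"
      using c by (simp add: mult.assoc[symmetric] const_lin(3) flip: const_lin(2))
    then have ssG: "cls ss \<in> ?G" using mult[OF const[of "1 / c"] gen] by simp
    have pw: "cls (ss ^ k) \<in> ?G" for k
    proof (induction k)
      case 0 show ?case using const[of 1] by (simp add: const_lin)
    next
      case (Suc k) then show ?case using mult[OF ssG] by simp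
    qed
    have "cls (\<Sum>k\<in>I. const (d q k) * ss ^ k) \<in> ?G" if "finite I" for I
      using that
    proof (induction I rule: finite_induct)
      case empty show ?case using const[of 0] by (simp add: const_lin)
    next
      case (insert k I)
      then show ?case by (simp add: add mult const pw)
    qed
    then show "T \<in> ?G" unfolding q(1) dec[OF q(2)] by blast
  next
    fix T assume "T \<in> ?G"
    then show "T \<in> ?I"
    proof induction
      case (scalar a)
      show ?case unfolding sc A_invariants_class by (intro imageI) (simp add: K)
    next
      case (gen a) then show ?case using inv by simp
    next
      case (add a b)
      then obtain p q where "a = cls p" "b = cls q" "\<forall>z. D z p \<in> K" "\<forall>z. D z q \<in> K"
        unfolding A_invariants_class by blast
      then show ?case unfolding A_invariants_class by (simp add: ring, intro imageI) (simp add: free_derivation_add K)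
    next
      case (mult a b)
      then obtain p q where "a = cls p" "b = cls q" "\<forall>z. D z p \<in> K" "\<forall>z. D z q \<in> K"
        unfolding A_invariants_class by blast
      then show ?case unfolding A_invariants_class by (simp add: ring, intro imageI) (simp add: free_derivation_mult K)
    qed
  qed
  show "S [^]\<^bsub>A\<^esub> (4::nat) = \<zero>\<^bsub>A\<^esub>"
    unfolding S ring const_power quotient_facts(3) using K(3)[OF ss_4] by simp
  show "S [^]\<^bsub>A\<^esub> (3::nat) \<noteq> \<zero>\<^bsub>A\<^esub>"
  proof
    assume "S [^]\<^bsub>A\<^esub> (3::nat) = \<zero>\<^bsub>A\<^esub>"
    then have "const (c ^ 3) * ss ^ 3 \<in> K" unfolding S ring const_power quotient_facts(3) by simp
    from lin_kill[OF \<psi>(1)[of 3] this] have "lin (\<psi> 3) (ss ^ 3) = 0" using c by simp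
    then show False using \<psi>(4)[of 3 3] by simp
  qed
qed

end

section \<open>From a Lie algebra of type G2 to named Chevalley generators\<close>

lemma type_G2_generators:
  assumes g: "simple_lie_algebra_with_basis scale brk B n x f" and G2: "type_G2 scale brk"
  shows "\<exists>e0 e1 f0 f1 h0 h1. G2 scale brk B n x f e0 e1 f0 f1 h0 h1"
proof -
  interpret simple_lie_algebra_with_basis scale brk B n x f by (rule g)
  obtain e f' h where gen: "lie_subalgebra_generated scale brk (e ` {..<2} \<union> f' ` {..<2} \<union> h ` {..<2}) = UNIV"
    and rel: "\<And>i j. i < 2 \<Longrightarrow> j < 2 \<Longrightarrow> brk (h i) (h j) = 0 \<and>
        brk (e i) (f' j) = (if i = j then h i else 0) \<and>
        brk (h i) (e j) = scale (of_int (cartan_matrix_G2 i j)) (e j) \<and>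
        brk (h i) (f' j) = scale (- of_int (cartan_matrix_G2 i j)) (f' j) \<and>
        (i \<noteq> j \<longrightarrow> (brk (e i) ^^ nat (1 - cartan_matrix_G2 i j)) (e j) = 0 \<and>
                 (brk (f' i) ^^ nat (1 - cartan_matrix_G2 i j)) (f' j) = 0)"
    using G2 unfolding type_G2_def chevalley_serre_generated_def by blast
  have "e ` {..<2} \<union> f' ` {..<2} \<union> h ` {..<2} = {e 0, e 1, f' 0, f' 1, h 0, h 1}"
    by (auto simp: numeral_2_eq_2 lessThan_Suc)
  then have "lie_subalgebra_generated scale brk {e 0, e 1, f' 0, f' 1, h 0, h 1} = UNIV" using gen by simp
  \<comment> \<open>The off-diagonal Cartan entries -1 and -3 give the Serre exponents 2 and
    4.\<close>
  then have "G2 scale brk B n x f (e 0) (e 1) (f' 0) (f' 1) (h 0) (h 1)"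
    using rel[of 0 0] rel[of 0 1] rel[of 1 0] rel[of 1 1]
    by unfold_locales (simp_all add: cartan_matrix_G2_def numeral_2_eq_2 eval_nat_numeral)
  then show ?thesis by blast
qed

theorem mainTheorem1:
  fixes scale :: "complex \<Rightarrow> 'g::ab_group_add \<Rightarrow> 'g"
    and brk :: "'g \<Rightarrow> 'g \<Rightarrow> 'g"
    and B :: "'g \<Rightarrow> 'g \<Rightarrow> complex"
    and n :: nat and x :: "nat \<Rightarrow> 'g"
    and f :: "nat \<Rightarrow> nat \<Rightarrow> nat \<Rightarrow> complex"
    and c :: complex
    and A :: "('g \<times> 'g) free_alg set set ring"
    and S :: "('g \<times> 'g) free_alg set set"
  assumes g: "simple_lie_algebra_with_basis scale brk B n x f"
    and G2: "type_G2 scale brk"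
    and A: "A = algebra_A scale n x f"
    and c: "c \<noteq> 0"
    and S: "S = A_scalar scale n x f c \<otimes>\<^bsub>A\<^esub> S_element scale n x f"
  shows "S \<in> A_invariants scale brk n x f \<inter> A_bidegree scale n x f 1 1
    \<and> (\<forall>T \<in> A_invariants scale brk n x f \<inter> A_bidegree scale n x f 1 1.
          \<exists>a. T = A_scalar scale n x f a \<otimes>\<^bsub>A\<^esub> S)
    \<and> A_invariants scale brk n x f = subalgebra_generated A (A_scalar scale n x f) {S}
    \<and> S [^]\<^bsub>A\<^esub> (4::nat) = \<zero>\<^bsub>A\<^esub>
    \<and> S [^]\<^bsub>A\<^esub> (3::nat) \<noteq> \<zero>\<^bsub>A\<^esub>"
proof -
  obtain e0 e1 f0 f1 h0 h1 where "G2 scale brk B n x f e0 e1 f0 f1 h0 h1"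
    using type_G2_generators[OF g G2] by blast
  from G2.invariant_subalgebra[OF this c S[unfolded A]] show ?thesis unfolding A .
qed

end
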